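(* Let $n\ge 2$, let $\widetilde\Omega\subset\mathbf{R}^n$ be open and let $\varphi\in C^\infty(\widetilde\Omega;\mathbf{R})$ be a limiting Carleman weight on $\widetilde\Omega$ (in particular with nowhere vanishing gradient). Let $\Omega\subset\subset\widetilde\Omega$ be an open set with $C^\infty$ boundary and let $q\in L^\infty(\Omega)$. Let $\nu$ denote the exterior unit normal to $\partial\Omega$ and put $$\partial\Omega_\pm=\{x\in\partial\Omega;\ \pm\varphi'_x(x)\cdot\nu(x)\ge 0\}.$$ Then there exist constants $C_0>0$ and $h_0>0$ such that for every $u\in C^\infty(\overline\Omega)$ with $u|_{\partial\Omega}=0$ and all $0<h\le h_0$: $$-\frac{h^3}{C_0}\big((\varphi'_x\cdot\nu)e^{\varphi/h}\partial_\nu u\,\big|\,e^{\varphi/h}\partial_\nu u\big)_{\partial\Omega_-}+\frac{h^2}{C_0}\big(\|e^{\varphi/h}u\|^2+\|e^{\varphi/h}h\nabla u\|^2\big)$$ $$\le\ \|e^{\varphi/h}(-h^2\Delta+h^2q)u\|^2+C_0h^3\big((\varphi'_x\cdot\nu)e^{\varphi/h}\partial_\nu u\,\big|\,e^{\varphi/h}\partial_\nu u\big)_{\partial\Omega_+}.$$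
   Context: $\varphi'_x$ denotes the gradient of $\varphi$. A function $\varphi\in C^\infty(\widetilde\Omega;\mathbf{R})$ is called a limiting Carleman weight if $\varphi'_x(x)\neq 0$ for all $x\in\widetilde\Omega$ and, with $a(x,\xi)=\xi^2-(\varphi'_x(x))^2$, $b(x,\xi)=2\varphi'_x(x)\cdot\xi$ on $\widetilde\Omega\times\mathbf{R}^n$ (where $\xi^2=\xi\cdot\xi$), the Poisson bracket $\{a,b\}=a'_\xi\cdot b'_x-a'_x\cdot b'_\xi$ satisfies $\{a,b\}(x,\xi)=0$ whenever $a(x,\xi)=b(x,\xi)=0$. $\|\cdot\|$ is the norm of $L^2(\Omega)$, and $(f|g)_{\partial\Omega_\pm}=\int_{\partial\Omega_\pm}f\overline g\,dS$ with $dS$ the surface measure on $\partial\Omega$. *)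

theory Defs
  imports "HOL-Analysis.Analysis"
begin

section \<open>Smooth functions and differential operators\<close>

text \<open>All functions are total; only their values on the relevant open set matter.
  The set \<open>S\<close> is meant to be open.\<close>

primrec Ck_on :: "nat \<Rightarrow> 'a::real_normed_vector set \<Rightarrow> ('a \<Rightarrow> 'b::real_normed_vector) \<Rightarrow> bool" where
  "Ck_on 0 S f \<longleftrightarrow> continuous_on S f"
| "Ck_on (Suc k) S f \<longleftrightarrow>
     (\<forall>x\<in>S. f differentiable at x) \<and> (\<forall>v. Ck_on k S (\<lambda>x. frechet_derivative f (at x) v))"

definition smooth_on :: "'a::real_normed_vector set \<Rightarrow> ('a \<Rightarrow> 'b::real_normed_vector) \<Rightarrow> bool" where
  "smooth_on S f \<longleftrightarrow> (\<forall>k. Ck_on k S f)"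

text \<open>The space \<open>C\<^sup>\<infinity>\<close> of the closure of \<open>\<Omega>\<close>: restrictions of functions that are smooth in a
  neighbourhood of the closure. The representative \<open>u\<close> is already such an extension, so that its
  derivatives at boundary points are ordinary two-sided derivatives; at points of the closure
  of an open set with smooth boundary they do not depend on the extension.\<close>

definition smooth_on_closure :: "'a::real_normed_vector set \<Rightarrow> ('a \<Rightarrow> 'b::real_normed_vector) \<Rightarrow> bool" where
  "smooth_on_closure \<Omega> u \<longleftrightarrow> (\<exists>V. open V \<and> closure \<Omega> \<subseteq> V \<and> smooth_on V u)"

definition partial :: "'n::finite \<Rightarrow> (real^'n \<Rightarrow> 'b::real_normed_vector) \<Rightarrow> real^'n \<Rightarrow> 'b" where
  "partial i f x = frechet_derivative f (at x) (axis i 1)"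

definition grad :: "(real^'n::finite \<Rightarrow> 'b::real_normed_vector) \<Rightarrow> real^'n \<Rightarrow> 'b^'n" where
  "grad f x = (\<chi> i. partial i f x)"

definition laplacian :: "(real^'n::finite \<Rightarrow> 'b::real_normed_vector) \<Rightarrow> real^'n \<Rightarrow> 'b" where
  "laplacian f x = (\<Sum>i\<in>UNIV. partial i (partial i f) x)"


section \<open>Limiting Carleman weights\<close>

definition poisson_bracket ::
  "(real^'n::finite \<Rightarrow> real^'n \<Rightarrow> real) \<Rightarrow> (real^'n \<Rightarrow> real^'n \<Rightarrow> real) \<Rightarrow> real^'n \<Rightarrow> real^'n \<Rightarrow> real" where
  "poisson_bracket a b x \<xi> =
     grad (\<lambda>\<eta>. a x \<eta>) \<xi> \<bullet> grad (\<lambda>y. b y \<xi>) x - grad (\<lambda>y. a y \<xi>) x \<bullet> grad (\<lambda>\<eta>. b x \<eta>) \<xi>"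

definition symbol_a :: "(real^'n::finite \<Rightarrow> real) \<Rightarrow> real^'n \<Rightarrow> real^'n \<Rightarrow> real" where
  "symbol_a \<phi> x \<xi> = \<xi> \<bullet> \<xi> - grad \<phi> x \<bullet> grad \<phi> x"

definition symbol_b :: "(real^'n::finite \<Rightarrow> real) \<Rightarrow> real^'n \<Rightarrow> real^'n \<Rightarrow> real" where
  "symbol_b \<phi> x \<xi> = 2 * (grad \<phi> x \<bullet> \<xi>)"

definition limiting_carleman_weight :: "(real^'n::finite) set \<Rightarrow> (real^'n \<Rightarrow> real) \<Rightarrow> bool" where
  "limiting_carleman_weight S \<phi> \<longleftrightarrow>
     smooth_on S \<phi> \<and>
     (\<forall>x\<in>S. grad \<phi> x \<noteq> 0) \<and>
     (\<forall>x\<in>S. \<forall>\<xi>. symbol_a \<phi> x \<xi> = 0 \<and> symbol_b \<phi> x \<xi> = 0 \<longrightarrow>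
        poisson_bracket (symbol_a \<phi>) (symbol_b \<phi>) x \<xi> = 0)"


section \<open>Open sets with smooth boundary\<close>

text \<open>Inside the open set \<open>U\<close>, the set \<open>\<Omega>\<close> is the region strictly above (\<open>s = 1\<close>) or strictly
  below (\<open>s = -1\<close>) the graph \<open>x\<^sub>k = g x\<close> of a smooth function of the remaining coordinates.
  A function on the coordinate hyperplane \<open>x\<^sub>k = 0\<close> is encoded as a function \<open>g\<close> on the whole space
  that does not depend on the coordinate \<open>k\<close>.\<close>

definition graph_chart ::
  "(real^'n::finite) set \<Rightarrow> (real^'n) set \<Rightarrow> 'n \<Rightarrow> real \<Rightarrow> (real^'n \<Rightarrow> real) \<Rightarrow> bool" where
  "graph_chart \<Omega> U k s g \<longleftrightarrow>
     open U \<and> s \<in> {1, -1} \<and>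
     smooth_on UNIV g \<and> (\<forall>x t. g (x + t *\<^sub>R axis k 1) = g x) \<and>
     \<Omega> \<inter> U = {x \<in> U. s * (x $ k - g x) > 0}"

definition smooth_boundary :: "(real^'n::finite) set \<Rightarrow> bool" where
  "smooth_boundary \<Omega> \<longleftrightarrow> (\<forall>x\<in>frontier \<Omega>. \<exists>U k s g. x \<in> U \<and> graph_chart \<Omega> U k s g)"

text \<open>In a graph chart, \<open>s * (x\<^sub>k - g x)\<close> is positive in \<open>\<Omega>\<close> and vanishes on the boundary, so the
  exterior normal is minus its normalised gradient. All charts at \<open>x\<close> give the same vector.\<close>

definition outer_normal :: "(real^'n::finite) set \<Rightarrow> real^'n \<Rightarrow> real^'n" where
  "outer_normal \<Omega> x = (THE \<nu>. \<exists>U k s g. x \<in> U \<and> graph_chart \<Omega> U k s g \<and>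
     \<nu> = (s / sqrt (1 + (norm (grad g x))\<^sup>2)) *\<^sub>R (grad g x - axis k 1))"

text \<open>Lebesgue measure of dimension \<open>n - 1\<close> on the coordinate hyperplane \<open>x\<^sub>k = 0\<close>.\<close>

definition hyperplane_lborel :: "'n::finite \<Rightarrow> (real^'n) measure" where
  "hyperplane_lborel k =
     distr (\<Pi>\<^sub>M i\<in>UNIV - {k}. lborel) borel (\<lambda>y. \<chi> i. if i = k then 0 else y i)"

text \<open>The surface measure \<open>dS\<close> of the boundary, as a Borel measure on the whole space that is
  concentrated on the boundary and has density \<open>sqrt (1 + |\<nabla>g|\<^sup>2)\<close> in every graph chart. For a
  compact smooth boundary there is exactly one such measure: finitely many charts cover the boundary,
  and the change of variables formula shows that the prescriptions of different charts agree.\<close>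

definition is_surface_measure :: "(real^'n::finite) set \<Rightarrow> (real^'n) measure \<Rightarrow> bool" where
  "is_surface_measure \<Omega> \<sigma> \<longleftrightarrow>
     sets \<sigma> = sets borel \<and>
     emeasure \<sigma> (- frontier \<Omega>) = 0 \<and>
     (\<forall>U k s g A. graph_chart \<Omega> U k s g \<and> A \<in> sets borel \<and> A \<subseteq> frontier \<Omega> \<inter> U \<longrightarrow>
        emeasure \<sigma> A =
          (\<integral>\<^sup>+ y. ennreal (sqrt (1 + (norm (grad g y))\<^sup>2)) * indicator A (y + g y *\<^sub>R axis k 1)
             \<partial>hyperplane_lborel k))"

definition surface_measure :: "(real^'n::finite) set \<Rightarrow> (real^'n) measure" where
  "surface_measure \<Omega> = (SOME \<sigma>. is_surface_measure \<Omega> \<sigma>)"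


section \<open>Norms, boundary parts and boundary pairings\<close>

definition L_infty :: "(real^'n::finite) set \<Rightarrow> (real^'n \<Rightarrow> complex) set" where
  "L_infty \<Omega> = {q \<in> borel_measurable (lebesgue_on \<Omega>). \<exists>K. AE x in lebesgue_on \<Omega>. norm (q x) \<le> K}"

definition L2norm_on :: "(real^'n::finite) set \<Rightarrow> (real^'n \<Rightarrow> 'b::real_normed_vector) \<Rightarrow> real" where
  "L2norm_on \<Omega> f = sqrt (\<integral>x. (norm (f x))\<^sup>2 \<partial>lebesgue_on \<Omega>)"

definition boundary_plus :: "(real^'n::finite) set \<Rightarrow> (real^'n \<Rightarrow> real) \<Rightarrow> (real^'n) set" where
  "boundary_plus \<Omega> \<phi> = {x \<in> frontier \<Omega>. grad \<phi> x \<bullet> outer_normal \<Omega> x \<ge> 0}"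

definition boundary_minus :: "(real^'n::finite) set \<Rightarrow> (real^'n \<Rightarrow> real) \<Rightarrow> (real^'n) set" where
  "boundary_minus \<Omega> \<phi> = {x \<in> frontier \<Omega>. - (grad \<phi> x \<bullet> outer_normal \<Omega> x) \<ge> 0}"

definition boundary_pairing ::
  "(real^'n::finite) set \<Rightarrow> (real^'n) set \<Rightarrow> (real^'n \<Rightarrow> complex) \<Rightarrow> (real^'n \<Rightarrow> complex) \<Rightarrow> complex" where
  "boundary_pairing \<Omega> \<Gamma> f g = set_lebesgue_integral (surface_measure \<Omega>) \<Gamma> (\<lambda>x. f x * cnj (g x))"

definition normal_deriv ::
  "(real^'n::finite) set \<Rightarrow> (real^'n \<Rightarrow> 'b::real_normed_vector) \<Rightarrow> real^'n \<Rightarrow> 'b" where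
  "normal_deriv \<Omega> u x = frechet_derivative u (at x) (outer_normal \<Omega> x)"

text \<open>The pairing of \<open>(\<phi>'\<^sub>x \<cdot> \<nu>) e\<^bsup>\<phi>/h\<^esup> \<partial>\<^sub>\<nu>u\<close> with \<open>e\<^bsup>\<phi>/h\<^esup> \<partial>\<^sub>\<nu>u\<close> over \<open>\<Gamma>\<close>. It is a complex number
  with vanishing imaginary part; \<open>Re\<close> makes it comparable with reals.\<close>

definition boundary_term ::
  "(real^'n::finite) set \<Rightarrow> (real^'n) set \<Rightarrow> (real^'n \<Rightarrow> real) \<Rightarrow> real \<Rightarrow> (real^'n \<Rightarrow> complex) \<Rightarrow> real" where
  "boundary_term \<Omega> \<Gamma> \<phi> h u =
     Re (boundary_pairing \<Omega> \<Gamma>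
       (\<lambda>x. (grad \<phi> x \<bullet> outer_normal \<Omega> x) *\<^sub>R exp (\<phi> x / h) *\<^sub>R normal_deriv \<Omega> u x)
       (\<lambda>x. exp (\<phi> x / h) *\<^sub>R normal_deriv \<Omega> u x))"

end

theory Submission
  imports Defs
begin

text \<open>Conjugating \<open>- h\<^sup>2 \<Delta>\<close> with \<open>e\<^bsup>\<psi>/h\<^esup>\<close>, where \<open>\<psi> = \<phi> + h \<phi>\<^sup>2 / (2 \<epsilon>)\<close>, gives \<open>S + T\<close> with
  \<open>S\<close> symmetric and \<open>T\<close> antisymmetric. Green's formula turns \<open>2 (S v | T v)\<close> into the boundary term
  \<open>- 2 h\<^sup>3 \<integral> \<partial>\<^sub>\<nu>\<psi> (\<partial>\<^sub>\<nu>v)\<^sup>2\<close> plus \<open>h\<close> times the bracket \<open>{a, b}\<close> of \<open>\<psi>\<close>, as a quadratic form in \<open>(h \<nabla>v, v)\<close>. Since \<open>\<phi>\<close> is a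
  limiting Carleman weight, this quadratic form equals multiples of \<open>S v\<close> and \<open>T v\<close>, which are absorbed by
  \<open>\<parallel>S v\<parallel>\<^sup>2 + \<parallel>T v\<parallel>\<^sup>2\<close>, plus a gain of order \<open>h\<^sup>2 / \<epsilon>\<close> from the convexification, which for small \<open>\<epsilon>\<close>
  dominates all errors of order \<open>h\<^sup>2\<close>. For fixed \<open>\<epsilon>\<close> the factor \<open>e\<^bsup>\<phi>\<^sup>2/(2\<epsilon>)\<^esup>\<close> is bounded above and below.
  Real and imaginary parts are treated separately and \<open>q\<close> is a perturbation of order \<open>h\<^sup>2\<close>.

  Two charts of the boundary give the same measure because both represent the distributional gradient
  of the indicator function of the domain; no change of variables is needed.\<close>

section \<open>Integration along a coordinate direction\<close>

text \<open>On the characteristic set the bracket of a limiting weight is zero, so by itself it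
  yields no positivity. Convexification, with t = h / \<epsilon>, adds the rank one form t
  (\<nabla>\<phi> . \<xi>)^2 to the Hessian of the weight. This produces two squares of weight h t =
  h^2 / \<epsilon>: one in \<open>v\<close>, the other in the derivative of \<open>v\<close> along
  \<nabla>\<phi>. The remaining components of the gradient are regained by pairing \<open>v\<close>
  with \<open>S v\<close>, whose leading part integrates to h^2 |\<nabla>v|^2; a small multiple
  \<kappa> t h of that identity is added. The whole commutator computation is phrased as a pointwise
  inequality modulo an exact divergence, so no operators or domains have to be set up, and the
  boundary term is the flux of this divergence.

  Each integration by parts moves one derivative, so continuous differentiability is enough
  throughout the divergence theorem, and cutoffs can be built from squares of positive parts. The
  boundary measure is given by \<open>SOME\<close> and the normal by \<open>THE\<close>; existence
  of the first and uniqueness of the second must be settled before any boundary integral can be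
  computed.\<close>

lemma axis_cart_nth: "(axis i (1::real) :: real^'n::finite) $ j = (if j = i then 1 else 0)"
  by (simp add: axis_def)

lemma prod_Basis_vec:
  fixes f :: "real^'n::finite \<Rightarrow> 'b::comm_monoid_mult"
  shows "(\<Prod>b\<in>Basis. f b) = (\<Prod>i\<in>UNIV. f (axis i 1))"
proof -
  have B: "(Basis :: (real^'n) set) = (\<lambda>i. axis i 1) ` UNIV"
    by (auto simp: Basis_vec_def)
  have I: "inj (\<lambda>i. axis i (1::real) :: real^'n)"
    by (auto intro!: injI simp: axis_eq_axis)
  show ?thesis unfolding B by (subst prod.reindex[OF I]) (simp add: comp_def)
qed

lemma measurable_vec_lambda [measurable (raw)]:
  assumes "\<And>i. (\<lambda>x. f x i) \<in> borel_measurable M"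
  shows "(\<lambda>x. (\<chi> i. f x i) :: real^'n::finite) \<in> borel_measurable M"
proof (rule borel_measurable_euclidean_space[THEN iffD2], rule ballI)
  fix b :: "real^'n" assume "b \<in> Basis"
  then obtain i where "b = axis i 1" by (auto simp: Basis_vec_def)
  then show "(\<lambda>x. (\<chi> i. f x i) \<bullet> b) \<in> borel_measurable M"
    using assms by (simp add: inner_axis)
qed

interpretation lborel_product: product_sigma_finite "\<lambda>_. lborel :: real measure"
  by standard

text \<open>A measure giving every box the product of its side lengths is Lebesgue measure. The
  product form opens the way to splitting off a single coordinate.\<close>

lemma lborel_vec:
  "(lborel :: (real^'n::finite) measure) = distr (\<Pi>\<^sub>M i\<in>UNIV. lborel) borel (\<lambda>f. \<chi> i. f i)"
proof (rule lborel_eqI)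
  fix l u :: "real^'n" assume le: "\<And>b. b \<in> Basis \<Longrightarrow> l \<bullet> b \<le> u \<bullet> b"
  have le': "l $ i \<le> u $ i" for i
    using le[of "axis i 1"] by (simp add: inner_axis)
  have eq: "(\<lambda>f. (\<chi> i. f i) :: real^'n) -` box l u \<inter> space (\<Pi>\<^sub>M i\<in>UNIV. lborel) =
      (\<Pi>\<^sub>E i\<in>UNIV. {l$i <..< u$i})"
    by (auto simp: space_PiM mem_box_cart PiE_def Pi_def)
  have "emeasure (distr (\<Pi>\<^sub>M i\<in>UNIV. lborel) borel (\<lambda>f. (\<chi> i. f i) :: real^'n)) (box l u) =
      emeasure (\<Pi>\<^sub>M i\<in>UNIV. lborel) (\<Pi>\<^sub>E i\<in>UNIV. {l$i <..< u$i})"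
    by (subst emeasure_distr) (auto simp: eq)
  also have "\<dots> = (\<Prod>i\<in>UNIV. emeasure lborel {l$i <..< u$i})"
    by (rule lborel_product.emeasure_PiM) auto
  also have "\<dots> = ennreal (\<Prod>i\<in>UNIV. (u - l) $ i)"
    by (simp add: le' prod_ennreal)
  finally show "emeasure (distr (\<Pi>\<^sub>M i\<in>UNIV. lborel) borel (\<lambda>f. (\<chi> i. f i) :: real^'n)) (box l u) =
      (\<Prod>b\<in>Basis. (u - l) \<bullet> b)"
    by (simp add: prod_Basis_vec inner_axis)
qed simp

lemma sets_hyperplane_lborel [measurable_cong, simp]: "sets (hyperplane_lborel k) = sets borel"
  by (simp add: hyperplane_lborel_def)

lemma space_hyperplane_lborel [simp]: "space (hyperplane_lborel k) = UNIV"
  by (simp add: hyperplane_lborel_def)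

lemma measurable_hyperplane_embedding:
  "(\<lambda>y. \<chi> i. if i = k then 0 else y i) \<in> (\<Pi>\<^sub>M i\<in>UNIV - {k}. lborel) \<rightarrow>\<^sub>M (borel :: (real^'n::finite) measure)"
proof (rule measurable_vec_lambda)
  fix i show "(\<lambda>y. if i = k then 0 else y i) \<in> borel_measurable (\<Pi>\<^sub>M i\<in>UNIV - {k}. lborel)"
    by (cases "i = k") auto
qed

lemma AE_hyperplane_lborel: "AE y in hyperplane_lborel k. y $ k = 0"
  unfolding hyperplane_lborel_def
  by (subst AE_distr_iff) (auto intro!: measurable_hyperplane_embedding)

text \<open>Tonelli's theorem for the product measure with the factor \<open>k\<close> inserted
  last. The inner integrals run over lines parallel to the \<open>k\<close>-th axis, where the
  one-dimensional fundamental theorem applies.\<close>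

lemma nn_integral_lborel_hyperplane:
  fixes f :: "real^'n::finite \<Rightarrow> ennreal"
  assumes [measurable]: "f \<in> borel_measurable borel"
  shows "(\<integral>\<^sup>+x. f x \<partial>lborel) = (\<integral>\<^sup>+y. \<integral>\<^sup>+t. f (y + t *\<^sub>R axis k 1) \<partial>lborel \<partial>hyperplane_lborel k)"
proof -
  have [measurable]: "(\<lambda>f. (\<chi> i. f i) :: real^'n) \<in> (\<Pi>\<^sub>M i\<in>UNIV. lborel) \<rightarrow>\<^sub>M borel"
    by (intro measurable_vec_lambda) auto
  have U: "insert k (UNIV - {k}) = UNIV" by auto
  have "(\<integral>\<^sup>+x. f x \<partial>lborel) = (\<integral>\<^sup>+x. f (\<chi> i. x i) \<partial>(\<Pi>\<^sub>M i\<in>insert k (UNIV - {k}). lborel))"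
    unfolding U by (subst lborel_vec, subst nn_integral_distr) auto
  also have "\<dots> = (\<integral>\<^sup>+x. \<integral>\<^sup>+t. f (\<chi> i. (x(k := t)) i) \<partial>lborel \<partial>(\<Pi>\<^sub>M i\<in>UNIV - {k}. lborel))"
    by (rule lborel_product.product_nn_integral_insert) (auto simp: U)
  also have "\<dots> = (\<integral>\<^sup>+x. \<integral>\<^sup>+t. f ((\<chi> i. if i = k then 0 else x i) + t *\<^sub>R axis k 1) \<partial>lborel \<partial>(\<Pi>\<^sub>M i\<in>UNIV - {k}. lborel))"
    by (intro nn_integral_cong arg_cong[where f=f]) (auto simp: vec_eq_iff axis_cart_nth)
  also have "\<dots> = (\<integral>\<^sup>+y. \<integral>\<^sup>+t. f (y + t *\<^sub>R axis k 1) \<partial>lborel \<partial>hyperplane_lborel k)"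
    unfolding hyperplane_lborel_def
    by (subst nn_integral_distr) (auto intro!: measurable_hyperplane_embedding lborel.borel_measurable_nn_integral)
  finally show ?thesis .
qed

lemma emeasure_hyperplane_lborel_cbox:
  fixes k :: "'n::finite"
  shows "emeasure (hyperplane_lborel k) (cbox a b) < \<infinity>"
proof -
  have "(\<lambda>y. (\<chi> i. if i = k then 0 else y i) :: real^'n) -` cbox a b \<inter> space (\<Pi>\<^sub>M i\<in>UNIV - {k}. lborel) \<subseteq>
      (\<Pi>\<^sub>E i\<in>UNIV - {k}. {a$i .. b$i})"
  proof (clarsimp simp: space_PiM mem_box_cart PiE_def Pi_def)
    fix x i assume *: "\<forall>i. a $ i \<le> (if i = k then 0 else x i) \<and> (if i = k then 0 else x i) \<le> b $ i" and "i \<noteq> k"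
    with *[rule_format, of i] show "a $ i \<le> x i \<and> x i \<le> b $ i" by simp
  qed
  then have "emeasure (hyperplane_lborel k) (cbox a b) \<le> emeasure (\<Pi>\<^sub>M i\<in>UNIV - {k}. lborel) (\<Pi>\<^sub>E i\<in>UNIV - {k}. {a$i .. b$i})"
    unfolding hyperplane_lborel_def
    by (subst emeasure_distr) (auto intro!: measurable_hyperplane_embedding emeasure_mono)
  also have "\<dots> = (\<Prod>i\<in>UNIV - {k}. emeasure lborel {a$i .. b$i})"
    by (rule lborel_product.emeasure_PiM) auto
  also have "\<dots> < \<infinity>"
    by (simp add: emeasure_lborel_Icc_eq prod_ennreal)
  finally show ?thesis .
qed

lemma sigma_finite_hyperplane_lborel: "sigma_finite_measure (hyperplane_lborel (k::'n::finite))"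
proof
  have "\<exists>n::nat. x \<in> cbox (- (\<chi> i. real n)) (\<chi> i. real n)" for x :: "real^'n"
  proof -
    obtain n where "norm x \<le> real n" using real_arch_simple by blast
    then have "\<bar>x $ i\<bar> \<le> real n" for i using component_le_norm_cart[of x i] by simp
    then show ?thesis by (auto simp: mem_box_cart abs_le_iff) (metis minus_le_iff)
  qed
  then show "\<exists>A. countable A \<and> A \<subseteq> sets (hyperplane_lborel k) \<and> \<Union> A = space (hyperplane_lborel k) \<and>
     (\<forall>a\<in>A. emeasure (hyperplane_lborel k) a \<noteq> \<infinity>)"
    by (intro exI[of _ "range (\<lambda>n::nat. cbox (- (\<chi> i. real n)) (\<chi> i. real n))"])
       (use emeasure_hyperplane_lborel_cbox in \<open>auto simp: less_top\<close>)
qed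

text \<open>As the image of a product of two sigma-finite measures, Lebesgue measure also admits
  Fubini's theorem for integrands without a sign.\<close>

lemma lborel_eq_hyperplane_line:
  "(lborel :: (real^'n::finite) measure) =
     distr (hyperplane_lborel k \<Otimes>\<^sub>M lborel) borel (\<lambda>(y, t). y + t *\<^sub>R axis k 1)"
proof (rule measure_eqI)
  fix A :: "(real^'n) set" assume "A \<in> sets lborel"
  then have [measurable]: "A \<in> sets borel" by simp
  have "emeasure lborel A = (\<integral>\<^sup>+x. indicator A x \<partial>lborel)" by simp
  also have "\<dots> = (\<integral>\<^sup>+y. \<integral>\<^sup>+t. indicator A (y + t *\<^sub>R axis k 1) \<partial>lborel \<partial>hyperplane_lborel k)"
    by (rule nn_integral_lborel_hyperplane) simp
  also have "\<dots> = (\<integral>\<^sup>+z. indicator A ((\<lambda>(y, t). y + t *\<^sub>R axis k 1) z) \<partial>(hyperplane_lborel k \<Otimes>\<^sub>M lborel))"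
    by (subst lborel.nn_integral_fst[symmetric]) (auto simp: split_beta)
  also have "\<dots> = (\<integral>\<^sup>+x. indicator A x \<partial>distr (hyperplane_lborel k \<Otimes>\<^sub>M lborel) borel (\<lambda>(y, t). y + t *\<^sub>R axis k 1))"
    by (subst nn_integral_distr) auto
  also have "\<dots> = emeasure (distr (hyperplane_lborel k \<Otimes>\<^sub>M lborel) borel (\<lambda>(y, t). y + t *\<^sub>R axis k 1)) A"
    by simp
  finally show "emeasure lborel A = \<dots>" .
qed simp

lemma integral_lborel_hyperplane:
  fixes f :: "real^'n::finite \<Rightarrow> real"
  assumes f: "integrable lborel f"
  shows "(\<integral>x. f x \<partial>lborel) = (\<integral>y. \<integral>t. f (y + t *\<^sub>R axis k 1) \<partial>lborel \<partial>hyperplane_lborel k)"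
proof -
  interpret sigma_finite_measure "hyperplane_lborel k" by (rule sigma_finite_hyperplane_lborel)
  interpret pair_sigma_finite "hyperplane_lborel k" "lborel :: real measure" ..
  have [measurable]: "f \<in> borel_measurable borel" using f by simp
  have int: "integrable (hyperplane_lborel k \<Otimes>\<^sub>M lborel) (\<lambda>z. f ((\<lambda>(y, t). y + t *\<^sub>R axis k 1) z))"
    using f by (subst (asm) lborel_eq_hyperplane_line[of k], subst (asm) integrable_distr_eq) auto
  have "(\<integral>x. f x \<partial>lborel) = (\<integral>z. f ((\<lambda>(y, t). y + t *\<^sub>R axis k 1) z) \<partial>(hyperplane_lborel k \<Otimes>\<^sub>M lborel))"
    by (subst lborel_eq_hyperplane_line[of k], subst integral_distr) auto
  also have "\<dots> = (\<integral>y. \<integral>t. f (y + t *\<^sub>R axis k 1) \<partial>lborel \<partial>hyperplane_lborel k)"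
    using integral_fst'[OF int] by simp
  finally show ?thesis .
qed

text \<open>The fundamental theorem of calculus on an interval with both ends outside the support.
  Over a half line the end point 0 survives; \<open>s\<close> selects the half line and thereby the
  sign. This is the only place where a boundary value arises.\<close>

lemma integral_derivative_compact_support:
  fixes f f' :: "real \<Rightarrow> real"
  assumes der: "\<And>t. (f has_real_derivative f' t) (at t)"
    and cont: "continuous_on UNIV f'"
    and supp: "\<And>t. \<bar>t\<bar> > R \<Longrightarrow> f t = 0" "\<And>t. \<bar>t\<bar> > R \<Longrightarrow> f' t = 0"
  shows "(\<integral>t. f' t \<partial>lborel) = 0"
    and "s \<in> {1, -1} \<Longrightarrow> (\<integral>t. indicator {t. s * t > 0} t * f' t \<partial>lborel) = - s * f 0"
proof -
  \<comment> \<open>\<open>R\<close> may be negative or attained by the support; \<open>r\<close> is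
    positive and beyond it.\<close>
  define r where "r = \<bar>R\<bar> + 1"
  have r: "r > 0" "f r = 0" "f (- r) = 0" "\<And>t. \<bar>t\<bar> > r \<Longrightarrow> f' t = 0"
    using supp by (auto simp: r_def)
  have zero: "f' t = 0" if "\<not> (- r \<le> t \<and> t \<le> r)" for t
    using that by (intro r(4)) linarith
  have FTC: "(\<integral>t. f' t * indicator {a..b} t \<partial>lborel) = f b - f a" if "a \<le> b" for a b
    using that der cont
    by (intro integral_FTC_Icc_real) (auto intro: continuous_on_interior[of UNIV])
  have "(\<integral>t. f' t \<partial>lborel) = (\<integral>t. f' t * indicator {-r..r} t \<partial>lborel)"
    using zero by (intro Bochner_Integration.integral_cong) (auto simp: indicator_def)
  then show "(\<integral>t. f' t \<partial>lborel) = 0"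
    using FTC[of "-r" r] r by simp
  assume s: "s \<in> {1, -1}"
  have AE0: "AE t in lborel. t \<noteq> (0::real)" by (rule AE_lborel_singleton)
  have m: "f' \<in> borel_measurable borel" using cont by (rule borel_measurable_continuous_onI)
  show "(\<integral>t. indicator {t. s * t > 0} t * f' t \<partial>lborel) = - s * f 0"
  proof (cases "s = 1")
    case True
    have "(\<integral>t. indicator {t. s * t > 0} t * f' t \<partial>lborel) = (\<integral>t. f' t * indicator {0..r} t \<partial>lborel)"
      using AE0 zero m True by (intro integral_cong_AE) (auto simp: indicator_def)
    then show ?thesis using FTC[of 0 r] r True by simp
  next
    case False
    then have "s = -1" using s by simp
    have "(\<integral>t. indicator {t. s * t > 0} t * f' t \<partial>lborel) = (\<integral>t. f' t * indicator {-r..0} t \<partial>lborel)"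
      using AE0 zero m \<open>s = -1\<close> by (intro integral_cong_AE) (auto simp: indicator_def)
    then show ?thesis using FTC[of "-r" 0] r \<open>s = -1\<close> by simp
  qed
qed

section \<open>Functions with continuous gradient\<close>

text \<open>The regularity class of all integration formulas below. The gradient is an explicit
  argument, so that the rules in \<open>C1_intros\<close> assemble it by unification, even in places
  where only its existence is claimed.\<close>

definition C1_grad :: "'a::real_inner set \<Rightarrow> ('a \<Rightarrow> real) \<Rightarrow> ('a \<Rightarrow> 'a) \<Rightarrow> bool" where
  "C1_grad V F F' \<longleftrightarrow> (\<forall>x\<in>V. GDERIV F x :> F' x) \<and> continuous_on V F'"

lemma C1_grad_GDERIV: "C1_grad V F F' \<Longrightarrow> x \<in> V \<Longrightarrow> GDERIV F x :> F' x"
  by (simp add: C1_grad_def)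

lemma C1_grad_has_derivative: "C1_grad V F F' \<Longrightarrow> x \<in> V \<Longrightarrow> (F has_derivative (\<lambda>h. F' x \<bullet> h)) (at x)"
  by (simp add: C1_grad_def gderiv_def inner_commute)

lemma C1_grad_continuous: "C1_grad V F F' \<Longrightarrow> continuous_on V F"
  by (meson C1_grad_has_derivative continuous_at_imp_continuous_on has_derivative_continuous)

lemma C1_grad_continuous_grad: "C1_grad V F F' \<Longrightarrow> continuous_on V F'"
  by (simp add: C1_grad_def)

lemma C1_grad_subset: "C1_grad V F F' \<Longrightarrow> W \<subseteq> V \<Longrightarrow> C1_grad W F F'"
  by (auto simp: C1_grad_def intro: continuous_on_subset)

lemma C1_grad_cong:
  assumes "C1_grad V F F'" "\<And>x. x \<in> V \<Longrightarrow> F' x = G' x"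
  shows "C1_grad V F G'"
  using assms by (auto simp: C1_grad_def cong: continuous_on_cong)

lemma C1_grad_cong_open:
  assumes "C1_grad V F F'" "open V" "\<And>x. x \<in> V \<Longrightarrow> F x = G x"
  shows "C1_grad V G F'"
  using assms unfolding C1_grad_def gderiv_def
  by (meson has_derivative_transform_within_open)

named_theorems C1_intros

lemma C1_grad_const [C1_intros]: "C1_grad V (\<lambda>_. c) (\<lambda>_. 0)"
  by (simp add: C1_grad_def GDERIV_const)

lemma C1_grad_add [C1_intros]:
  "C1_grad V F F' \<Longrightarrow> C1_grad V G G' \<Longrightarrow> C1_grad V (\<lambda>x. F x + G x) (\<lambda>x. F' x + G' x)"
  by (auto simp: C1_grad_def intro!: GDERIV_add continuous_intros)

lemma C1_grad_minus [C1_intros]: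
  "C1_grad V F F' \<Longrightarrow> C1_grad V (\<lambda>x. - F x) (\<lambda>x. - F' x)"
  by (auto simp: C1_grad_def intro!: GDERIV_minus continuous_intros)

lemma C1_grad_diff [C1_intros]:
  "C1_grad V F F' \<Longrightarrow> C1_grad V G G' \<Longrightarrow> C1_grad V (\<lambda>x. F x - G x) (\<lambda>x. F' x - G' x)"
  by (auto simp: C1_grad_def intro!: GDERIV_diff continuous_intros)

lemma C1_grad_mult [C1_intros]:
  assumes "C1_grad V F F'" "C1_grad V G G'"
  shows "C1_grad V (\<lambda>x. F x * G x) (\<lambda>x. F x *\<^sub>R G' x + G x *\<^sub>R F' x)"
  using assms C1_grad_continuous[OF assms(1)] C1_grad_continuous[OF assms(2)]
  by (auto simp: C1_grad_def intro!: GDERIV_mult continuous_intros)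

lemma C1_grad_sum [C1_intros]:
  assumes "\<And>i. i \<in> I \<Longrightarrow> C1_grad V (F i) (F' i)"
  shows "C1_grad V (\<lambda>x. \<Sum>i\<in>I. F i x) (\<lambda>x. \<Sum>i\<in>I. F' i x)"
  using assms by (induction I rule: infinite_finite_induct) (auto intro!: C1_intros)

lemma C1_grad_compose:
  fixes f f' :: "real \<Rightarrow> real"
  assumes F: "C1_grad V F F'"
    and f: "\<And>x. x \<in> V \<Longrightarrow> (f has_real_derivative f' (F x)) (at (F x))"
    and c: "continuous_on (F ` V) f'"
  shows "C1_grad V (\<lambda>x. f (F x)) (\<lambda>x. f' (F x) *\<^sub>R F' x)"
  unfolding C1_grad_def
proof (intro conjI ballI)
  show "GDERIV (\<lambda>x. f (F x)) x :> f' (F x) *\<^sub>R F' x" if "x \<in> V" for x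
    by (rule GDERIV_DERIV_compose[OF C1_grad_GDERIV[OF F that] f[OF that]])
  show "continuous_on V (\<lambda>x. f' (F x) *\<^sub>R F' x)"
    by (intro continuous_intros continuous_on_compose2[OF c C1_grad_continuous[OF F]] C1_grad_continuous_grad[OF F]) auto
qed

lemma C1_grad_exp [C1_intros]:
  "C1_grad V F F' \<Longrightarrow> C1_grad V (\<lambda>x. exp (F x)) (\<lambda>x. exp (F x) *\<^sub>R F' x)"
  by (rule C1_grad_compose) (auto intro!: derivative_eq_intros continuous_intros)

lemma C1_grad_inverse [C1_intros]:
  assumes "C1_grad V F F'" "\<And>x. x \<in> V \<Longrightarrow> F x \<noteq> 0"
  shows "C1_grad V (\<lambda>x. inverse (F x)) (\<lambda>x. - (inverse (F x))\<^sup>2 *\<^sub>R F' x)"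
  using assms
  by (intro C1_grad_compose) (auto intro!: derivative_eq_intros continuous_intros simp: power2_eq_square)

lemma C1_grad_component [C1_intros]:
  "C1_grad V (\<lambda>x::real^'n::finite. x $ i) (\<lambda>_. axis i 1)"
  by (auto simp: C1_grad_def gderiv_def inner_axis intro!: bounded_linear_imp_has_derivative bounded_linear_vec_nth)

text \<open>Transfers support conditions from a function to its gradient.\<close>

lemma C1_grad_zero_on_open:
  assumes "C1_grad V F F'" "open W" "W \<subseteq> V" "\<And>x. x \<in> W \<Longrightarrow> F x = 0" "x \<in> W"
  shows "F' x = 0"
proof -
  have "(F has_derivative (\<lambda>h. F' x \<bullet> h)) (at x)" using assms by (intro C1_grad_has_derivative[of V]) auto
  moreover have "(F has_derivative (\<lambda>h. 0)) (at x)"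
    by (rule has_derivative_transform_within_open[where f="\<lambda>_. 0", OF _ assms(2,5)]) (auto simp: assms(4))
  ultimately have "(\<lambda>h. F' x \<bullet> h) = (\<lambda>h. 0)" by (rule has_derivative_unique)
  then have "F' x \<bullet> F' x = 0" by meson
  then show ?thesis by simp
qed

lemma C1_grad_line:
  fixes F :: "real^'n::finite \<Rightarrow> real"
  assumes "C1_grad UNIV F F'"
  shows "((\<lambda>t. F (x + t *\<^sub>R axis k 1)) has_real_derivative F' (x + t *\<^sub>R axis k 1) $ k) (at t)"
proof -
  have "((\<lambda>t. F (x + t *\<^sub>R axis k 1)) has_derivative (\<lambda>h. F' (x + t *\<^sub>R axis k 1) \<bullet> (h *\<^sub>R axis k 1))) (at t)"
    by (rule has_derivative_compose[OF _ C1_grad_has_derivative[OF assms]])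
       (auto intro!: derivative_eq_intros)
  moreover have "(\<lambda>h. F' (x + t *\<^sub>R axis k 1) \<bullet> (h *\<^sub>R axis k 1)) = (*) (F' (x + t *\<^sub>R axis k 1) $ k)"
    by (auto simp: inner_axis)
  ultimately show ?thesis
    by (simp add: has_field_derivative_def)
qed

section \<open>The divergence theorem over and under a graph\<close>

lemma integrable_bounded_support:
  fixes f :: "real^'n::finite \<Rightarrow> real"
  assumes "f \<in> borel_measurable borel" "\<And>x. norm x \<le> R \<Longrightarrow> \<bar>f x\<bar> \<le> B" "\<And>x. norm x > R \<Longrightarrow> f x = 0"
  shows "integrable lborel f"
proof (rule Bochner_Integration.integrable_bound)
  show "integrable lborel (\<lambda>x::real^'n. B * indicator (cball 0 R) x :: real)"
    by (intro integrable_mult_right integrable_real_indicator) (use emeasure_lborel_cball_finite[of "0::real^'n" R] in auto)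
  have "norm (f x) \<le> norm (B * indicator (cball 0 R) x :: real)" for x
    using assms(2)[of x] assms(3)[of x] by (cases "norm x \<le> R") (auto simp: indicator_def)
  then show "AE x in lborel. norm (f x) \<le> norm (B * indicator (cball 0 R) x :: real)" by simp
qed (use assms in simp)

lemma continuous_bounded_cball:
  fixes f :: "real^'n::finite \<Rightarrow> 'b::real_normed_vector"
  assumes "continuous_on UNIV f"
  shows "\<exists>B. \<forall>x. norm x \<le> R \<longrightarrow> norm (f x) \<le> B"
proof -
  have "compact (f ` cball 0 R)"
    using assms by (intro compact_continuous_image) (auto intro: continuous_on_subset)
  then obtain B where "\<forall>y\<in>f ` cball 0 R. norm y \<le> B"
    using compact_imp_bounded bounded_iff by blast
  then show ?thesis by (intro exI[of _ B]) auto
qed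

text \<open>Along each line in direction \<open>k\<close> the weight is a constant factor, so it
  needs no smoothness. Below it is a derivative of the graph function, or the indicator of a half
  space in another coordinate.\<close>

lemma integral_weighted_partial:
  fixes f :: "real^'n::finite \<Rightarrow> real"
  assumes f: "C1_grad UNIV f f'" and supp: "\<And>x. norm x > R \<Longrightarrow> f x = 0"
    and w[measurable]: "w \<in> borel_measurable borel" and wB: "\<And>x. norm x \<le> R \<Longrightarrow> \<bar>w x\<bar> \<le> B"
    and wk: "\<And>x t. w (x + t *\<^sub>R axis k 1) = w x"
  shows "integrable lborel (\<lambda>x. w x * f' x $ k)"
    and "(\<integral>x. w x * f' x $ k \<partial>lborel) = 0"
    and "integrable lborel (\<lambda>x. indicator {x. s * x $ k > 0} x * (w x * f' x $ k))"
    and "s \<in> {1, -1} \<Longrightarrow> (\<integral>x. indicator {x. s * x $ k > 0} x * (w x * f' x $ k) \<partial>lborel) =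
      - s * (\<integral>y. w y * f y \<partial>hyperplane_lborel k)"
proof -
  have cf: "continuous_on UNIV f" and cf': "continuous_on UNIV f'"
    using f C1_grad_continuous C1_grad_continuous_grad by auto
  have [measurable]: "f \<in> borel_measurable borel" using cf by (rule borel_measurable_continuous_onI)
  have cf'k: "continuous_on UNIV (\<lambda>x. f' x $ k)" by (intro continuous_intros cf')
  have [measurable]: "(\<lambda>x. f' x $ k) \<in> borel_measurable borel" using cf'k by (rule borel_measurable_continuous_onI)
  have supp': "f' x = 0" if "norm x > R" for x
    using f by (rule C1_grad_zero_on_open[where W="{x. norm x > R}"]) (use supp that in \<open>auto intro!: open_Collect_less continuous_intros\<close>)
  obtain B' where B': "\<And>x. norm x \<le> R \<Longrightarrow> \<bar>f' x $ k\<bar> \<le> B'"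
    using continuous_bounded_cball[OF cf'k, of R] by auto
  have bd: "\<bar>w x * f' x $ k\<bar> \<le> B * B'" if "norm x \<le> R" for x
    unfolding abs_mult using wB[OF that] B'[OF that] by (intro mult_mono) auto
  show int: "integrable lborel (\<lambda>x. w x * f' x $ k)"
    using bd supp' by (intro integrable_bounded_support[where R=R and B="B * B'"]) auto
  have [measurable]: "{x::real^'n. s * x $ k > 0} \<in> sets borel"
    by measurable
  show int2: "integrable lborel (\<lambda>x. indicator {x. s * x $ k > 0} x * (w x * f' x $ k))"
    using integrable_real_mult_indicator[OF _ int, of "{x. s * x $ k > 0}"] by (simp add: mult.commute)
  let ?l = "\<lambda>y t. y + t *\<^sub>R axis k 1 :: real^'n"
  have far: "norm (?l y t) > R" if "y $ k = 0" "\<bar>t\<bar> > R" for y t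
    using component_le_norm_cart[of "?l y t" k] that by (simp add: axis_cart_nth)
  have cl: "continuous_on UNIV (\<lambda>t. f' (?l y t) $ k)" for y
    by (intro continuous_intros continuous_on_compose2[OF cf']) auto
  have AE: "AE y in hyperplane_lborel k. y $ k = (0::real)" by (rule AE_hyperplane_lborel)
  have "(\<integral>x. w x * f' x $ k \<partial>lborel) = (\<integral>y. \<integral>t. w (?l y t) * f' (?l y t) $ k \<partial>lborel \<partial>hyperplane_lborel k)"
    by (rule integral_lborel_hyperplane[OF int])
  also have "\<dots> = (\<integral>y. 0 \<partial>hyperplane_lborel k)"
  proof (rule integral_cong_AE)
    show "AE y in hyperplane_lborel k. (\<integral>t. w (?l y t) * f' (?l y t) $ k \<partial>lborel) = 0"
      using AE
    proof eventually_elim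
      case (elim y)
      have "(\<integral>t. f' (?l y t) $ k \<partial>lborel) = 0"
        by (rule integral_derivative_compact_support(1)[OF C1_grad_line[OF f] cl, where R=R])
           (use far[OF elim] supp supp' in auto)
      then show ?case by (simp add: wk)
    qed
  qed (auto intro!: lborel.borel_measurable_lebesgue_integral)
  finally show "(\<integral>x. w x * f' x $ k \<partial>lborel) = 0" by simp
  assume s: "s \<in> {1, -1}"
  have "(\<integral>x. indicator {x. s * x $ k > 0} x * (w x * f' x $ k) \<partial>lborel) =
     (\<integral>y. \<integral>t. indicator {x. s * x $ k > 0} (?l y t) * (w (?l y t) * f' (?l y t) $ k) \<partial>lborel \<partial>hyperplane_lborel k)"
    by (rule integral_lborel_hyperplane[OF int2])
  also have "\<dots> = (\<integral>y. - s * (w y * f y) \<partial>hyperplane_lborel k)"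
  proof (rule integral_cong_AE)
    show "AE y in hyperplane_lborel k. (\<integral>t. indicator {x. s * x $ k > 0} (?l y t) * (w (?l y t) * f' (?l y t) $ k) \<partial>lborel)
       = - s * (w y * f y)"
      using AE
    proof eventually_elim
      case (elim y)
      have "(\<integral>t. indicator {t. s * t > 0} t * f' (?l y t) $ k \<partial>lborel) = - s * f (?l y 0)"
        by (rule integral_derivative_compact_support(2)[OF C1_grad_line[OF f] cl, where R=R])
           (use far[OF elim] supp supp' s in auto)
      moreover have "indicator {x. s * x $ k > 0} (?l y t) * (w (?l y t) * f' (?l y t) $ k) =
          w y * (indicator {t. s * t > 0} t * f' (?l y t) $ k)" for t
        using elim by (simp add: wk indicator_def axis_cart_nth)
      ultimately show ?case by (simp only: integral_mult_right_zero) simp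
    qed
  qed (auto intro!: lborel.borel_measurable_lebesgue_integral)
  finally show "(\<integral>x. indicator {x. s * x $ k > 0} x * (w x * f' x $ k) \<partial>lborel) =
      - s * (\<integral>y. w y * f y \<partial>hyperplane_lborel k)" by simp
qed

text \<open>Since \<open>g\<close> does not depend on the coordinate \<open>k\<close>, the shear
  translates every line parallel to that axis, and one-dimensional translation invariance suffices.
  No Jacobian determinant enters.\<close>

lemma distr_lborel_shear:
  fixes g :: "real^'n::finite \<Rightarrow> real"
  assumes g[measurable]: "g \<in> borel_measurable borel" and gk: "\<And>x t. g (x + t *\<^sub>R axis k 1) = g x"
  shows "distr lborel borel (\<lambda>x. x + g x *\<^sub>R axis k 1) = lborel"
proof (rule measure_eqI)
  fix A :: "(real^'n) set" assume "A \<in> sets (distr lborel borel (\<lambda>x. x + g x *\<^sub>R axis k 1))"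
  then have [measurable]: "A \<in> sets borel" by simp
  have "emeasure (distr lborel borel (\<lambda>x. x + g x *\<^sub>R axis k 1)) A =
      (\<integral>\<^sup>+x. indicator A x \<partial>distr lborel borel (\<lambda>x. x + g x *\<^sub>R axis k 1))" by simp
  also have "\<dots> = (\<integral>\<^sup>+x. indicator A (x + g x *\<^sub>R axis k 1) \<partial>lborel)"
    by (rule nn_integral_distr) auto
  also have "\<dots> = (\<integral>\<^sup>+y. \<integral>\<^sup>+t. indicator A ((y + t *\<^sub>R axis k 1) + g y *\<^sub>R axis k 1) \<partial>lborel \<partial>hyperplane_lborel k)"
    by (subst nn_integral_lborel_hyperplane[where k=k]) (auto simp: gk)
  also have "\<dots> = (\<integral>\<^sup>+y. \<integral>\<^sup>+t. indicator A (y + t *\<^sub>R axis k 1) \<partial>lborel \<partial>hyperplane_lborel k)"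
  proof (rule nn_integral_cong)
    fix y :: "real^'n"
    show "(\<integral>\<^sup>+t. indicator A ((y + t *\<^sub>R axis k 1) + g y *\<^sub>R axis k 1) \<partial>lborel) =
        (\<integral>\<^sup>+t. indicator A (y + t *\<^sub>R axis k 1) \<partial>lborel)"
      by (subst (2) nn_integral_real_affine[where c=1 and t="g y"]) (auto simp: algebra_simps)
  qed
  also have "\<dots> = emeasure lborel A"
    by (subst nn_integral_lborel_hyperplane[where k=k, symmetric]) auto
  finally show "emeasure (distr lborel borel (\<lambda>x. x + g x *\<^sub>R axis k 1)) A = emeasure lborel A" .
qed simp

lemma C1_grad_invariant:
  fixes g :: "real^'n::finite \<Rightarrow> real"
  assumes g: "C1_grad UNIV g g'" and gk: "\<And>x t. g (x + t *\<^sub>R axis k 1) = g x"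
  shows "g' (x + t *\<^sub>R axis k 1) = g' x" and "g' x $ k = 0"
proof -
  show "g' (x + t *\<^sub>R axis k 1) = g' x"
  proof -
    have "((\<lambda>z. g (z + t *\<^sub>R axis k 1)) has_derivative (\<lambda>h. g' (x + t *\<^sub>R axis k 1) \<bullet> h)) (at x)"
      by (rule has_derivative_compose[OF _ C1_grad_has_derivative[OF g]]) (auto intro!: derivative_eq_intros)
    then have "(g has_derivative (\<lambda>h. g' (x + t *\<^sub>R axis k 1) \<bullet> h)) (at x)" by (simp add: gk)
    then have "(\<lambda>h. g' (x + t *\<^sub>R axis k 1) \<bullet> h) = (\<lambda>h. g' x \<bullet> h)"
      using C1_grad_has_derivative[OF g, of x] by (auto intro: has_derivative_unique)
    then show ?thesis by (metis vector_eq_rdot)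
  qed
  show "g' x $ k = 0"
  proof -
    have "((\<lambda>t. g (x + t *\<^sub>R axis k 1)) has_real_derivative g' x $ k) (at 0)"
      using C1_grad_line[OF g, of x k 0] by simp
    then have "((\<lambda>t. g x) has_real_derivative g' x $ k) (at 0)" by (simp add: gk)
    then show ?thesis using DERIV_const DERIV_unique by blast
  qed
qed

text \<open>The shear \<open>T\<close> straightens the graph to the hyperplane, and the derivatives
  of \<open>G\<close> are expressed by those of \<open>K\<close>, the composition of
  \<open>G\<close> with \<open>T\<close>. The vector \<open>s *\<^sub>R (g' y - axis k 1)\<close> is
  the exterior normal before normalisation.\<close>

lemma divergence_graph:
  fixes g G :: "real^'n::finite \<Rightarrow> real"
  assumes g: "C1_grad UNIV g g'" and gk: "\<And>x t. g (x + t *\<^sub>R axis k 1) = g x"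
    and s: "s \<in> {1, -1}"
    and G: "C1_grad UNIV G G'" and supp: "\<And>x. norm x > R \<Longrightarrow> G x = 0"
  shows "(\<integral>x. indicator {x. s * (x $ k - g x) > 0} x * G' x $ j \<partial>lborel) =
    (\<integral>y. G (y + g y *\<^sub>R axis k 1) * (s * (g' y - axis k 1) $ j) \<partial>hyperplane_lborel k)"
proof -
  define T where "T x = x + g x *\<^sub>R axis k 1" for x
  define K where "K x = G (T x)" for x
  define K' where "K' x = G' (T x) + (G' (T x) $ k) *\<^sub>R g' x" for x
  have cg: "continuous_on UNIV g" "continuous_on UNIV g'" "continuous_on UNIV G'" "continuous_on UNIV G"
    using g G C1_grad_continuous C1_grad_continuous_grad by auto
  have [measurable]: "g \<in> borel_measurable borel" "g' \<in> borel_measurable borel" "G' \<in> borel_measurable borel" "G \<in> borel_measurable borel"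
    using cg borel_measurable_continuous_onI by blast+
  have cT: "continuous_on UNIV T" unfolding T_def by (intro continuous_intros cg)
  have [measurable]: "T \<in> borel_measurable borel" using cT by (rule borel_measurable_continuous_onI)
  have K: "C1_grad UNIV K K'"
    unfolding C1_grad_def
  proof (intro conjI ballI)
    fix x
    have T': "(T has_derivative (\<lambda>h. h + (g' x \<bullet> h) *\<^sub>R axis k 1)) (at x)"
      unfolding T_def by (auto intro!: derivative_eq_intros C1_grad_has_derivative[OF g])
    have "(K has_derivative (\<lambda>h. G' (T x) \<bullet> (h + (g' x \<bullet> h) *\<^sub>R axis k 1))) (at x)"
      unfolding K_def by (rule has_derivative_compose[OF T' C1_grad_has_derivative[OF G]]) simp
    moreover have "G' (T x) \<bullet> (h + (g' x \<bullet> h) *\<^sub>R axis k 1) = h \<bullet> K' x" for h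
      by (simp add: K'_def inner_axis inner_add_right inner_add_left inner_commute[of h] inner_commute[of "axis k 1"] mult.commute)
    ultimately show "GDERIV K x :> K' x" by (simp add: gderiv_def)
    show "continuous_on UNIV K'"
      unfolding K'_def by (intro continuous_intros continuous_on_compose2[OF cg(3) cT] cg) auto
  qed
  have gT: "g (T x) = g x" for x by (simp add: T_def gk)
  have Tk: "T x $ k = x $ k + g x" for x by (simp add: T_def axis_cart_nth)
  note g'inv = C1_grad_invariant(1)[OF g gk] and g'k = C1_grad_invariant(2)[OF g gk]
  obtain B where B: "\<And>x. norm x \<le> R \<Longrightarrow> \<bar>g x\<bar> \<le> B"
    using continuous_bounded_cball[OF cg(1), of R] by auto
  \<comment> \<open>\<open>g\<close> takes the same value at \<open>x\<close> and
    \<open>T x\<close>, so a point sent into the ball of radius \<open>R\<close> is displaced by at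
    most the bound of \<open>g\<close> on that ball.\<close>
  have Ksupp: "K x = 0" if "norm x > R + B" for x
  proof (rule ccontr)
    assume "K x \<noteq> 0"
    then have *: "norm (T x) \<le> R" using supp unfolding K_def by force
    have "norm x \<le> norm (T x) + norm (g (T x) *\<^sub>R axis k (1::real))"
      using norm_triangle_ineq4[of "T x" "g (T x) *\<^sub>R axis k 1"] by (simp add: gT) (simp add: T_def)
    also have "\<dots> \<le> R + B" using B[OF *] * by simp
    finally show False using that by simp
  qed
  have cgj: "continuous_on UNIV (\<lambda>x. g' x $ j)" by (intro continuous_intros cg)
  obtain B2 where B2: "\<And>x. norm x \<le> R + B \<Longrightarrow> \<bar>g' x $ j\<bar> \<le> B2"
    using continuous_bounded_cball[OF cgj, of "R + B"] by auto
  note W = integral_weighted_partial[OF K Ksupp]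
  let ?H = "indicator {x. s * x $ k > 0} :: real^'n \<Rightarrow> real"
  have a: "(\<integral>x. ?H x * (1 * K' x $ k) \<partial>lborel) = - s * (\<integral>y. 1 * K y \<partial>hyperplane_lborel k)"
    by (rule W(4)[where B=1 and s=s]) (use s in auto)
  have b: "integrable lborel (\<lambda>x. ?H x * (g' x $ j * K' x $ k))"
    using B2 g'inv borel_measurable_continuous_onI[OF cgj] by (intro W(3)[where B=B2 and s=s]) auto
  have b': "(\<integral>x. ?H x * (g' x $ j * K' x $ k) \<partial>lborel) = - s * (\<integral>y. g' y $ j * K y \<partial>hyperplane_lborel k)"
    using s B2 g'inv borel_measurable_continuous_onI[OF cgj] by (intro W(4)[where B=B2 and s=s]) auto
  \<comment> \<open>For \<open>j \<noteq> k\<close> the half space is invariant in direction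
    \<open>j\<close>, so its indicator is an admissible weight and no boundary term appears.\<close>
  have c: "(\<integral>x. ?H x * K' x $ j \<partial>lborel) = 0" "integrable lborel (\<lambda>x. ?H x * K' x $ j)" if "j \<noteq> k"
    by (rule W(1)[where B=1] W(2)[where B=1]; use that in \<open>auto simp: indicator_def axis_cart_nth\<close>)+
  have TD: "indicator {x. s * (x $ k - g x) > 0} (T x) = ?H x" for x
    by (simp add: indicator_def Tk gT)
  have [measurable]: "(\<lambda>x. G' x $ j) \<in> borel_measurable borel"
    by (intro borel_measurable_continuous_onI continuous_intros cg)
  have "(\<integral>x. indicator {x. s * (x $ k - g x) > 0} x * G' x $ j \<partial>lborel) =
    (\<integral>x. indicator {x. s * (x $ k - g x) > 0} (T x) * G' (T x) $ j \<partial>lborel)"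
  proof -
    have "(lborel :: (real^'n) measure) = distr lborel borel T"
      using distr_lborel_shear[of g k] gk by (simp add: T_def[abs_def])
    then have "(\<integral>x. indicator {x. s * (x $ k - g x) > 0} x * G' x $ j \<partial>lborel) =
       (\<integral>x. indicator {x. s * (x $ k - g x) > 0} x * G' x $ j \<partial>distr lborel borel T)" by simp
    then show ?thesis by (subst (asm) integral_distr) auto
  qed
  also have "\<dots> = (\<integral>x. ?H x * (G' (T x) $ j) \<partial>lborel)" by (simp only: TD)
  also have "\<dots> = (\<integral>y. K y * (s * (g' y - axis k 1) $ j) \<partial>hyperplane_lborel k)"
  proof (cases "j = k")
    case True
    then have "(\<integral>x. ?H x * (G' (T x) $ j) \<partial>lborel) = - s * (\<integral>y. K y \<partial>hyperplane_lborel k)"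
      using a by (simp add: K'_def g'k)
    also have "\<dots> = (\<integral>y. K y * (s * (g' y - axis k 1) $ j) \<partial>hyperplane_lborel k)"
      by (simp add: True g'k axis_cart_nth mult.commute)
    finally show ?thesis .
  next
    case False
    \<comment> \<open>The chain rule solved for the tangential derivative. The first term integrates
      to zero by \<open>c\<close>; the second differentiates across the hyperplane and leaves the
      boundary integral with weight \<open>g' y $ j\<close>.\<close>
    have "G' (T x) $ j = K' x $ j - g' x $ j * K' x $ k" for x
      by (simp add: K'_def g'k)
    then have "(\<integral>x. ?H x * (G' (T x) $ j) \<partial>lborel) =
       (\<integral>x. ?H x * K' x $ j - ?H x * (g' x $ j * K' x $ k) \<partial>lborel)"
      by (simp add: right_diff_distrib)
    also have "\<dots> = s * (\<integral>y. g' y $ j * K y \<partial>hyperplane_lborel k)"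
      by (subst Bochner_Integration.integral_diff) (use False b b' c in auto)
    also have "\<dots> = (\<integral>y. K y * (s * (g' y - axis k 1) $ j) \<partial>hyperplane_lborel k)"
      by (simp add: False axis_cart_nth mult_ac)
    finally show ?thesis .
  qed
  finally show ?thesis by (simp add: K_def T_def)
qed

section \<open>Smooth functions and their partial derivatives as functions with continuous
  gradient\<close>

lemma frechet_derivative_expansion:
  fixes f :: "real^'n::finite \<Rightarrow> 'b::real_normed_vector"
  assumes "f differentiable at x"
  shows "frechet_derivative f (at x) h = (\<Sum>i\<in>UNIV. h $ i *\<^sub>R partial i f x)"
proof -
  have bl: "bounded_linear (frechet_derivative f (at x))"
    using assms frechet_derivative_works has_derivative_bounded_linear by blast
  have "frechet_derivative f (at x) h = frechet_derivative f (at x) (\<Sum>i\<in>UNIV. h $ i *\<^sub>R axis i 1)"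
    using basis_expansion[of h] by (simp add: scalar_mult_eq_scaleR)
  also have "\<dots> = (\<Sum>i\<in>UNIV. h $ i *\<^sub>R partial i f x)"
    using bl by (simp add: linear_sum[OF bounded_linear.linear] linear_cmul[OF bounded_linear.linear] partial_def)
  finally show ?thesis .
qed

lemma frechet_derivative_eq_grad:
  fixes f :: "real^'n::finite \<Rightarrow> real"
  assumes "f differentiable at x"
  shows "frechet_derivative f (at x) h = grad f x \<bullet> h"
  by (simp add: frechet_derivative_expansion[OF assms] grad_def inner_vec_def mult.commute)

lemma smooth_on_partial: "smooth_on S f \<Longrightarrow> smooth_on S (partial i f)"
  unfolding smooth_on_def partial_def[abs_def]
  by (metis Ck_on.simps(2))

lemma smooth_on_differentiable: "smooth_on S f \<Longrightarrow> x \<in> S \<Longrightarrow> f differentiable at x"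
  unfolding smooth_on_def by (metis Ck_on.simps(2))

lemma smooth_on_continuous: "smooth_on S f \<Longrightarrow> continuous_on S f"
  unfolding smooth_on_def by (metis Ck_on.simps(1))

lemma smooth_on_C1_grad:
  assumes "smooth_on S f"
  shows "C1_grad S f (grad f)"
  unfolding C1_grad_def
proof (intro conjI ballI)
  fix x assume "x \<in> S"
  then have d: "f differentiable at x" using assms by (rule smooth_on_differentiable[rotated])
  then have "(f has_derivative (\<lambda>h. grad f x \<bullet> h)) (at x)"
    using frechet_derivative_eq_grad[OF d] frechet_derivative_works by (metis (no_types, lifting) ext)
  then show "GDERIV f x :> grad f x" by (simp add: gderiv_def inner_commute)
next
  show "continuous_on S (grad f)"
    unfolding grad_def[abs_def]
    by (intro continuous_on_vec_lambda smooth_on_continuous[of S] smooth_on_partial assms)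
qed

lemma grad_component: "grad f x $ i = partial i f x"
  by (simp add: grad_def)

lemma smooth_on_C1_grad_component:
  assumes "smooth_on S f"
  shows "C1_grad S (\<lambda>x. grad f x $ i) (grad (partial i f))"
  unfolding grad_component by (rule smooth_on_C1_grad[OF smooth_on_partial[OF assms]])

section \<open>Geometry of graph charts\<close>

lemma graph_chart_C1:
  "graph_chart \<Omega> U k s g \<Longrightarrow> C1_grad UNIV g (grad g)"
  by (auto simp: graph_chart_def intro: smooth_on_C1_grad)

lemma graph_chart_grad:
  assumes "graph_chart \<Omega> U k s g"
  shows "grad g (x + t *\<^sub>R axis k 1) = grad g x" and "grad g x $ k = 0"
  using C1_grad_invariant[OF graph_chart_C1[OF assms]] assms by (auto simp: graph_chart_def)

lemma graph_chart_open: "graph_chart \<Omega> U k s g \<Longrightarrow> open U"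
  and graph_chart_sign: "graph_chart \<Omega> U k s g \<Longrightarrow> s = 1 \<or> s = -1"
  and graph_chart_invariant: "graph_chart \<Omega> U k s g \<Longrightarrow> g (x + t *\<^sub>R axis k 1) = g x"
  and graph_chart_mem: "graph_chart \<Omega> U k s g \<Longrightarrow> x \<in> U \<Longrightarrow> x \<in> \<Omega> \<longleftrightarrow> s * (x $ k - g x) > 0"
  by (auto simp: graph_chart_def)

text \<open>A point strictly on the other side of the graph has a neighbourhood disjoint from the
  domain, while a point on the graph is approached by moving along the axis in the direction given
  by \<open>s\<close>.\<close>

lemma graph_chart_frontier:
  assumes c: "graph_chart \<Omega> U k s g" and o: "open \<Omega>" and x: "x \<in> U"
  shows "x \<in> frontier \<Omega> \<longleftrightarrow> x $ k = g x"
proof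
  assume "x \<in> frontier \<Omega>"
  then have nin: "x \<notin> \<Omega>" and cl: "x \<in> closure \<Omega>"
    using o by (auto simp: frontier_def interior_open)
  have "s * (x $ k - g x) \<le> 0" using graph_chart_mem[OF c x] nin by simp
  moreover have "s * (x $ k - g x) \<ge> 0"
  proof (rule ccontr)
    assume "\<not> s * (x $ k - g x) \<ge> 0"
    then have "x \<in> U \<inter> {x. s * (x $ k - g x) < 0}" using x by simp
    moreover have "open (U \<inter> {x. s * (x $ k - g x) < 0})"
      by (intro open_Int graph_chart_open[OF c] open_Collect_less continuous_intros
          C1_grad_continuous[OF graph_chart_C1[OF c]])
    ultimately obtain y where "y \<in> \<Omega>" "y \<in> U" "s * (y $ k - g y) < 0"
      using cl open_Int_closure_eq_empty[of "U \<inter> {x. s * (x $ k - g x) < 0}" \<Omega>] by auto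
    then show False using graph_chart_mem[OF c] by fastforce
  qed
  ultimately show "x $ k = g x" using graph_chart_sign[OF c] by auto
next
  assume eq: "x $ k = g x"
  have "x \<notin> \<Omega>" using graph_chart_mem[OF c x] eq by simp
  moreover have "x \<in> closure \<Omega>"
    unfolding closure_approachable
  proof (intro allI impI)
    fix e :: real assume e: "e > 0"
    obtain d where d: "d > 0" "ball x d \<subseteq> U" using graph_chart_open[OF c] x open_contains_ball by blast
    define t where "t = min e d / 2"
    let ?y = "x + (s * t) *\<^sub>R axis k 1"
    have t: "t > 0" "t < e" "t < d" using e d by (auto simp: t_def)
    have dist: "dist ?y x = t" using t graph_chart_sign[OF c] by (auto simp: dist_norm)
    then have "?y \<in> U" using d t by (auto simp: dist_commute)
    moreover have "s * (?y $ k - g ?y) = t"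
      using graph_chart_sign[OF c] by (auto simp: graph_chart_invariant[OF c] eq axis_cart_nth)
    ultimately have "?y \<in> \<Omega>" using graph_chart_mem[OF c] t by simp
    then show "\<exists>y\<in>\<Omega>. dist y x < e" using dist t by (intro bexI[of _ ?y]) auto
  qed
  ultimately show "x \<in> frontier \<Omega>" using o by (simp add: frontier_def interior_open)
qed

text \<open>The candidate vectors in \<open>outer_normal\<close>, but defined on the whole space and
  not only on the graph. This extension is constant along the axis \<open>k\<close> and is
  differentiated as part of a test function.\<close>

definition graph_normal :: "'n \<Rightarrow> real \<Rightarrow> (real^'n::finite \<Rightarrow> real) \<Rightarrow> real^'n \<Rightarrow> real^'n" where
  "graph_normal k s g x = (s / sqrt (1 + (norm (grad g x))\<^sup>2)) *\<^sub>R (grad g x - axis k 1)"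

text \<open>If the part \<open>w\<close> of \<open>b\<close> orthogonal to \<open>a\<close> were
  nonzero, then \<open>e *\<^sub>R a - w\<close> with small positive \<open>e\<close> would violate
  the inclusion of the half spaces.\<close>

lemma half_space_subset_imp_positive_multiple:
  fixes a b :: "'a::real_inner"
  assumes "\<And>v. v \<bullet> a > 0 \<Longrightarrow> v \<bullet> b \<ge> 0" "a \<noteq> 0" "b \<noteq> 0"
  shows "\<exists>c>0. b = c *\<^sub>R a"
proof -
  define c where "c = (b \<bullet> a) / (a \<bullet> a)"
  define w where "w = b - c *\<^sub>R a"
  have aa: "a \<bullet> a > 0" using assms by simp
  have wa: "w \<bullet> a = 0" using aa by (simp add: w_def c_def inner_diff_left)
  have wb: "w \<bullet> b = w \<bullet> w" using wa by (simp add: w_def inner_diff_right inner_commute)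
  have small: "w \<bullet> w \<le> e * (a \<bullet> b)" if "e > 0" for e
    using assms(1)[of "e *\<^sub>R a - w"] that aa wa wb by (simp add: inner_diff_left)
  have ab: "a \<bullet> b \<ge> 0" using assms(1)[of a] aa by simp
  have "w \<bullet> w \<le> 0"
  proof (rule field_le_epsilon)
    fix e :: real assume e: "e > 0"
    define d where "d = e / (a \<bullet> b + 1)"
    have "d > 0" "d * (a \<bullet> b) \<le> e"
      using e ab by (auto simp: d_def field_simps)
    then show "w \<bullet> w \<le> 0 + e" using small[of d] by simp
  qed
  then have "w = 0" by (metis inner_eq_zero_iff inner_ge_zero order_antisym)
  then have "b = c *\<^sub>R a" by (simp add: w_def)
  moreover have "c \<ge> 0" using ab aa by (simp add: c_def inner_commute)
  ultimately show ?thesis using assms(3) by (intro exI[of _ c]) (auto simp: less_eq_real_def)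
qed

lemma graph_normal_eq_sgn:
  assumes c: "graph_chart \<Omega> U k s g"
  shows "graph_normal k s g x = - sgn (s *\<^sub>R (axis k 1 - grad g x))"
    and "axis k 1 - grad g x \<noteq> 0"
proof -
  have k: "grad g x $ k = 0" by (rule graph_chart_grad(2)[OF c])
  have "(norm (axis k 1 - grad g x))\<^sup>2 = 1 + (norm (grad g x))\<^sup>2"
    by (simp add: power2_norm_eq_inner inner_diff_left inner_diff_right inner_axis inner_commute[of "axis k 1"] k axis_cart_nth)
  then have n: "norm (axis k 1 - grad g x) = sqrt (1 + (norm (grad g x))\<^sup>2)"
    by (metis norm_ge_zero real_sqrt_unique)
  show "graph_normal k s g x = - sgn (s *\<^sub>R (axis k 1 - grad g x))"
    using graph_chart_sign[OF c] by (auto simp: graph_normal_def sgn_div_norm n[symmetric] norm_minus_commute scaleR_diff_right divide_inverse)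
  show "axis k 1 - grad g x \<noteq> 0" using k by (auto simp: vec_eq_iff axis_cart_nth intro!: exI[of _ k])
qed

lemma norm_graph_normal: "graph_chart \<Omega> U k s g \<Longrightarrow> norm (graph_normal k s g x) = 1"
  using graph_normal_eq_sgn[of \<Omega> U k s g x] graph_chart_sign[of \<Omega> U k s g] by (auto simp: norm_sgn)

text \<open>A direction with positive product with the inner normal \<open>a\<close> of one chart
  enters the domain at \<open>x\<close>. In the other chart the defining function then cannot become
  negative, so the two half spaces of directions are nested and the normals parallel. This makes the
  \<open>THE\<close> in \<open>outer_normal\<close> meaningful.\<close>

lemma graph_normal_unique:
  assumes c: "graph_chart \<Omega> U k s g" and c': "graph_chart \<Omega> U' k' s' g'"
    and o: "open \<Omega>" and x: "x \<in> frontier \<Omega>" "x \<in> U" "x \<in> U'"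
  shows "graph_normal k s g x = graph_normal k' s' g' x"
proof -
  define a where "a = s *\<^sub>R (axis k 1 - grad g x)"
  define b where "b = s' *\<^sub>R (axis k' 1 - grad g' x)"
  have nz: "a \<noteq> 0" "b \<noteq> 0"
    using graph_normal_eq_sgn(2)[OF c, of x] graph_normal_eq_sgn(2)[OF c', of x]
      graph_chart_sign[OF c] graph_chart_sign[OF c'] by (auto simp: a_def b_def)
  have line: "((\<lambda>t. s * ((x + t *\<^sub>R v) $ k - g (x + t *\<^sub>R v))) has_real_derivative v \<bullet> (s *\<^sub>R (axis k 1 - grad g x))) (at 0)"
    if c: "graph_chart \<Omega> U k s g" for U k s g v
  proof -
    have "((\<lambda>t. g (x + t *\<^sub>R v)) has_derivative (\<lambda>t. grad g (x + 0 *\<^sub>R v) \<bullet> (t *\<^sub>R v))) (at 0)"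
      by (rule has_derivative_compose[OF _ C1_grad_has_derivative[OF graph_chart_C1[OF c]]])
         (auto intro!: derivative_eq_intros)
    then have "((\<lambda>t. g (x + t *\<^sub>R v)) has_real_derivative (grad g x \<bullet> v)) (at 0)"
      by (simp add: has_field_derivative_def mult.commute[of _ "grad g x \<bullet> v"] mult_commute_abs)
    then show ?thesis
      by (auto intro!: derivative_eq_intros simp: inner_diff_right inner_axis inner_commute algebra_simps)
  qed
  have "v \<bullet> b \<ge> 0" if v: "v \<bullet> a > 0" for v
  proof (rule ccontr)
    assume "\<not> v \<bullet> b \<ge> 0"
    then have vb: "v \<bullet> b < 0" by simp
    have z: "s * (x $ k - g x) = 0" "s' * (x $ k' - g' x) = 0"
      using graph_chart_frontier[OF c o x(2)] graph_chart_frontier[OF c' o x(3)] x(1) by auto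
    obtain d1 where d1: "d1 > 0" "\<And>t. 0 < t \<Longrightarrow> t < d1 \<Longrightarrow> s * ((x + t *\<^sub>R v) $ k - g (x + t *\<^sub>R v)) > 0"
      using DERIV_pos_inc_right[OF line[OF c, of v]] v z by (auto simp: a_def)
    obtain d2 where d2: "d2 > 0" "\<And>t. 0 < t \<Longrightarrow> t < d2 \<Longrightarrow> s' * ((x + t *\<^sub>R v) $ k' - g' (x + t *\<^sub>R v)) < 0"
      using DERIV_neg_dec_right[OF line[OF c', of v]] vb z by (auto simp: b_def)
    have "((\<lambda>t. x + t *\<^sub>R v) \<longlongrightarrow> x + 0 *\<^sub>R v) (at_right 0)" by (intro tendsto_intros)
    moreover have "open (U \<inter> U')" using graph_chart_open c c' by blast
    ultimately have "\<forall>\<^sub>F t in at_right 0. x + t *\<^sub>R v \<in> U \<inter> U'"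
      using x by (intro topological_tendstoD) auto
    moreover have "\<forall>\<^sub>F t in at_right 0. 0 < t \<and> t < min d1 d2"
      using d1(1) d2(1) eventually_at_right_less[of "0::real"]
      by (auto simp: eventually_at_right[of 0 1] intro!: exI[of _ "min d1 d2"])
    ultimately have "\<forall>\<^sub>F t in at_right 0. x + t *\<^sub>R v \<in> U \<inter> U' \<and> 0 < t \<and> t < min d1 d2"
      by eventually_elim auto
    then obtain t where t: "x + t *\<^sub>R v \<in> U \<inter> U'" "0 < t" "t < d1" "t < d2"
      using eventually_happens'[OF trivial_limit_at_right_real] by fastforce
    then show False
      using d1(2)[of t] d2(2)[of t] graph_chart_mem[OF c, of "x + t *\<^sub>R v"] graph_chart_mem[OF c', of "x + t *\<^sub>R v"] by auto
  qed
  then obtain r where "r > 0" "b = r *\<^sub>R a"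
    using half_space_subset_imp_positive_multiple[of a b] nz by blast
  then have "sgn a = sgn b" by (simp add: sgn_scaleR)
  then show ?thesis
    unfolding graph_normal_eq_sgn(1)[OF c] graph_normal_eq_sgn(1)[OF c'] by (simp add: a_def b_def)
qed

lemma outer_normal_eq:
  assumes c: "graph_chart \<Omega> U k s g" and o: "open \<Omega>" and x: "x \<in> frontier \<Omega>" "x \<in> U"
  shows "outer_normal \<Omega> x = graph_normal k s g x"
  unfolding outer_normal_def graph_normal_def[symmetric]
proof (rule the_equality)
  show "\<exists>U k' s' g'. x \<in> U \<and> graph_chart \<Omega> U k' s' g' \<and> graph_normal k s g x = graph_normal k' s' g' x"
    using c x by blast
  show "\<nu> = graph_normal k s g x" if "\<exists>U k s g. x \<in> U \<and> graph_chart \<Omega> U k s g \<and> \<nu> = graph_normal k s g x" for \<nu>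
    using that graph_normal_unique[OF c _ o x] by metis
qed

text \<open>Components of the normal will be factors of functions inserted into the divergence
  formula, so continuity of the normal would not be enough.\<close>

lemma C1_grad_graph_normal:
  assumes c: "graph_chart \<Omega> U k s g"
  shows "\<exists>D. C1_grad UNIV (\<lambda>x. graph_normal k s g x $ j) D"
proof -
  have sm: "smooth_on UNIV g" using c by (simp add: graph_chart_def)
  note gi = smooth_on_C1_grad_component[OF sm]
  define n where "n x = 1 + (\<Sum>i\<in>UNIV. grad g x $ i * grad g x $ i)" for x
  have n: "n x > 0" for x unfolding n_def by (intro add_pos_nonneg sum_nonneg) auto
  then have nn: "\<not> n x < 0" "n x \<noteq> 0" for x by (simp_all add: less_imp_le not_less order.strict_implies_not_eq[symmetric])
  have n': "C1_grad UNIV n (\<lambda>x. 0 + (\<Sum>i\<in>UNIV. grad g x $ i *\<^sub>R grad (partial i g) x + grad g x $ i *\<^sub>R grad (partial i g) x))"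
    (is "C1_grad UNIV n ?n'")
    unfolding n_def by (intro C1_intros gi)
  have r: "C1_grad UNIV (\<lambda>x. inverse (sqrt (n x))) (\<lambda>x. ((\<lambda>r. - (inverse (sqrt r) * (inverse (sqrt r) / 2 * inverse (sqrt r)))) (n x)) *\<^sub>R ?n' x)"
    by (rule C1_grad_compose[OF n', where f="\<lambda>r. inverse (sqrt r)"])
       (use n nn in \<open>auto intro!: derivative_eq_intros continuous_intros simp: less_imp_neq[OF n, symmetric] power2_eq_square\<close>)
  have eq: "graph_normal k s g x $ j = s * (inverse (sqrt (n x)) * (grad g x $ j - axis k 1 $ j))" for x
    by (simp add: graph_normal_def n_def power2_norm_eq_inner inner_vec_def divide_inverse)
  show ?thesis
    unfolding eq by (rule exI, (rule r gi C1_grad_mult C1_grad_diff C1_grad_const)+)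
qed

lemma continuous_graph_normal:
  assumes "graph_chart \<Omega> U k s g"
  shows "continuous_on UNIV (graph_normal k s g)"
proof -
  have "continuous_on UNIV (\<lambda>x. \<chi> j. graph_normal k s g x $ j)"
    using C1_grad_graph_normal[OF assms] C1_grad_continuous by (intro continuous_on_vec_lambda) blast
  then show ?thesis by simp
qed

section \<open>Measures determined by integrals of continuously differentiable functions\<close>

lemma C1_grad_prod_ex:
  assumes "\<And>i. i \<in> I \<Longrightarrow> \<exists>D. C1_grad V (F i) D"
  shows "\<exists>D. C1_grad V (\<lambda>x. \<Prod>i\<in>I. F i x) D"
  using assms
proof (induction I rule: infinite_finite_induct)
  case (insert i I)
  then obtain D E where "C1_grad V (\<lambda>x. \<Prod>i\<in>I. F i x) D" "C1_grad V (F i) E" by blast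
  then show ?case using insert.hyps C1_grad_mult by (auto intro!: exI)
qed (auto intro!: exI C1_grad_const)

text \<open>The square of the positive part: continuously differentiable, zero on a half line, and
  sufficient to build all cutoff functions needed here.\<close>

definition sqpos :: "real \<Rightarrow> real" where
  "sqpos r = (max 0 r)\<^sup>2"

lemma sqpos_simps [simp]: "r \<le> 0 \<Longrightarrow> sqpos r = 0" "r > 0 \<Longrightarrow> sqpos r = r\<^sup>2" "sqpos r \<ge> 0"
  "sqpos r > 0 \<longleftrightarrow> r > 0" "sqpos r = 0 \<longleftrightarrow> r \<le> 0"
  by (auto simp: sqpos_def max_def)

lemma sqpos_derivative: "(sqpos has_real_derivative 2 * max 0 r) (at r)"
proof -
  consider "r < 0" | "r > 0" | "r = 0" by linarith
  then show ?thesis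
  proof cases
    case 1
    have "((\<lambda>_. 0) has_real_derivative 2 * max 0 r) (at r)" using 1 by simp
    then show ?thesis
      by (rule has_field_derivative_transform_within_open[where S="{..<0}"]) (use 1 in auto)
  next
    case 2
    have "((\<lambda>r. r\<^sup>2) has_real_derivative 2 * max 0 r) (at r)" using 2 by (auto intro!: derivative_eq_intros)
    then show ?thesis
      by (rule has_field_derivative_transform_within_open[where S="{0<..}"]) (use 2 in auto)
  next
    case 3
    have "((\<lambda>h. sqpos h / h) \<longlongrightarrow> 0) (at 0)"
    proof (rule Lim_null_comparison)
      show "\<forall>\<^sub>F h in at 0. norm (sqpos h / h) \<le> \<bar>h\<bar>"
        by (rule always_eventually) (auto simp: sqpos_def max_def power2_eq_square)
      show "((\<lambda>h. \<bar>h\<bar>) \<longlongrightarrow> (0::real)) (at 0)" by (rule tendsto_eq_intros | simp)+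
    qed
    then show ?thesis using 3 by (simp add: has_field_derivative_iff)
  qed
qed

lemma C1_grad_sqpos [C1_intros]:
  "C1_grad V F F' \<Longrightarrow> C1_grad V (\<lambda>x. sqpos (F x)) (\<lambda>x. (2 * max 0 (F x)) *\<^sub>R F' x)"
  by (rule C1_grad_compose[where f'="\<lambda>r. 2 * max 0 r"]) (auto intro!: sqpos_derivative continuous_intros)

lemma sqpos_le_1: "r \<le> 1 \<Longrightarrow> sqpos r \<le> 1"
  by (auto simp: sqpos_def max_def power_le_one)

lemma box_approximation:
  fixes a b :: "real^'n::finite"
  assumes ab: "\<And>i. a $ i < b $ i"
  shows "\<exists>F. (\<forall>m::nat. \<exists>D. C1_grad UNIV (F m) D) \<and> (\<forall>m x. \<bar>F m x\<bar> \<le> indicator (box a b) x) \<and>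
    (\<forall>x. (\<lambda>m. F m x) \<longlonglongrightarrow> indicator (box a b) x)"
proof -
  define p where "p x = (\<Prod>i\<in>UNIV. sqpos ((x $ i - a $ i) * (b $ i - x $ i)))" for x :: "real^'n"
  \<comment> \<open>Zero where \<open>p\<close> vanishes, and exactly 1 as soon as
    \<open>real m * p x \<ge> 1\<close>; hence the limit is the indicator of the set where
    \<open>p\<close> is positive, which is the open box.\<close>
  define F where "F m x = 1 - sqpos (1 - real m * p x)" for m x
  have "\<exists>D. C1_grad UNIV (\<lambda>x. sqpos ((x $ i - a $ i) * (b $ i - x $ i))) D" for i
    by (rule exI, (rule C1_intros)+)
  then obtain D where D: "C1_grad UNIV p D"
    using C1_grad_prod_ex[of UNIV UNIV "\<lambda>i x. sqpos ((x $ i - a $ i) * (b $ i - x $ i))"] unfolding p_def by auto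
  have "\<exists>D. C1_grad UNIV (F m) D" for m
    unfolding F_def by (rule exI, (rule C1_intros D)+)
  moreover have p0: "p x \<ge> 0" for x by (auto simp: p_def intro!: prod_nonneg)
  have pin: "p x > 0" if "x \<in> box a b" for x
    using that by (auto simp: p_def mem_box_cart intro!: prod_pos) (metis less_irrefl)+
  have pout: "p x = 0" if "x \<notin> box a b" for x
  proof -
    obtain i where i: "\<not> (a $ i < x $ i \<and> x $ i < b $ i)" using \<open>x \<notin> box a b\<close> by (auto simp: mem_box_cart)
    then have "(x $ i - a $ i) * (b $ i - x $ i) \<le> 0"
      using ab[of i] by (auto simp: mult_le_0_iff)
    then show ?thesis by (auto simp: p_def)
  qed
  have "\<bar>F m x\<bar> \<le> indicator (box a b) x" for m x
  proof (cases "x \<in> box a b")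
    case True
    have "sqpos (1 - real m * p x) \<le> 1" using p0[of x] by (intro sqpos_le_1) simp
    then show ?thesis using True by (simp add: F_def)
  next
    case False
    then show ?thesis by (simp add: F_def pout)
  qed
  moreover have "(\<lambda>m. F m x) \<longlonglongrightarrow> indicator (box a b) x" for x
  proof (cases "x \<in> box a b")
    case True
    obtain m0 where m0: "real m0 * p x > 1" using reals_Archimedean3[OF pin[OF True]] by blast
    have "F m x = 1" if "m \<ge> m0" for m
    proof -
      have "real m0 * p x \<le> real m * p x" using that p0 by (intro mult_right_mono) auto
      then show ?thesis using m0 by (simp add: F_def)
    qed
    then have "\<forall>\<^sub>F m in sequentially. F m x = 1" by (auto simp: eventually_sequentially)
    then show ?thesis using True by (simp add: tendsto_eventually)
  next
    case False
    then show ?thesis by (simp add: F_def pout)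
  qed
  ultimately show ?thesis by blast
qed

text \<open>Dominated convergence gives equality on boxes with closure in \<open>W\<close>. Boxes
  form an intersection-stable generator, and countably many of them fill \<open>W\<close>.\<close>

lemma measure_eq_if_C1_integrals_eq:
  fixes M N :: "(real^'n::finite) measure"
  assumes sM: "sets M = sets borel" and sN: "sets N = sets borel"
    and fM: "\<And>a b. emeasure M (cbox a b) < \<infinity>" and fN: "\<And>a b. emeasure N (cbox a b) < \<infinity>"
    and W: "open W"
    and eq: "\<And>F D C. C1_grad UNIV F D \<Longrightarrow> compact C \<Longrightarrow> C \<subseteq> W \<Longrightarrow> (\<And>x. x \<notin> C \<Longrightarrow> F x = 0) \<Longrightarrow>
      (\<integral>x. F x \<partial>M) = (\<integral>x. F x \<partial>N)"
    and A: "A \<in> sets borel" "A \<subseteq> W"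
  shows "emeasure M A = emeasure N A"
proof -
  have fb: "emeasure M (box a b) < \<infinity>" "emeasure N (box a b) < \<infinity>" for a b
    using fM[of a b] fN[of a b] emeasure_mono[OF box_subset_cbox, of a b M] emeasure_mono[OF box_subset_cbox, of a b N] sM sN
    by (auto intro: le_less_trans)
  have box: "emeasure M (box a b) = emeasure N (box a b)" if sub: "cbox a b \<subseteq> W" for a b
  proof (cases "\<forall>i. a $ i < b $ i")
    case True
    then obtain F where C1: "\<And>m::nat. \<exists>D. C1_grad UNIV (F m) D" and bd: "\<And>m x. \<bar>F m x\<bar> \<le> indicator (box a b) x"
      and lim: "\<And>x. (\<lambda>m. F m x) \<longlonglongrightarrow> indicator (box a b) x"
      using box_approximation[of a b] by blast
    have [measurable]: "F m \<in> borel_measurable borel" for m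
      using C1[of m] C1_grad_continuous borel_measurable_continuous_onI by blast
    have conv: "(\<lambda>m. \<integral>x. F m x \<partial>L) \<longlonglongrightarrow> (\<integral>x. indicator (box a b) x \<partial>L)"
      if L: "sets L = sets borel" "emeasure L (box a b) < \<infinity>" for L
    proof (rule integral_dominated_convergence)
      show "integrable L (indicator (box a b) :: _ \<Rightarrow> real)" using L by (auto intro!: integrable_real_indicator)
      show "AE x in L. (\<lambda>m. F m x) \<longlonglongrightarrow> indicator (box a b) x" using lim by simp
      show "AE x in L. norm (F m x) \<le> indicator (box a b) x" for m using bd by simp
    qed (use L in \<open>simp_all cong: measurable_cong_sets\<close>)
    have "(\<integral>x. F m x \<partial>M) = (\<integral>x. F m x \<partial>N)" for m
    proof -
      obtain D where D: "C1_grad UNIV (F m) D" using C1 by blast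
      have "F m x = 0" if "x \<notin> cbox a b" for x
        using bd[of m x] that box_subset_cbox[of a b] by (cases "x \<in> box a b") auto
      then show ?thesis using eq[OF D compact_cbox sub] by blast
    qed
    then have "(\<integral>x. indicator (box a b) x \<partial>M) = (\<integral>x. indicator (box a b) x \<partial>N :: real)"
      using conv[OF sM fb(1)] conv[OF sN fb(2)] LIMSEQ_unique by auto
    then have "measure M (box a b) = measure N (box a b)"
      using sM sN by simp
    then show ?thesis
      using fb[of a b] by (simp add: emeasure_eq_ennreal_measure)
  next
    case False
    then have "box a b = {}" by (simp add: interval_eq_empty_cart not_less)
    then show ?thesis by simp
  qed
  have inQ: "emeasure M (B \<inter> box a b) = emeasure N (B \<inter> box a b)" if sub: "cbox a b \<subseteq> W" and B: "B \<in> sets borel" for a b B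
  proof -
    \<comment> \<open>After restriction to a box with closure in \<open>W\<close>, only
      intersections with that box are tested. These are again boxes with closure in
      \<open>W\<close>, so the generator argument applies although the two measures may differ
      outside \<open>W\<close>.\<close>
    let ?M = "density M (indicator (box a b))" and ?N = "density N (indicator (box a b))"
    have em: "emeasure ?M X = emeasure M (X \<inter> box a b)" "emeasure ?N X = emeasure N (X \<inter> box a b)" if "X \<in> sets borel" for X
      using that sM sN by (auto simp: emeasure_density Int_commute indicator_inter_arith[symmetric] cong: measurable_cong_sets)
    let ?E = "range (\<lambda>(a, b). box a b::(real^'n) set)"
    have "?M = ?N"
    proof (rule measure_eqI_generator_eq)
      show "Int_stable ?E" by (auto simp: Int_stable_def box_Int_box)
      show "?E \<subseteq> Pow UNIV" "sets ?M = sigma_sets UNIV ?E" "sets ?N = sigma_sets UNIV ?E"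
        using sM sN by (simp_all add: borel_eq_box)
      let ?A = "\<lambda>n::nat. box (- (real n *\<^sub>R One)) (real n *\<^sub>R One) :: (real^'n) set"
      show "range ?A \<subseteq> ?E" "(\<Union>i. ?A i) = UNIV" unfolding UN_box_eq_UNIV by auto
      show "emeasure ?M (?A i) \<noteq> \<infinity>" for i
      proof -
        have "emeasure ?M (?A i) = emeasure M (?A i \<inter> box a b)" by (rule em(1)) simp
        also have "\<dots> \<le> emeasure M (box a b)" by (rule emeasure_mono) (simp_all add: sM)
        also have "\<dots> < \<infinity>" by (rule fb(1))
        finally show ?thesis by simp
      qed
      show "emeasure ?M X = emeasure ?N X" if XE: "X \<in> ?E" for X
      proof -
        obtain c d where X: "X = box c d" using XE by (elim rangeE) (auto split: prod.splits)
        obtain c' d' where cd: "box c d \<inter> box a b = box c' d'" "cbox c' d' = cbox c d \<inter> cbox a b"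
          unfolding box_Int_box Int_interval by blast
        have "emeasure ?M X = emeasure M (box c' d')" using em(1)[of X] by (simp add: X cd(1))
        also have "\<dots> = emeasure N (box c' d')" using sub cd(2) by (intro box) auto
        also have "\<dots> = emeasure ?N X" using em(2)[of X] by (simp add: X cd(1))
        finally show ?thesis .
      qed
    qed
    then show ?thesis using em B by metis
  qed
  have "\<exists>a b. x \<in> box a b \<and> cbox a b \<subseteq> W" if "x \<in> W" for x
    using open_contains_cbox[OF W that] by metis
  then obtain lo hi where lh: "\<And>x. x \<in> W \<Longrightarrow> x \<in> box (lo x) (hi x) \<and> cbox (lo x) (hi x) \<subseteq> W" by metis
  let ?F = "(\<lambda>x. box (lo x) (hi x)) ` W"
  obtain F' where F': "F' \<subseteq> ?F" "countable F'" "\<Union>F' = \<Union>?F"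
    by (rule Lindelof[of ?F]) auto
  have WF: "W \<subseteq> \<Union>F'" using lh F' by auto
  show ?thesis
  proof (cases "A = {}")
    case False
    then have ne: "F' \<noteq> {}" using A WF by auto
    \<comment> \<open>An enumeration of the countable cover; \<open>disjointed\<close> turns it into
      a partition along which both measures are summed.\<close>
    define Q where "Q n = from_nat_into F' n" for n
    have Q: "Q n \<in> F'" for n using ne by (simp add: Q_def from_nat_into)
    then have QF: "Q n \<in> ?F" for n using F'(1) by blast
    have UQ: "(\<Union>n. Q n) = \<Union>F'" using range_from_nat_into[OF ne F'(2)] by (simp add: Q_def)
    have Qb: "Q n \<in> sets borel" for n using QF[of n] by auto
    have dQ: "disjointed Q n \<in> sets borel" for n
      using Qb by (auto simp: disjointed_def)
    have pieces: "emeasure M (A \<inter> disjointed Q n) = emeasure N (A \<inter> disjointed Q n)" for n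
    proof -
      obtain x where x: "x \<in> W" "Q n = box (lo x) (hi x)" using QF[of n] by auto
      have "A \<inter> disjointed Q n = (A \<inter> disjointed Q n) \<inter> box (lo x) (hi x)"
        using disjointed_subset[of Q n] x by auto
      then show ?thesis using inQ[of "lo x" "hi x" "A \<inter> disjointed Q n"] lh[OF x(1)] dQ A by auto
    qed
    have U: "A \<inter> \<Union>(range (disjointed Q)) = A"
    proof -
      have "A \<inter> \<Union>(range (disjointed Q)) = A \<inter> \<Union>F'" by (simp only: UN_disjointed_eq UQ)
      also have "\<dots> = A" using WF A(2) by auto
      finally show ?thesis .
    qed
    have dj: "disjoint_family (\<lambda>n. A \<inter> disjointed Q n)"
      using disjoint_family_disjointed[of Q] by (auto simp: disjoint_family_on_def)
    have "emeasure M A = (\<Sum>n. emeasure M (A \<inter> disjointed Q n))"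
      using dQ A sM suminf_emeasure[OF _ dj, of M] by (simp add: U image_subset_iff)
    also have "\<dots> = (\<Sum>n. emeasure N (A \<inter> disjointed Q n))" by (simp add: pieces)
    also have "\<dots> = emeasure N A"
      using dQ A sN suminf_emeasure[OF _ dj, of N] by (simp add: U image_subset_iff)
    finally show ?thesis .
  qed simp
qed

section \<open>The surface measure\<close>

text \<open>The area measure of the entire graph, also outside the chart domain \<open>U\<close>. It
  describes the boundary only within \<open>U\<close>.\<close>

definition chart_measure :: "'n::finite \<Rightarrow> (real^'n \<Rightarrow> real) \<Rightarrow> (real^'n) measure" where
  "chart_measure k g = distr (density (hyperplane_lborel k) (\<lambda>y. ennreal (sqrt (1 + (norm (grad g y))\<^sup>2))))
     borel (\<lambda>y. y + g y *\<^sub>R axis k 1)"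

lemma sets_chart_measure [measurable_cong, simp]: "sets (chart_measure k g) = sets borel"
  and space_chart_measure [simp]: "space (chart_measure k g) = UNIV"
  by (simp_all add: chart_measure_def)

lemma graph_chart_measurable:
  assumes c: "graph_chart \<Omega> U k s g"
  shows "g \<in> borel_measurable borel" "grad g \<in> borel_measurable borel"
  using C1_grad_continuous[OF graph_chart_C1[OF c]] C1_grad_continuous_grad[OF graph_chart_C1[OF c]]
  by (auto intro: borel_measurable_continuous_onI)

lemma emeasure_chart_measure:
  assumes c: "graph_chart \<Omega> U k s g" and [measurable]: "A \<in> sets borel"
  shows "emeasure (chart_measure k g) A =
    (\<integral>\<^sup>+ y. ennreal (sqrt (1 + (norm (grad g y))\<^sup>2)) * indicator A (y + g y *\<^sub>R axis k 1) \<partial>hyperplane_lborel k)"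
proof -
  note [measurable] = graph_chart_measurable[OF c]
  have "emeasure (chart_measure k g) A = (\<integral>\<^sup>+x. indicator A x \<partial>chart_measure k g)" by simp
  also have "\<dots> = (\<integral>\<^sup>+ y. indicator A (y + g y *\<^sub>R axis k 1) \<partial>density (hyperplane_lborel k) (\<lambda>y. ennreal (sqrt (1 + (norm (grad g y))\<^sup>2))))"
    unfolding chart_measure_def by (rule nn_integral_distr) auto
  also have "\<dots> = (\<integral>\<^sup>+ y. ennreal (sqrt (1 + (norm (grad g y))\<^sup>2)) * indicator A (y + g y *\<^sub>R axis k 1) \<partial>hyperplane_lborel k)"
    by (rule nn_integral_density) auto
  finally show ?thesis .
qed

lemma integral_chart_measure:
  fixes f :: "real^'n::finite \<Rightarrow> real"
  assumes c: "graph_chart \<Omega> U k s g" and [measurable]: "f \<in> borel_measurable borel"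
  shows "(\<integral>x. f x \<partial>chart_measure k g) =
    (\<integral>y. sqrt (1 + (norm (grad g y))\<^sup>2) * f (y + g y *\<^sub>R axis k 1) \<partial>hyperplane_lborel k)"
proof -
  note [measurable] = graph_chart_measurable[OF c]
  have "(\<integral>x. f x \<partial>chart_measure k g) = (\<integral>y. f (y + g y *\<^sub>R axis k 1) \<partial>density (hyperplane_lborel k) (\<lambda>y. ennreal (sqrt (1 + (norm (grad g y))\<^sup>2))))"
    unfolding chart_measure_def by (rule integral_distr) auto
  also have "\<dots> = (\<integral>y. sqrt (1 + (norm (grad g y))\<^sup>2) *\<^sub>R f (y + g y *\<^sub>R axis k 1) \<partial>hyperplane_lborel k)"
    by (rule integral_density) auto
  finally show ?thesis by simp
qed

text \<open>The part of the graph in a ball projects into a cube of the hyperplane, on which the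
  density is bounded.\<close>

lemma emeasure_chart_measure_cball:
  fixes g :: "real^'n::finite \<Rightarrow> real"
  assumes c: "graph_chart \<Omega> U k s g"
  shows "emeasure (chart_measure k g) (cball 0 R) < \<infinity>"
proof -
  note [measurable] = graph_chart_measurable[OF c]
  define Q where "Q = cbox (- (\<chi> i. R)) (\<chi> i. R :: real^'n)"
  have "continuous_on Q (\<lambda>y. sqrt (1 + (norm (grad g y))\<^sup>2))"
    by (intro continuous_intros continuous_on_subset[OF C1_grad_continuous_grad[OF graph_chart_C1[OF c]]]) auto
  then have "bounded ((\<lambda>y. sqrt (1 + (norm (grad g y))\<^sup>2)) ` Q)"
    by (intro compact_imp_bounded compact_continuous_image) (auto simp: Q_def)
  then obtain B where B: "\<And>y. y \<in> Q \<Longrightarrow> sqrt (1 + (norm (grad g y))\<^sup>2) \<le> B"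
    by (auto simp: bounded_real)
  have [measurable]: "Q \<in> sets borel" by (simp add: Q_def)
  have "emeasure (chart_measure k g) (cball 0 R) =
     (\<integral>\<^sup>+ y. ennreal (sqrt (1 + (norm (grad g y))\<^sup>2)) * indicator (cball 0 R) (y + g y *\<^sub>R axis k 1) \<partial>hyperplane_lborel k)"
    by (rule emeasure_chart_measure[OF c]) simp
  also have "\<dots> \<le> (\<integral>\<^sup>+ y. ennreal B * indicator Q y \<partial>hyperplane_lborel k)"
  proof (rule nn_integral_mono_AE)
    show "AE y in hyperplane_lborel k. ennreal (sqrt (1 + (norm (grad g y))\<^sup>2)) * indicator (cball 0 R) (y + g y *\<^sub>R axis k 1)
       \<le> ennreal B * indicator Q y"
      using AE_hyperplane_lborel
    proof eventually_elim
      case (elim y)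
      show ?case
      proof (cases "y + g y *\<^sub>R axis k 1 \<in> cball 0 R")
        case True
        then have le: "\<bar>(y + g y *\<^sub>R axis k 1) $ i\<bar> \<le> R" for i
          using component_le_norm_cart[of "y + g y *\<^sub>R axis k 1" i] by simp
        have "\<bar>y $ i\<bar> \<le> R" for i
          using le[of i] le[of k] elim by (cases "i = k") (auto simp: axis_cart_nth)
        then have "y \<in> Q" by (auto simp: Q_def mem_box_cart abs_le_iff) (metis minus_le_iff)
        then show ?thesis using B by (auto simp: indicator_def intro: ennreal_leI)
      qed simp
    qed
  qed
  also have "\<dots> = ennreal B * emeasure (hyperplane_lborel k) Q"
    by (simp add: nn_integral_cmult)
  also have "\<dots> < \<infinity>"
    using emeasure_hyperplane_lborel_cbox[of k "- (\<chi> i. R)" "\<chi> i. R"] by (auto simp: Q_def ennreal_mult_less_top)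
  finally show ?thesis .
qed

lemma integrable_locally_finite:
  fixes f :: "real^'n::finite \<Rightarrow> real"
  assumes M: "sets M = sets borel" "\<And>R. emeasure M (cball 0 R) < \<infinity>"
    and f: "continuous_on UNIV f" and C: "compact C" "\<And>x. x \<notin> C \<Longrightarrow> f x = 0"
  shows "integrable M f"
proof -
  obtain R where R: "\<And>x. x \<in> C \<Longrightarrow> norm x \<le> R" using compact_imp_bounded[OF C(1)] bounded_iff by blast
  obtain B where B: "\<And>x. norm x \<le> R \<Longrightarrow> \<bar>f x\<bar> \<le> B" using continuous_bounded_cball[OF f, of R] by auto
  show ?thesis
  proof (rule Bochner_Integration.integrable_bound)
    show "integrable M (\<lambda>x::real^'n. B * indicator (cball 0 R) x :: real)"
      using M by (intro integrable_mult_right integrable_real_indicator) auto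
    have "norm (f x) \<le> norm (B * indicator (cball 0 R) x :: real)" for x
      using B[of x] R[of x] C(2)[of x] by (cases "norm x \<le> R") (auto simp: indicator_def)
    then show "AE x in M. norm (f x) \<le> norm (B * indicator (cball 0 R) x :: real)" by simp
  qed (use f M in \<open>simp_all add: borel_measurable_continuous_onI cong: measurable_cong_sets\<close>)
qed

text \<open>On the support of \<open>F\<close> the domain coincides with the region beyond the
  graph. The density of the area measure cancels the normalising factor of
  \<open>graph_normal\<close>, whose values at a point of the graph and at its projection
  agree.\<close>

lemma divergence_chart:
  fixes F :: "real^'n::finite \<Rightarrow> real"
  assumes c: "graph_chart \<Omega> U k s g"
    and F: "C1_grad UNIV F F'" and C: "compact C" "C \<subseteq> U" "\<And>x. x \<notin> C \<Longrightarrow> F x = 0"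
  shows "(\<integral>x. indicator \<Omega> x * F' x $ j \<partial>lborel) = (\<integral>x. F x * graph_normal k s g x $ j \<partial>chart_measure k g)"
proof -
  have F'0: "F' x = 0" if "x \<notin> C" for x
    by (rule C1_grad_zero_on_open[OF F, of "- C"]) (use C that compact_imp_closed in auto)
  obtain R where R: "\<And>x. x \<in> C \<Longrightarrow> norm x \<le> R" using compact_imp_bounded[OF C(1)] bounded_iff by blast
  have [measurable]: "F \<in> borel_measurable borel" "graph_normal k s g \<in> borel_measurable borel"
    using C1_grad_continuous[OF F] continuous_graph_normal[OF c] by (auto intro: borel_measurable_continuous_onI)
  have [measurable]: "(\<lambda>x. graph_normal k s g x $ j) \<in> borel_measurable borel"
    using continuous_graph_normal[OF c] by (intro borel_measurable_continuous_onI continuous_intros)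
  have "indicator \<Omega> x * F' x $ j = indicator {x. s * (x $ k - g x) > 0} x * F' x $ j" for x
  proof (cases "x \<in> C")
    case True
    then have "x \<in> U" using C by auto
    from graph_chart_mem[OF c this] show ?thesis by (simp add: indicator_def)
  qed (simp add: F'0)
  then have "(\<integral>x. indicator \<Omega> x * F' x $ j \<partial>lborel) = (\<integral>x. indicator {x. s * (x $ k - g x) > 0} x * F' x $ j \<partial>lborel)"
    by presburger
  also have "\<dots> = (\<integral>y. F (y + g y *\<^sub>R axis k 1) * (s * (grad g y - axis k 1) $ j) \<partial>hyperplane_lborel k)"
    by (rule divergence_graph[OF graph_chart_C1[OF c] graph_chart_invariant[OF c] _ F, where R=R])
       (use graph_chart_sign[OF c] C R in \<open>auto simp: not_le[symmetric]\<close>)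
  also have "\<dots> = (\<integral>y. sqrt (1 + (norm (grad g y))\<^sup>2) * (F (y + g y *\<^sub>R axis k 1) * graph_normal k s g (y + g y *\<^sub>R axis k 1) $ j) \<partial>hyperplane_lborel k)"
  proof (rule Bochner_Integration.integral_cong[OF refl])
    fix y
    have "sqrt (1 + (norm (grad g y))\<^sup>2) \<noteq> 0"
      by (metis add_pos_nonneg less_irrefl real_sqrt_gt_zero zero_le_power2 zero_less_one)
    then show "F (y + g y *\<^sub>R axis k 1) * (s * (grad g y - axis k 1) $ j) =
      sqrt (1 + (norm (grad g y))\<^sup>2) * (F (y + g y *\<^sub>R axis k 1) * graph_normal k s g (y + g y *\<^sub>R axis k 1) $ j)"
      by (simp add: graph_normal_def graph_chart_grad(1)[OF c])
  qed
  also have "\<dots> = (\<integral>x. F x * graph_normal k s g x $ j \<partial>chart_measure k g)"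
    by (rule integral_chart_measure[OF c, symmetric]) auto
  finally show ?thesis .
qed

lemma AE_chart_measure_graph:
  assumes c: "graph_chart \<Omega> U k s g"
  shows "AE x in chart_measure k g. x $ k = g x"
proof -
  note [measurable] = graph_chart_measurable[OF c]
  have *: "AE y in hyperplane_lborel k. (y + g y *\<^sub>R axis k 1) $ k = g (y + g y *\<^sub>R axis k 1)"
    using AE_hyperplane_lborel by eventually_elim (simp add: axis_cart_nth graph_chart_invariant[OF c])
  show ?thesis
    unfolding chart_measure_def
    by (subst AE_distr_iff, simp, measurable, subst AE_density, measurable) (use * in auto)
qed

text \<open>For a test function \<open>F\<close> and the normal components \<open>n j\<close> of the
  first chart, insert \<open>F * n j\<close> into the divergence formula of both charts: the volume
  integrals are the same. Summing over \<open>j\<close> gives \<open>F\<close> times the squared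
  length of the normal, since on the boundary the two normals coincide. So both charts integrate
  \<open>F\<close> equally.\<close>

lemma chart_measure_agree:
  fixes \<Omega> :: "(real^'n::finite) set"
  assumes c: "graph_chart \<Omega> U k s g" and c': "graph_chart \<Omega> U' k' s' g'" and o: "open \<Omega>"
    and A: "A \<in> sets borel" "A \<subseteq> U \<inter> U'"
  shows "emeasure (chart_measure k g) A = emeasure (chart_measure k' g') A"
proof (rule measure_eq_if_C1_integrals_eq[where W="U \<inter> U'"])
  have lf: "emeasure (chart_measure k g) (cbox a b) < \<infinity>" if c: "graph_chart \<Omega> U k s g" for U k s g and a b :: "real^'n"
  proof -
    obtain R where "\<forall>x\<in>cbox a b. norm x \<le> R" using bounded_cbox[of a b] unfolding bounded_iff by blast
    then have "cbox a b \<subseteq> cball 0 R" by auto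
    then have "emeasure (chart_measure k g) (cbox a b) \<le> emeasure (chart_measure k g) (cball 0 R)"
      by (intro emeasure_mono) auto
    then show ?thesis using emeasure_chart_measure_cball[OF c] le_less_trans by blast
  qed
  show "emeasure (chart_measure k g) (cbox a b) < \<infinity>" "emeasure (chart_measure k' g') (cbox a b) < \<infinity>" for a b
    using lf c c' by blast+
  show "open (U \<inter> U')" using graph_chart_open[OF c] graph_chart_open[OF c'] by blast
  fix F D C assume F: "C1_grad UNIV F D" and C: "compact C" "C \<subseteq> U \<inter> U'" "\<And>x. x \<notin> C \<Longrightarrow> F x = 0"
  let ?n = "graph_normal k s g" and ?n' = "graph_normal k' s' g'"
  note cF = C1_grad_continuous[OF F]
  note cn = continuous_graph_normal[OF c] and cn' = continuous_graph_normal[OF c']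
  have eq: "(\<integral>x. F x * ?n x $ j * ?n x $ j \<partial>chart_measure k g) = (\<integral>x. F x * ?n x $ j * ?n' x $ j \<partial>chart_measure k' g')" for j
  proof -
    obtain N where N: "C1_grad UNIV (\<lambda>x. ?n x $ j) N" using C1_grad_graph_normal[OF c] by blast
    note FN = C1_grad_mult[OF F N]
    show ?thesis
      using divergence_chart[OF c FN C(1), of j] divergence_chart[OF c' FN C(1), of j] C by auto
  qed
  have int: "integrable (chart_measure k g) (\<lambda>x. F x * ?n x $ j * ?n x $ j)"
    "integrable (chart_measure k' g') (\<lambda>x. F x * ?n x $ j * ?n' x $ j)" for j
    by (rule integrable_locally_finite[OF _ _ _ C(1)];
        use emeasure_chart_measure_cball[OF c] emeasure_chart_measure_cball[OF c'] C cF cn cn' in \<open>auto intro!: continuous_intros\<close>)+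
  have "(\<integral>x. F x \<partial>chart_measure k g) = (\<integral>x. (\<Sum>j\<in>UNIV. F x * ?n x $ j * ?n x $ j) \<partial>chart_measure k g)"
  proof (rule Bochner_Integration.integral_cong[OF refl])
    fix x
    have "?n x \<bullet> ?n x = 1" using norm_graph_normal[OF c] by (simp add: dot_square_norm)
    then show "F x = (\<Sum>j\<in>UNIV. F x * ?n x $ j * ?n x $ j)"
      by (simp add: inner_vec_def mult.assoc sum_distrib_left[symmetric])
  qed
  also have "\<dots> = (\<integral>x. (\<Sum>j\<in>UNIV. F x * ?n x $ j * ?n' x $ j) \<partial>chart_measure k' g')"
    using int eq by simp
  also have "\<dots> = (\<integral>x. F x \<partial>chart_measure k' g')"
  proof (rule integral_cong_AE)
    show "AE x in chart_measure k' g'. (\<Sum>j\<in>UNIV. F x * ?n x $ j * ?n' x $ j) = F x"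
      using AE_chart_measure_graph[OF c']
    proof eventually_elim
      case (elim x)
      show ?case
      proof (cases "x \<in> C")
        case True
        then have U: "x \<in> U" "x \<in> U'" using C by auto
        then have "?n x = ?n' x"
          using graph_normal_unique[OF c c' o] graph_chart_frontier[OF c' o] elim by blast
        moreover have "?n' x \<bullet> ?n' x = 1" using norm_graph_normal[OF c'] by (simp add: dot_square_norm)
        ultimately show ?thesis by (simp add: inner_vec_def mult.assoc sum_distrib_left[symmetric])
      qed (use C in simp)
    qed
  qed (use cF cn cn' in \<open>simp_all add: measurable_cong_sets[OF sets_chart_measure refl] borel_measurable_continuous_onI continuous_intros\<close>)
  finally show "(\<integral>x. F x \<partial>chart_measure k g) = (\<integral>x. F x \<partial>chart_measure k' g')" .
qed (use A in auto)

lemma add_measures: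
  assumes "sets M = sets N"
  shows "\<exists>L. sets L = sets M \<and> (\<forall>A\<in>sets M. emeasure L A = emeasure M A + emeasure N A)"
proof -
  have "emeasure (measure_of (space M) (sets M) (\<lambda>A. emeasure M A + emeasure N A)) A = emeasure M A + emeasure N A"
    if "A \<in> sets M" for A
  proof (rule emeasure_measure_of_sigma)
    show "sigma_algebra (space M) (sets M)" by (rule sets.sigma_algebra_axioms)
    show "positive (sets M) (\<lambda>A. emeasure M A + emeasure N A)" by (simp add: positive_def)
    show "countably_additive (sets M) (\<lambda>A. emeasure M A + emeasure N A)"
    proof (rule countably_additiveI)
      fix A :: "nat \<Rightarrow> 'a set" assume A: "range A \<subseteq> sets M" "disjoint_family A"
      then have "(\<Sum>i. emeasure M (A i) + emeasure N (A i)) = (\<Sum>i. emeasure M (A i)) + (\<Sum>i. emeasure N (A i))"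
        by (intro suminf_add[symmetric]) auto
      then show "(\<Sum>i. emeasure M (A i) + emeasure N (A i)) = emeasure M (\<Union> (range A)) + emeasure N (\<Union> (range A))"
        using A assms by (simp add: suminf_emeasure)
    qed
  qed fact
  then show ?thesis
    by (intro exI[of _ "measure_of (space M) (sets M) (\<lambda>A. emeasure M A + emeasure N A)"]) simp
qed

text \<open>Chart measures are glued along a finite cover of the compact boundary, one chart domain
  at a time.\<close>

lemma surface_measure_exists:
  fixes \<Omega> :: "(real^'n::finite) set"
  assumes o: "open \<Omega>" and cpt: "compact (closure \<Omega>)" and sb: "smooth_boundary \<Omega>"
  shows "\<exists>\<sigma>. is_surface_measure \<Omega> \<sigma>"
proof -
  have fr_cpt: "compact (frontier \<Omega>)" using cpt by (simp add: compact_frontier_bounded compact_imp_bounded bounded_subset[OF compact_imp_bounded closure_subset])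
  \<comment> \<open>The agreement is demanded for every chart, not only for those with domain in
    \<open>\<U>\<close>, because the definition of a surface measure quantifies over all
    charts.\<close>
  have step: "\<exists>\<sigma>. sets \<sigma> = sets borel \<and> emeasure \<sigma> (- (frontier \<Omega> \<inter> \<Union>\<U>)) = 0 \<and>
     (\<forall>U k s g A. graph_chart \<Omega> U k s g \<and> A \<in> sets borel \<and> A \<subseteq> frontier \<Omega> \<inter> U \<inter> \<Union>\<U> \<longrightarrow>
        emeasure \<sigma> A = emeasure (chart_measure k g) A)"
    if "finite \<U>" "\<And>U. U \<in> \<U> \<Longrightarrow> \<exists>k s g. graph_chart \<Omega> U k s g" for \<U>
    using that
  proof (induction \<U>)
    case empty
    have "emeasure (null_measure borel) A = 0" for A :: "(real^'n) set" by simp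
    then show ?case by (intro exI[of _ "null_measure borel"]) auto
  next
    case (insert U0 \<U>)
    let ?W = "\<Union>\<U>" and ?F = "frontier \<Omega>"
    obtain \<sigma> where s1: "sets \<sigma> = sets borel" and s2: "emeasure \<sigma> (- (?F \<inter> ?W)) = 0"
      and s3: "\<And>U k s g A. graph_chart \<Omega> U k s g \<Longrightarrow> A \<in> sets borel \<Longrightarrow> A \<subseteq> ?F \<inter> U \<inter> ?W \<Longrightarrow>
        emeasure \<sigma> A = emeasure (chart_measure k g) A"
      using insert by (metis insertCI)
    obtain k0 s0 g0 where c0: "graph_chart \<Omega> U0 k0 s0 g0" using insert.prems by blast
    have oW: "open ?W" using insert.prems graph_chart_open by (intro open_Union) blast
    have oU: "open U0" by (rule graph_chart_open[OF c0])
    \<comment> \<open>The part of the boundary that the new chart covers for the first time;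
      restricting its measure to \<open>D\<close> avoids counting the overlap twice.\<close>
    define D where "D = ?F \<inter> U0 - ?W"
    have D: "D \<in> sets borel" using oW oU by (auto simp: D_def)
    have FW: "?F \<inter> ?W \<in> sets borel" using oW by auto
    obtain \<tau> where t1: "sets \<tau> = sets borel" and t2: "\<And>A. A \<in> sets borel \<Longrightarrow> emeasure \<tau> A =
        emeasure \<sigma> A + emeasure (density (chart_measure k0 g0) (indicator D)) A"
      using add_measures[of \<sigma> "density (chart_measure k0 g0) (indicator D)"] s1 by auto
    have t3: "emeasure \<tau> A = emeasure \<sigma> A + emeasure (chart_measure k0 g0) (A \<inter> D)" if "A \<in> sets borel" for A
      using that D by (simp add: t2 emeasure_density indicator_inter_arith[symmetric] Int_commute)
    have "emeasure \<tau> (- (?F \<inter> \<Union>(insert U0 \<U>))) = 0"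
    proof -
      have eq: "- (?F \<inter> \<Union>(insert U0 \<U>)) = - (?F \<inter> (U0 \<union> ?W))" by simp
      have "?F \<inter> (U0 \<union> ?W) \<in> sets borel" using oW oU by (intro sets.Int borel_closed borel_open open_Un) auto
      then have b: "- (?F \<inter> (U0 \<union> ?W)) \<in> sets borel" by (rule borel_comp)
      have b2: "- (?F \<inter> ?W) \<in> sets borel" using FW by (rule borel_comp)
      have "emeasure \<sigma> (- (?F \<inter> (U0 \<union> ?W))) \<le> emeasure \<sigma> (- (?F \<inter> ?W))"
        by (rule emeasure_mono) (use b2 s1 in blast)+
      moreover have "- (?F \<inter> (U0 \<union> ?W)) \<inter> D = {}" unfolding D_def by blast
      ultimately show ?thesis unfolding eq using s2 b by (simp add: t3)
    qed
    moreover have "emeasure \<tau> A = emeasure (chart_measure k g) A"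
      if c: "graph_chart \<Omega> U k s g" and A: "A \<in> sets borel" "A \<subseteq> ?F \<inter> U \<inter> \<Union>(insert U0 \<U>)" for U k s g A
    proof -
      have AW: "A \<inter> ?W \<in> sets borel" "A - ?W \<in> sets borel" using A(1) oW by (auto simp del: Int_Union2)
      have "emeasure \<sigma> (A - ?W) \<le> emeasure \<sigma> (- (?F \<inter> ?W))"
        by (rule emeasure_mono) (use FW s1 borel_comp in blast)+
      then have z: "emeasure \<sigma> (A - ?W) = 0" using s2 by simp
      have "emeasure \<sigma> A = emeasure \<sigma> (A \<inter> ?W) + emeasure \<sigma> (A - ?W)"
        using AW s1 plus_emeasure[of "A \<inter> ?W" \<sigma> "A - ?W"] by (simp add: Int_Diff_Un Int_Diff_disjoint)
      also have "\<dots> = emeasure (chart_measure k g) (A \<inter> ?W)"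
        using z s3[OF c AW(1)] A(2) by (simp add: le_infI1 le_infI2 Int_assoc)
      finally have 1: "emeasure \<sigma> A = emeasure (chart_measure k g) (A \<inter> ?W)" .
      have AU: "A - ?W \<subseteq> U0 \<inter> U" "A \<inter> ?W \<subseteq> ?F \<inter> U \<inter> ?W" using A(2) by blast+
      have "A \<inter> D = A - ?W" using A(2) unfolding D_def by blast
      then have 2: "emeasure (chart_measure k0 g0) (A \<inter> D) = emeasure (chart_measure k g) (A - ?W)"
        using chart_measure_agree[OF c0 c o AW(2)] AU by simp
      have "emeasure (chart_measure k g) A = emeasure (chart_measure k g) (A \<inter> ?W) + emeasure (chart_measure k g) (A - ?W)"
        using AW plus_emeasure[of "A \<inter> ?W" "chart_measure k g" "A - ?W"] by (simp add: Int_Diff_Un Int_Diff_disjoint)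
      then show ?thesis using 1 2 by (simp add: t3 A)
    qed
    ultimately show ?case using t1 by blast
  qed
  define \<C> where "\<C> = {U. \<exists>k s g. graph_chart \<Omega> U k s g}"
  have "frontier \<Omega> \<subseteq> \<Union>\<C>" using sb unfolding smooth_boundary_def \<C>_def by blast
  moreover have "\<And>U. U \<in> \<C> \<Longrightarrow> open U" using graph_chart_open by (auto simp: \<C>_def)
  ultimately obtain \<U> where U: "\<U> \<subseteq> \<C>" "finite \<U>" "frontier \<Omega> \<subseteq> \<Union>\<U>"
    using fr_cpt compactE by metis
  have pre: "\<And>U. U \<in> \<U> \<Longrightarrow> \<exists>k s g. graph_chart \<Omega> U k s g" using U(1) unfolding \<C>_def by auto
  from step[OF U(2) pre] obtain \<sigma> where \<sigma>: "sets \<sigma> = sets borel \<and> emeasure \<sigma> (- (frontier \<Omega> \<inter> \<Union>\<U>)) = 0 \<and>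
     (\<forall>U k s g A. graph_chart \<Omega> U k s g \<and> A \<in> sets borel \<and> A \<subseteq> frontier \<Omega> \<inter> U \<inter> \<Union>\<U> \<longrightarrow>
        emeasure \<sigma> A = emeasure (chart_measure k g) A)" ..
  have FU: "frontier \<Omega> \<inter> \<Union>\<U> = frontier \<Omega>" using U(3) by (rule Int_absorb2)
  have "is_surface_measure \<Omega> \<sigma>"
    unfolding is_surface_measure_def
  proof (intro conjI allI impI)
    show "sets \<sigma> = sets borel" "emeasure \<sigma> (- frontier \<Omega>) = 0" using \<sigma> unfolding FU by simp_all
    fix V k s g A assume A: "graph_chart \<Omega> V k s g \<and> A \<in> sets borel \<and> A \<subseteq> frontier \<Omega> \<inter> V"
    then have "A \<subseteq> frontier \<Omega> \<inter> V \<inter> \<Union>\<U>" using U(3) by blast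
    then have "emeasure \<sigma> A = emeasure (chart_measure k g) A" using \<sigma> A by blast
    then show "emeasure \<sigma> A = (\<integral>\<^sup>+ y. ennreal (sqrt (1 + (norm (grad g y))\<^sup>2)) * indicator A (y + g y *\<^sub>R axis k 1) \<partial>hyperplane_lborel k)"
      using emeasure_chart_measure[of \<Omega> V k s g A] A by simp
  qed
  then show ?thesis ..
qed

section \<open>The divergence theorem\<close>

locale smooth_domain =
  fixes \<Omega> :: "(real^'n::finite) set"
  assumes open_domain: "open \<Omega>" and compact_closure: "compact (closure \<Omega>)"
    and smooth_boundary: "smooth_boundary \<Omega>"
begin

abbreviation \<sigma> :: "(real^'n) measure" where "\<sigma> \<equiv> surface_measure \<Omega>"

lemma is_surface_measure_surface_measure: "is_surface_measure \<Omega> \<sigma>"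
  unfolding surface_measure_def
  using surface_measure_exists[OF open_domain compact_closure smooth_boundary] by (rule someI_ex)

lemma sets_surface_measure [measurable_cong, simp]: "sets \<sigma> = sets borel"
  using is_surface_measure_surface_measure by (simp add: is_surface_measure_def)

lemma space_surface_measure [simp]: "space \<sigma> = UNIV"
  using sets_eq_imp_space_eq[OF sets_surface_measure] by simp

lemma emeasure_surface_measure:
  assumes "graph_chart \<Omega> U k s g" "A \<in> sets borel" "A \<subseteq> frontier \<Omega> \<inter> U"
  shows "emeasure \<sigma> A = emeasure (chart_measure k g) A"
proof -
  have "emeasure \<sigma> A = (\<integral>\<^sup>+ y. ennreal (sqrt (1 + (norm (grad g y))\<^sup>2)) * indicator A (y + g y *\<^sub>R axis k 1) \<partial>hyperplane_lborel k)"
    using is_surface_measure_surface_measure assms unfolding is_surface_measure_def by blast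
  then show ?thesis using emeasure_chart_measure[OF assms(1,2)] by simp
qed

lemma frontier_subset_closure: "frontier \<Omega> \<subseteq> closure \<Omega>"
  by (simp add: frontier_def)

lemma compact_frontier_domain: "compact (frontier \<Omega>)"
  using compact_closure closed_Int_compact[of "frontier \<Omega>" "closure \<Omega>"] frontier_subset_closure
  by (simp add: Int_absorb2)

lemma frontier_borel [measurable]: "frontier \<Omega> \<in> sets borel"
  by (simp add: borel_closed)

lemma domain_borel [measurable]: "\<Omega> \<in> sets borel"
  using open_domain by simp

lemma domain_frontier_disjoint: "\<Omega> \<inter> frontier \<Omega> = {}"
  using open_domain by (auto simp: frontier_def interior_open)

lemma closure_cases: "x \<in> closure \<Omega> \<Longrightarrow> x \<in> \<Omega> \<or> x \<in> frontier \<Omega>"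
  using open_domain by (auto simp: frontier_def interior_open)

lemma chart_at:
  assumes "x \<in> frontier \<Omega>"
  obtains U k s g where "x \<in> U" "graph_chart \<Omega> U k s g"
  using assms smooth_boundary unfolding smooth_boundary_def by blast

lemma AE_surface_measure: "AE x in \<sigma>. x \<in> frontier \<Omega>"
proof -
  have "emeasure \<sigma> (- frontier \<Omega>) = 0"
    using is_surface_measure_surface_measure by (simp add: is_surface_measure_def)
  moreover have "- frontier \<Omega> \<in> sets \<sigma>" using frontier_borel by (simp only: sets_surface_measure borel_comp)
  ultimately show ?thesis by (intro AE_I[where N="- frontier \<Omega>"]) auto
qed

text \<open>Chart measures are finite on bounded sets, and finitely many balls contained in chart
  domains cover the boundary.\<close>

lemma finite_measure_surface_measure: "finite_measure \<sigma>"
proof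
  define \<C> where "\<C> = {ball x r | x r. \<exists>U k s g. graph_chart \<Omega> U k s g \<and> cball x r \<subseteq> U}"
  have cov: "frontier \<Omega> \<subseteq> \<Union>\<C>"
  proof
    fix x assume "x \<in> frontier \<Omega>"
    then obtain U k s g where U: "x \<in> U" "graph_chart \<Omega> U k s g" by (rule chart_at)
    then obtain r where "r > 0" "cball x r \<subseteq> U" using graph_chart_open open_contains_cball by blast
    then have "x \<in> ball x r" by simp
    moreover have "ball x r \<in> \<C>" unfolding \<C>_def using U(2) \<open>cball x r \<subseteq> U\<close> by blast
    ultimately show "x \<in> \<Union>\<C>" by blast
  qed
  have "\<And>B. B \<in> \<C> \<Longrightarrow> open B" by (auto simp: \<C>_def)
  then obtain \<D> where D: "\<D> \<subseteq> \<C>" "finite \<D>" "frontier \<Omega> \<subseteq> \<Union>\<D>"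
    using compactE[OF compact_frontier_domain cov] by metis
  have fin: "emeasure \<sigma> (B \<inter> frontier \<Omega>) < \<infinity>" if BD: "B \<in> \<D>" for B
  proof -
    obtain x r U k s g where B: "B = ball x r" "graph_chart \<Omega> U k s g" "cball x r \<subseteq> U"
      using BD D(1) unfolding \<C>_def by blast
    have "emeasure \<sigma> (B \<inter> frontier \<Omega>) = emeasure (chart_measure k g) (B \<inter> frontier \<Omega>)"
      using B by (intro emeasure_surface_measure[OF B(2)]) auto
    also have "\<dots> \<le> emeasure (chart_measure k g) (cball 0 (norm x + r))"
    proof (rule emeasure_mono)
      show "B \<inter> frontier \<Omega> \<subseteq> cball 0 (norm x + r)"
      proof
        fix y assume "y \<in> B \<inter> frontier \<Omega>"
        then have "dist x y < r" by (simp add: B)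
        then show "y \<in> cball 0 (norm x + r)"
          using norm_triangle_ineq[of x "y - x"] by (simp add: dist_norm norm_minus_commute)
      qed
    qed simp
    also have "\<dots> < \<infinity>" by (rule emeasure_chart_measure_cball[OF B(2)])
    finally show ?thesis .
  qed
  have Db: "B \<inter> frontier \<Omega> \<in> sets borel" if "B \<in> \<D>" for B
    using that D(1) by (auto simp: \<C>_def)
  have "emeasure \<sigma> (frontier \<Omega>) \<le> emeasure \<sigma> (\<Union>B\<in>\<D>. B \<inter> frontier \<Omega>)"
    using D(3) by (intro emeasure_mono) (auto simp: sets_surface_measure Db simp del: UN_simps intro!: sets.finite_UN D(2))
  also have "\<dots> \<le> (\<Sum>B\<in>\<D>. emeasure \<sigma> (B \<inter> frontier \<Omega>))"
    using D(2) Db by (intro emeasure_subadditive_finite) auto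
  also have "\<dots> < \<infinity>" using fin D(2) by (simp add: ennreal_sum_less_top)
  finally have f: "emeasure \<sigma> (frontier \<Omega>) < \<infinity>" .
  have "emeasure \<sigma> (space \<sigma>) = emeasure \<sigma> (frontier \<Omega>)"
    using AE_surface_measure by (intro emeasure_eq_AE) auto
  then show "emeasure \<sigma> (space \<sigma>) \<noteq> \<infinity>" using f by simp
qed

lemma continuous_outer_normal: "continuous_on (frontier \<Omega>) (outer_normal \<Omega>)"
proof (rule continuous_on_eq_continuous_within[THEN iffD2], rule ballI)
  fix x assume x: "x \<in> frontier \<Omega>"
  then obtain U k s g where U: "x \<in> U" "graph_chart \<Omega> U k s g" by (rule chart_at)
  then obtain r where r: "r > 0" "ball x r \<subseteq> U" using graph_chart_open open_contains_ball by blast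
  show "continuous (at x within frontier \<Omega>) (outer_normal \<Omega>)"
  proof (rule continuous_transform_within[where f="graph_normal k s g" and \<delta>=r])
    show "continuous (at x within frontier \<Omega>) (graph_normal k s g)"
      using continuous_graph_normal[OF U(2)] continuous_at_imp_continuous_at_within
      by (auto simp: continuous_on_eq_continuous_at)
    show "graph_normal k s g y = outer_normal \<Omega> y" if "y \<in> frontier \<Omega>" "dist y x < r" for y
      using that r by (intro outer_normal_eq[OF U(2) open_domain, symmetric]) (auto simp: dist_commute)
  qed (use r x in auto)
qed

lemma norm_outer_normal: "x \<in> frontier \<Omega> \<Longrightarrow> norm (outer_normal \<Omega> x) = 1"
proof -
  assume x: "x \<in> frontier \<Omega>"
  then obtain U k s g where U: "x \<in> U" "graph_chart \<Omega> U k s g" by (rule chart_at)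
  show ?thesis using outer_normal_eq[OF U(2) open_domain x U(1)] norm_graph_normal[OF U(2)] by simp
qed

lemma integrable_frontier:
  fixes f :: "real^'n \<Rightarrow> real"
  assumes "continuous_on (frontier \<Omega>) f"
  shows "integrable \<sigma> (\<lambda>x. indicator (frontier \<Omega>) x * f x)"
proof -
  interpret finite_measure \<sigma> by (rule finite_measure_surface_measure)
  have "bounded (f ` frontier \<Omega>)"
    using assms compact_frontier_domain by (intro compact_imp_bounded compact_continuous_image)
  then obtain B where B: "\<And>x. x \<in> frontier \<Omega> \<Longrightarrow> \<bar>f x\<bar> \<le> B" by (auto simp: bounded_real)
  have "AE x in \<sigma>. norm (indicator (frontier \<Omega>) x * f x) \<le> B"
    using AE_surface_measure by eventually_elim (use B in auto)
  moreover have "(\<lambda>x. indicator (frontier \<Omega>) x *\<^sub>R f x) \<in> borel_measurable borel"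
    using assms by (rule borel_measurable_continuous_on_indicator[OF frontier_borel])
  ultimately show ?thesis by (intro integrable_const_bound) auto
qed

lemma integrable_domain:
  fixes f :: "real^'n \<Rightarrow> real"
  assumes "continuous_on (closure \<Omega>) f"
  shows "integrable lborel (\<lambda>x. indicator \<Omega> x * f x)"
proof -
  have "bounded (f ` closure \<Omega>)"
    using assms compact_closure by (intro compact_imp_bounded compact_continuous_image)
  then obtain B where B: "\<And>x. x \<in> closure \<Omega> \<Longrightarrow> \<bar>f x\<bar> \<le> B" by (auto simp: bounded_real)
  have m: "(\<lambda>x. indicator \<Omega> x *\<^sub>R f x) \<in> borel_measurable borel"
    using continuous_on_subset[OF assms closure_subset] by (rule borel_measurable_continuous_on_indicator[OF domain_borel])
  obtain R where R: "\<And>x. x \<in> closure \<Omega> \<Longrightarrow> norm x \<le> R"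
    using compact_imp_bounded[OF compact_closure] bounded_iff by blast
  have in_cl: "x \<in> \<Omega> \<Longrightarrow> x \<in> closure \<Omega>" for x using closure_subset by blast
  have "\<bar>indicator \<Omega> x * f x\<bar> \<le> max 0 B" for x
    using B[OF in_cl, of x] by (auto simp: indicator_def)
  moreover have "indicator \<Omega> x * f x = 0" if "norm x > R" for x
    using R[OF in_cl, of x] that by (auto simp: indicator_def)
  ultimately show ?thesis using m by (intro integrable_bounded_support[where R=R and B="max 0 B"]) auto
qed

text \<open>The chart measure lives on the graph, which inside \<open>U\<close> is the boundary, and
  there both measures have the same restriction. Outside \<open>U\<close> the integrand
  vanishes.\<close>

lemma integral_surface_measure_chart:
  fixes f :: "real^'n \<Rightarrow> real"
  assumes c: "graph_chart \<Omega> U k s g" and f[measurable]: "f \<in> borel_measurable borel"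
    and supp: "\<And>x. x \<notin> U \<Longrightarrow> f x = 0"
  shows "(\<integral>x. f x \<partial>\<sigma>) = (\<integral>x. f x \<partial>chart_measure k g)"
proof -
  let ?S = "frontier \<Omega> \<inter> U"
  have [measurable]: "?S \<in> sets borel" using graph_chart_open[OF c] by auto
  have eq: "density \<sigma> (\<lambda>x. ennreal (indicator ?S x)) = density (chart_measure k g) (\<lambda>x. ennreal (indicator ?S x))"
  proof (rule measure_eqI)
    fix A assume "A \<in> sets (density \<sigma> (\<lambda>x. ennreal (indicator ?S x)))"
    then have A[measurable]: "A \<in> sets borel" by simp
    have "emeasure \<sigma> (?S \<inter> A) = emeasure (chart_measure k g) (?S \<inter> A)"
      by (rule emeasure_surface_measure[OF c]) auto
    then show "emeasure (density \<sigma> (\<lambda>x. ennreal (indicator ?S x))) A = emeasure (density (chart_measure k g) (\<lambda>x. ennreal (indicator ?S x))) A"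
      by (simp add: emeasure_density ennreal_indicator indicator_inter_arith[symmetric])
  qed simp
  have "(\<integral>x. f x \<partial>\<sigma>) = (\<integral>x. indicator ?S x *\<^sub>R f x \<partial>\<sigma>)"
  proof (rule integral_cong_AE)
    show "AE x in \<sigma>. f x = indicator ?S x *\<^sub>R f x"
      using AE_surface_measure by eventually_elim (use supp in \<open>auto simp: indicator_def\<close>)
  qed auto
  also have "\<dots> = (\<integral>x. f x \<partial>density \<sigma> (\<lambda>x. ennreal (indicator ?S x)))"
    by (rule integral_density[symmetric]) auto
  also have "\<dots> = (\<integral>x. indicator ?S x *\<^sub>R f x \<partial>chart_measure k g)"
    unfolding eq by (rule integral_density) auto
  also have "\<dots> = (\<integral>x. f x \<partial>chart_measure k g)"
  proof (rule integral_cong_AE)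
    show "AE x in chart_measure k g. indicator ?S x *\<^sub>R f x = f x"
      using AE_chart_measure_graph[OF c]
    proof eventually_elim
      case (elim x)
      then show ?case using supp[of x] graph_chart_frontier[OF c open_domain, of x] by (cases "x \<in> U") auto
    qed
  qed auto
  finally show ?thesis .
qed

text \<open>For support inside the domain both sides are zero; for support in a chart the formula
  over a graph applies.\<close>

lemma divergence_local:
  assumes F: "C1_grad UNIV F F'" and C: "compact C" "\<And>x. x \<notin> C \<Longrightarrow> F x = 0"
    and loc: "C \<subseteq> \<Omega> \<or> (\<exists>U k s g. graph_chart \<Omega> U k s g \<and> C \<subseteq> U)"
  shows "(\<integral>x. indicator \<Omega> x * F' x $ j \<partial>lborel) =
    (\<integral>x. indicator (frontier \<Omega>) x * (F x * outer_normal \<Omega> x $ j) \<partial>\<sigma>)"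
  using loc
proof
  assume CO: "C \<subseteq> \<Omega>"
  obtain R where R: "\<And>x. x \<in> C \<Longrightarrow> norm x \<le> R" using compact_imp_bounded[OF C(1)] bounded_iff by blast
  have "F' x = 0" if "x \<notin> C" for x
    by (rule C1_grad_zero_on_open[OF F, of "- C"]) (use C that compact_imp_closed in auto)
  then have "indicator \<Omega> x * F' x $ j = 1 * F' x $ j" for x using CO by (cases "x \<in> C") auto
  then have "(\<integral>x. indicator \<Omega> x * F' x $ j \<partial>lborel) = (\<integral>x. 1 * F' x $ j \<partial>lborel)" by presburger
  also have "\<dots> = 0"
    by (rule integral_weighted_partial(2)[OF F, where R=R and B=1]) (use C R in \<open>auto simp: not_le[symmetric]\<close>)
  finally have l: "(\<integral>x. indicator \<Omega> x * F' x $ j \<partial>lborel) = 0" .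
  have "indicator (frontier \<Omega>) x * (F x * outer_normal \<Omega> x $ j) = 0" for x
    using C(2)[of x] CO domain_frontier_disjoint by (auto simp: indicator_def)
  then have "(\<integral>x. indicator (frontier \<Omega>) x * (F x * outer_normal \<Omega> x $ j) \<partial>\<sigma>) = (\<integral>x. 0 \<partial>\<sigma>)" by presburger
  then show ?thesis using l by simp
next
  assume "\<exists>U k s g. graph_chart \<Omega> U k s g \<and> C \<subseteq> U"
  then obtain U k s g where c: "graph_chart \<Omega> U k s g" and CU: "C \<subseteq> U" by blast
  have cn: "continuous_on UNIV (\<lambda>x. F x * graph_normal k s g x $ j)"
    by (intro continuous_intros C1_grad_continuous[OF F] continuous_graph_normal[OF c])
  have con: "continuous_on (frontier \<Omega>) (\<lambda>x. F x * outer_normal \<Omega> x $ j)"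
    by (intro continuous_intros continuous_on_subset[OF C1_grad_continuous[OF F]] continuous_outer_normal) auto
  have "(\<integral>x. indicator \<Omega> x * F' x $ j \<partial>lborel) = (\<integral>x. F x * graph_normal k s g x $ j \<partial>chart_measure k g)"
    by (rule divergence_chart[OF c F C(1) CU C(2)])
  also have "\<dots> = (\<integral>x. F x * graph_normal k s g x $ j \<partial>\<sigma>)"
    by (rule integral_surface_measure_chart[OF c, symmetric]) (use cn C CU in \<open>auto intro: borel_measurable_continuous_onI\<close>)
  also have "\<dots> = (\<integral>x. indicator (frontier \<Omega>) x * (F x * outer_normal \<Omega> x $ j) \<partial>\<sigma>)"
  proof (rule integral_cong_AE)
    show "AE x in \<sigma>. F x * graph_normal k s g x $ j = indicator (frontier \<Omega>) x * (F x * outer_normal \<Omega> x $ j)"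
      using AE_surface_measure
    proof eventually_elim
      case (elim x)
      then show ?case using outer_normal_eq[OF c open_domain, of x] C(2)[of x] CU by (cases "x \<in> C") auto
    qed
    show "(\<lambda>x. F x * graph_normal k s g x $ j) \<in> borel_measurable \<sigma>"
      using cn by (simp add: measurable_cong_sets[OF sets_surface_measure refl] borel_measurable_continuous_onI)
    show "(\<lambda>x. indicator (frontier \<Omega>) x * (F x * outer_normal \<Omega> x $ j)) \<in> borel_measurable \<sigma>"
      using integrable_frontier[OF con] by (rule borel_measurable_integrable)
  qed
  finally show ?thesis .
qed

end

lemma cutoff_exists:
  fixes x :: "real^'n::finite"
  assumes r: "r > 0"
  shows "\<exists>\<beta> D. C1_grad UNIV \<beta> D \<and> (\<forall>y\<in>ball x r. \<beta> y = 1) \<and> (\<forall>y. y \<notin> cball x (2 * r) \<longrightarrow> \<beta> y = 0)"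
proof -
  define d where "d y = (y - x) \<bullet> (y - x)" for y :: "real^'n"
  have d: "d y = (dist x y)\<^sup>2" for y
    by (simp add: d_def dist_norm norm_minus_commute[of x] power2_norm_eq_inner)
  have d': "C1_grad UNIV d (\<lambda>y. 2 *\<^sub>R (y - x))"
    unfolding C1_grad_def gderiv_def d_def
    by (auto intro!: derivative_eq_intros continuous_intros simp: inner_commute algebra_simps inner_diff_right)
  \<comment> \<open>Within distance \<open>r\<close> the inner argument is at least 3/4, its square
    is at least 9/16, and the factor 4 lifts this above 1, so the outer \<open>sqpos\<close> is
    zero. Beyond \<open>2 * r\<close> the inner \<open>sqpos\<close> is zero and the outer one
    equals 1.\<close>
  define \<beta> where "\<beta> y = 1 - sqpos (1 - 4 * sqpos (1 - (1 / (4 * r\<^sup>2)) * d y))" for y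
  obtain D where D: "C1_grad UNIV \<beta> D"
    unfolding \<beta>_def by atomize_elim (rule exI, (rule d' C1_intros)+)
  have one: "\<beta> y = 1" if "y \<in> ball x r" for y
  proof -
    have "(dist x y)\<^sup>2 \<le> r\<^sup>2" using that r by (intro power_mono) auto
    then have q: "1 - (1 / (4 * r\<^sup>2)) * d y \<ge> 3 / 4" using r by (simp add: d field_simps)
    have "sqpos (1 - (1 / (4 * r\<^sup>2)) * d y) \<ge> (3 / 4)\<^sup>2"
      using q by (subst sqpos_simps(2)) (auto intro!: power_mono)
    then show ?thesis by (simp add: \<beta>_def power2_eq_square)
  qed
  have zero: "\<beta> y = 0" if "y \<notin> cball x (2 * r)" for y
  proof -
    have "(2 * r)\<^sup>2 \<le> (dist x y)\<^sup>2" using that r by (intro power_mono) auto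
    then have "1 - (1 / (4 * r\<^sup>2)) * d y \<le> 0" using r by (simp add: d field_simps power2_eq_square)
    then show ?thesis by (simp add: \<beta>_def)
  qed
  show ?thesis by (intro exI[of _ \<beta>] exI[of _ D]) (use D one zero in auto)
qed

context smooth_domain begin

text \<open>In place of a partition of unity, pieces are peeled off one ball at a time: subtracting
  \<open>\<beta>\<close> times \<open>F\<close> leaves a function that vanishes on the ball just
  treated, and the subtracted piece is supported where the local formula holds.\<close>

theorem divergence_theorem:
  assumes V: "open V" "closure \<Omega> \<subseteq> V" and F: "C1_grad V F F'"
  shows "(\<integral>x. indicator \<Omega> x * F' x $ j \<partial>lborel) =
    (\<integral>x. indicator (frontier \<Omega>) x * (F x * outer_normal \<Omega> x $ j) \<partial>\<sigma>)"
proof -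
  define good where "good x r \<longleftrightarrow> r > 0 \<and> cball x (2 * r) \<subseteq> V \<and>
    (cball x (2 * r) \<subseteq> \<Omega> \<or> (\<exists>U k s g. graph_chart \<Omega> U k s g \<and> cball x (2 * r) \<subseteq> U))" for x r
  \<comment> \<open>The induction is on the finite set of balls outside of which \<open>F\<close>
    vanishes on the closure; at the end nothing of \<open>F\<close> is left there.\<close>
  have main: "(\<integral>x. indicator \<Omega> x * F' x $ j \<partial>lborel) =
      (\<integral>x. indicator (frontier \<Omega>) x * (F x * outer_normal \<Omega> x $ j) \<partial>\<sigma>)"
    if "finite K" "\<And>x r. (x, r) \<in> K \<Longrightarrow> good x r" "C1_grad V F F'"
      "\<And>y. y \<in> closure \<Omega> \<Longrightarrow> (\<And>x r. (x, r) \<in> K \<Longrightarrow> y \<notin> ball x r) \<Longrightarrow> F y = 0" for K F F'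
    using that
  proof (induction K arbitrary: F F')
    case empty
    have F0: "F y = 0" if "y \<in> closure \<Omega>" for y using empty(3)[of y] that by simp
    have sub: "\<Omega> \<subseteq> closure \<Omega>" by (rule closure_subset)
    have "F' y = 0" if "y \<in> \<Omega>" for y
      by (rule C1_grad_zero_on_open[OF empty(2) open_domain _ _ that]) (use sub V F0 in auto)
    then have "indicator \<Omega> y * F' y $ j = 0" for y by (auto simp: indicator_def)
    moreover have "indicator (frontier \<Omega>) y * (F y * outer_normal \<Omega> y $ j) = 0" for y
      using F0[of y] frontier_subset_closure by (auto simp: indicator_def)
    ultimately show ?case by (simp only: integral_zero)
  next
    case (insert p K)
    obtain x r where p: "p = (x, r)" by (cases p)
    have g: "good x r" using insert.prems(1) p by blast
    then obtain \<beta> D where b: "C1_grad UNIV \<beta> D" "\<And>y. y \<in> ball x r \<Longrightarrow> \<beta> y = 1" "\<And>y. y \<notin> cball x (2 * r) \<Longrightarrow> \<beta> y = 0"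
      using cutoff_exists[of r x] unfolding good_def by blast
    have bV: "C1_grad V \<beta> D" using b(1) by (rule C1_grad_subset) simp
    note F = insert.prems(2)
    define G where "G y = \<beta> y * F y" for y
    \<comment> \<open>Extended by 0 beyond \<open>V\<close>, where nothing is known about
      \<open>F\<close>. The cutoff vanishes near such points because its support lies in
      \<open>V\<close>, so the two local descriptions of \<open>G\<close> patch together.\<close>
    define G' where "G' y = (if y \<in> V then \<beta> y *\<^sub>R F' y + F y *\<^sub>R D y else 0)" for y
    have GV: "C1_grad V G G'"
      unfolding G_def by (rule C1_grad_cong[OF C1_grad_mult[OF bV F]]) (simp add: G'_def)
    have D0: "D y = 0" if "y \<notin> cball x (2 * r)" for y
      by (rule C1_grad_zero_on_open[OF b(1), of "- cball x (2 * r)"]) (use b(3) that in auto)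
    have GC: "C1_grad (- cball x (2 * r)) G G'"
    proof (rule C1_grad_cong_open[where F="\<lambda>_. 0"])
      show "C1_grad (- cball x (2 * r)) (\<lambda>_. 0) G'"
        by (rule C1_grad_cong[OF C1_grad_const]) (use b(3) D0 in \<open>auto simp: G'_def\<close>)
    qed (use b(3) in \<open>auto simp: G_def\<close>)
    have VC: "V \<union> - cball x (2 * r) = UNIV" using g by (auto simp: good_def)
    have "continuous_on (V \<union> - cball x (2 * r)) G'"
      by (rule continuous_on_open_Un) (use GV GC V(1) in \<open>auto simp: C1_grad_def\<close>)
    moreover have "GDERIV G y :> G' y" for y
      using GV GC VC unfolding C1_grad_def by blast
    ultimately have G: "C1_grad UNIV G G'" unfolding VC C1_grad_def by blast
    have Gint: "(\<integral>x. indicator \<Omega> x * G' x $ j \<partial>lborel) =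
        (\<integral>x. indicator (frontier \<Omega>) x * (G x * outer_normal \<Omega> x $ j) \<partial>\<sigma>)"
      by (rule divergence_local[OF G compact_cball[of x "2 * r"]]) (use b(3) g in \<open>auto simp: G_def good_def\<close>)
    have H: "C1_grad V (\<lambda>x. F x - G x) (\<lambda>x. F' x - G' x)" by (rule C1_grad_diff[OF F GV])
    have Hint: "(\<integral>x. indicator \<Omega> x * (F' x - G' x) $ j \<partial>lborel) =
        (\<integral>x. indicator (frontier \<Omega>) x * ((F x - G x) * outer_normal \<Omega> x $ j) \<partial>\<sigma>)"
    proof (rule insert.IH[OF _ H])
      show "good x r" if "(x, r) \<in> K" for x r using insert.prems(1) that by blast
      fix y assume y: "y \<in> closure \<Omega>" "\<And>x r. (x, r) \<in> K \<Longrightarrow> y \<notin> ball x r"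
      show "F y - G y = 0"
      proof (cases "y \<in> ball x r")
        case True
        then show ?thesis using b(2) by (simp add: G_def)
      next
        case False
        then have "F y = 0" using y p by (intro insert.prems(3)) auto
        then show ?thesis by (simp add: G_def)
      qed
    qed
    have cl: "continuous_on (closure \<Omega>) f" if "continuous_on V f" for f :: "_ \<Rightarrow> real^'n"
      using that V(2) by (rule continuous_on_subset)
    have fr: "continuous_on (frontier \<Omega>) f" if "continuous_on V f" for f :: "_ \<Rightarrow> real"
      using that V(2) frontier_subset_closure by (auto intro: continuous_on_subset)
    have i1: "integrable lborel (\<lambda>x. indicator \<Omega> x * G' x $ j)" "integrable lborel (\<lambda>x. indicator \<Omega> x * (F' x - G' x) $ j)"
      by (intro integrable_domain continuous_intros cl C1_grad_continuous_grad[OF GV] C1_grad_continuous_grad[OF F])+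
    have i2: "integrable \<sigma> (\<lambda>x. indicator (frontier \<Omega>) x * (G x * outer_normal \<Omega> x $ j))"
       "integrable \<sigma> (\<lambda>x. indicator (frontier \<Omega>) x * ((F x - G x) * outer_normal \<Omega> x $ j))"
      by (intro integrable_frontier continuous_intros fr C1_grad_continuous[OF GV] C1_grad_continuous[OF F] continuous_outer_normal)+
    have "(\<integral>x. indicator \<Omega> x * F' x $ j \<partial>lborel) =
      (\<integral>x. indicator \<Omega> x * G' x $ j + indicator \<Omega> x * (F' x - G' x) $ j \<partial>lborel)"
      by (simp add: algebra_simps)
    also have "\<dots> = (\<integral>x. indicator (frontier \<Omega>) x * (G x * outer_normal \<Omega> x $ j) \<partial>\<sigma>) +
       (\<integral>x. indicator (frontier \<Omega>) x * ((F x - G x) * outer_normal \<Omega> x $ j) \<partial>\<sigma>)"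
      using i1 Gint Hint by simp
    also have "\<dots> = (\<integral>x. indicator (frontier \<Omega>) x * (G x * outer_normal \<Omega> x $ j) +
       indicator (frontier \<Omega>) x * ((F x - G x) * outer_normal \<Omega> x $ j) \<partial>\<sigma>)"
      using i2 by (rule Bochner_Integration.integral_add[symmetric])
    finally show ?case by (simp add: algebra_simps)
  qed
  have "\<exists>r. good x r" if xc: "x \<in> closure \<Omega>" for x
  proof -
    have sm: "\<exists>r>0. cball x (2 * r) \<subseteq> W" if W: "open W" "x \<in> W" for W
    proof -
      obtain e where "e > 0" "cball x e \<subseteq> W" using W open_contains_cball by meson
      then show ?thesis by (intro exI[of _ "e / 2"]) auto
    qed
    from xc consider "x \<in> \<Omega>" | "x \<in> frontier \<Omega>" using closure_cases by blast
    then show ?thesis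
    proof cases
      case 1
      then obtain r where "r > 0" "cball x (2 * r) \<subseteq> \<Omega> \<inter> V"
        using sm[of "\<Omega> \<inter> V"] open_domain V xc by auto
      then show ?thesis unfolding good_def by (intro exI[of _ r]) auto
    next
      case 2
      then obtain U k s g where U: "x \<in> U" "graph_chart \<Omega> U k s g" by (rule chart_at)
      then obtain r where "r > 0" "cball x (2 * r) \<subseteq> U \<inter> V"
        using sm[of "U \<inter> V"] graph_chart_open[OF U(2)] V xc U(1) by auto
      moreover have "\<exists>U k s g. graph_chart \<Omega> U k s g \<and> cball x (2 * r) \<subseteq> U" using U(2) calculation by blast
      ultimately show ?thesis unfolding good_def by (intro exI[of _ r]) simp
    qed
  qed
  then obtain rad where rad: "\<And>x. x \<in> closure \<Omega> \<Longrightarrow> good x (rad x)" by metis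
  obtain K where K: "K \<subseteq> closure \<Omega>" "finite K" "closure \<Omega> \<subseteq> (\<Union>x\<in>K. ball x (rad x))"
  proof (rule compactE_image[OF compact_closure, of "closure \<Omega>" "\<lambda>x. ball x (rad x)"])
    show "closure \<Omega> \<subseteq> (\<Union>x\<in>closure \<Omega>. ball x (rad x))"
      using rad by (force simp: good_def)
  qed auto
  show ?thesis
    by (rule main[of "(\<lambda>x. (x, rad x)) ` K"]) (use K rad F in auto)
qed

end

section \<open>Symmetry of second derivatives\<close>

lemma C1_grad_line_within:
  fixes F :: "'a::real_inner \<Rightarrow> real"
  assumes "C1_grad V F F'" "x + t *\<^sub>R a \<in> V"
  shows "((\<lambda>t. F (x + t *\<^sub>R a)) has_real_derivative F' (x + t *\<^sub>R a) \<bullet> a) (at t)"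
proof -
  have "((\<lambda>t. F (x + t *\<^sub>R a)) has_derivative (\<lambda>h. F' (x + t *\<^sub>R a) \<bullet> (h *\<^sub>R a))) (at t)"
    by (rule has_derivative_compose[where f="\<lambda>t. x + t *\<^sub>R a" and g=F, OF _ C1_grad_has_derivative[OF assms]])
       (auto intro!: derivative_eq_intros)
  moreover have "(\<lambda>h. F' (x + t *\<^sub>R a) \<bullet> (h *\<^sub>R a)) = (*) (F' (x + t *\<^sub>R a) \<bullet> a)"
    by auto
  ultimately show ?thesis by (simp add: has_field_derivative_def)
qed

text \<open>The mean value theorem, applied first in direction \<open>i\<close> and then in
  direction \<open>j\<close>.\<close>

lemma second_difference:
  fixes f :: "real^'n::finite \<Rightarrow> real"
  assumes V: "cball x (2 * s) \<subseteq> V" and f: "C1_grad V f f'" and f': "C1_grad V (\<lambda>x. f' x $ i) f''" and s: "s > 0"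
  shows "\<exists>p\<in>cball x (2 * s). f (x + s *\<^sub>R axis i 1 + s *\<^sub>R axis j 1) - f (x + s *\<^sub>R axis i 1) -
    f (x + s *\<^sub>R axis j 1) + f x = s * s * f'' p $ j"
proof -
  have near: "x + a *\<^sub>R axis i 1 + b *\<^sub>R axis j 1 \<in> cball x (2 * s)" if "0 \<le> a" "a \<le> s" "0 \<le> b" "b \<le> s" for a b
  proof -
    have "norm (a *\<^sub>R axis i 1 + b *\<^sub>R axis j 1 :: real^'n) \<le> a + b"
      using norm_triangle_ineq[of "a *\<^sub>R axis i 1 :: real^'n" "b *\<^sub>R axis j 1"] that by simp
    then have "dist (x + (a *\<^sub>R axis i 1 + b *\<^sub>R axis j 1)) x \<le> 2 * s" using that by (simp add: dist_norm)
    then show ?thesis by (simp add: dist_commute add.assoc)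
  qed
  let ?g = "\<lambda>\<tau>. f (x + s *\<^sub>R axis j 1 + \<tau> *\<^sub>R axis i 1) - f (x + \<tau> *\<^sub>R axis i 1)"
  have dg: "(?g has_real_derivative f' (x + s *\<^sub>R axis j 1 + \<tau> *\<^sub>R axis i 1) $ i - f' (x + \<tau> *\<^sub>R axis i 1) $ i) (at \<tau>)"
    if "0 \<le> \<tau>" "\<tau> \<le> s" for \<tau>
    using C1_grad_line_within[OF f, of "x + s *\<^sub>R axis j 1" \<tau> "axis i 1"] C1_grad_line_within[OF f, of x \<tau> "axis i 1"]
      near[of \<tau> s] near[of \<tau> 0] that s V
    by (auto simp: inner_axis algebra_simps intro!: DERIV_diff)
  obtain \<theta> where \<theta>: "0 < \<theta>" "\<theta> < s"
    "?g s - ?g 0 = (s - 0) * (f' (x + s *\<^sub>R axis j 1 + \<theta> *\<^sub>R axis i 1) $ i - f' (x + \<theta> *\<^sub>R axis i 1) $ i)"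
    using MVT2[of 0 s ?g, OF s dg] by blast
  let ?y = "x + \<theta> *\<^sub>R axis i 1"
  have dk: "((\<lambda>\<tau>. f' (?y + \<tau> *\<^sub>R axis j 1) $ i) has_real_derivative f'' (?y + \<tau> *\<^sub>R axis j 1) $ j) (at \<tau>)"
    if "0 \<le> \<tau>" "\<tau> \<le> s" for \<tau>
    using C1_grad_line_within[OF f', of ?y \<tau> "axis j 1"] near[of \<theta> \<tau>] \<theta> that V by (auto simp: inner_axis)
  obtain \<eta> where \<eta>: "0 < \<eta>" "\<eta> < s"
    "f' (?y + s *\<^sub>R axis j 1) $ i - f' (?y + 0 *\<^sub>R axis j 1) $ i = (s - 0) * f'' (?y + \<eta> *\<^sub>R axis j 1) $ j"
    using MVT2[of 0 s "\<lambda>\<tau>. f' (?y + \<tau> *\<^sub>R axis j 1) $ i", OF s dk] by blast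
  show ?thesis
  proof
    show "?y + \<eta> *\<^sub>R axis j 1 \<in> cball x (2 * s)" using near \<theta> \<eta> by simp
    show "f (x + s *\<^sub>R axis i 1 + s *\<^sub>R axis j 1) - f (x + s *\<^sub>R axis i 1) - f (x + s *\<^sub>R axis j 1) + f x
        = s * s * f'' (?y + \<eta> *\<^sub>R axis j 1) $ j"
      using \<theta>(3) \<eta>(3) by (simp add: algebra_simps)
  qed
qed

text \<open>The second difference is unchanged when \<open>i\<close> and \<open>j\<close> are
  exchanged, so the two mixed derivatives agree at two points close to \<open>x\<close>; continuity
  carries this over to \<open>x\<close>.\<close>

lemma C1_grad_symmetric:
  fixes f :: "real^'n::finite \<Rightarrow> real"
  assumes V: "open V" and f: "C1_grad V f f'" and f': "\<And>i. C1_grad V (\<lambda>x. f' x $ i) (f'' i)" and x: "x \<in> V"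
  shows "f'' i x $ j = f'' j x $ i"
proof -
  have "\<bar>f'' i x $ j - f'' j x $ i\<bar> \<le> e" if e: "e > 0" for e
  proof -
    have cont: "\<exists>d>0. \<forall>p. dist p x < d \<longrightarrow> \<bar>f'' i p $ j - f'' i x $ j\<bar> < e / 2" for i j
    proof -
      have "continuous_on V (\<lambda>p. f'' i p $ j)" by (intro continuous_intros C1_grad_continuous_grad[OF f'])
      then have "isCont (\<lambda>p. f'' i p $ j) x" using V x by (simp add: continuous_on_eq_continuous_at)
      then have "\<forall>\<epsilon>>0. \<exists>d>0. \<forall>p. dist p x < d \<longrightarrow> dist (f'' i p $ j) (f'' i x $ j) < \<epsilon>"
        unfolding continuous_at_eps_delta .
      from this[rule_format, of "e / 2"] e show ?thesis by (simp add: dist_real_def)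
    qed
    obtain d1 where d1: "d1 > 0" "\<And>p. dist p x < d1 \<Longrightarrow> \<bar>f'' i p $ j - f'' i x $ j\<bar> < e / 2" using cont by blast
    obtain d2 where d2: "d2 > 0" "\<And>p. dist p x < d2 \<Longrightarrow> \<bar>f'' j p $ i - f'' j x $ i\<bar> < e / 2" using cont by blast
    obtain r where r: "r > 0" "cball x r \<subseteq> V" using V x open_contains_cball by blast
    define s where "s = min r (min d1 d2) / 4"
    have s: "s > 0" "2 * s \<le> r" "2 * s < d1" "2 * s < d2" using d1 d2 r by (auto simp: s_def)
    have sub: "cball x (2 * s) \<subseteq> V" using r s by auto
    obtain p where p: "p \<in> cball x (2 * s)" "f (x + s *\<^sub>R axis i 1 + s *\<^sub>R axis j 1) - f (x + s *\<^sub>R axis i 1) -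
        f (x + s *\<^sub>R axis j 1) + f x = s * s * f'' i p $ j"
      using second_difference[OF sub f f' s(1)] by blast
    obtain p' where p': "p' \<in> cball x (2 * s)" "f (x + s *\<^sub>R axis j 1 + s *\<^sub>R axis i 1) - f (x + s *\<^sub>R axis j 1) -
        f (x + s *\<^sub>R axis i 1) + f x = s * s * f'' j p' $ i"
      using second_difference[OF sub f f' s(1)] by blast
    have "s * s * f'' i p $ j = s * s * f'' j p' $ i" using p(2) p'(2) by (simp add: algebra_simps)
    then have "f'' i p $ j = f'' j p' $ i" using s by simp
    moreover have "\<bar>f'' i p $ j - f'' i x $ j\<bar> < e / 2" using p(1) s by (intro d1(2)) (simp add: dist_commute)
    moreover have "\<bar>f'' j p' $ i - f'' j x $ i\<bar> < e / 2" using p'(1) s by (intro d2(2)) (simp add: dist_commute)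
    ultimately show ?thesis by linarith
  qed
  then have "\<bar>f'' i x $ j - f'' j x $ i\<bar> \<le> 0" by (rule field_le_epsilon) simp
  then show ?thesis by simp
qed

section \<open>Limiting Carleman weights\<close>

lemma grad_eqI:
  fixes F :: "real^'n::finite \<Rightarrow> real"
  assumes "GDERIV F x :> D"
  shows "grad F x = D"
proof -
  have "(F has_derivative (\<lambda>h. h \<bullet> D)) (at x)" using assms by (simp add: gderiv_def)
  then have "frechet_derivative F (at x) = (\<lambda>h. h \<bullet> D)" using frechet_derivative_at by metis
  then show ?thesis by (simp add: grad_def partial_def vec_eq_iff inner_axis inner_commute[of "axis _ _"])
qed

text \<open>The Hessian matrix applied to \<open>\<xi>\<close>, written as a combination of the
  gradients of the partial derivatives. These gradients are what the product rule produces.\<close>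

definition hess :: "(real^'n::finite \<Rightarrow> real) \<Rightarrow> real^'n \<Rightarrow> real^'n \<Rightarrow> real^'n" where
  "hess f x \<xi> = (\<Sum>i\<in>UNIV. \<xi> $ i *\<^sub>R grad (partial i f) x)"

lemma linear_hess: "linear (hess f x)"
  by (rule linearI) (simp_all add: hess_def scaleR_add_left sum.distrib scaleR_sum_right)

lemma hess_symmetric:
  assumes "open V" "smooth_on V f" "x \<in> V"
  shows "\<xi> \<bullet> hess f x \<eta> = \<eta> \<bullet> hess f x \<xi>"
proof -
  have sym: "grad (partial i f) x $ j = grad (partial j f) x $ i" for i j
    by (rule C1_grad_symmetric[OF assms(1) smooth_on_C1_grad[OF assms(2)] smooth_on_C1_grad_component[OF assms(2)] assms(3)])
  have "\<xi> \<bullet> hess f x \<eta> = (\<Sum>i\<in>UNIV. \<Sum>j\<in>UNIV. \<xi> $ i * (\<eta> $ j * grad (partial j f) x $ i))"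
    by (simp add: hess_def inner_vec_def sum_distrib_left)
  also have "\<dots> = (\<Sum>i\<in>UNIV. \<Sum>j\<in>UNIV. \<eta> $ j * (\<xi> $ i * grad (partial i f) x $ j))"
    by (simp add: sym mult_ac)
  also have "\<dots> = (\<Sum>j\<in>UNIV. \<Sum>i\<in>UNIV. \<eta> $ j * (\<xi> $ i * grad (partial i f) x $ j))" by (rule sum.swap)
  also have "\<dots> = \<eta> \<bullet> hess f x \<xi>" by (simp add: hess_def inner_vec_def sum_distrib_left)
  finally show ?thesis .
qed

text \<open>The four gradients are 2 \<xi> and 2 \<nabla>\<phi> in the fibre variable, twice the
  Hessian applied to \<xi> for \<open>symbol_b\<close>, and minus twice the Hessian applied to
  \<nabla>\<phi> for \<open>symbol_a\<close>. The weight condition thus becomes a condition on the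
  Hessian alone.\<close>

lemma poisson_bracket_symbols:
  fixes \<phi> :: "real^'n::finite \<Rightarrow> real"
  assumes sm: "smooth_on V \<phi>" and x: "x \<in> V"
  shows "poisson_bracket (symbol_a \<phi>) (symbol_b \<phi>) x \<xi> =
    4 * (\<xi> \<bullet> hess \<phi> x \<xi> + grad \<phi> x \<bullet> hess \<phi> x (grad \<phi> x))"
proof -
  note gi = C1_grad_GDERIV[OF smooth_on_C1_grad_component[OF sm] x]
  have 1: "grad (\<lambda>\<eta>. symbol_a \<phi> x \<eta>) \<xi> = 2 *\<^sub>R \<xi>"
    by (rule grad_eqI) (auto simp: symbol_a_def gderiv_def inner_commute intro!: derivative_eq_intros)
  have 2: "grad (\<lambda>\<eta>. symbol_b \<phi> x \<eta>) \<xi> = 2 *\<^sub>R grad \<phi> x"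
    by (rule grad_eqI) (auto simp: symbol_b_def gderiv_def inner_commute intro!: derivative_eq_intros)
  have hd: "((\<lambda>y. grad \<phi> y $ i) has_derivative (\<lambda>h. h \<bullet> grad (partial i \<phi>) x)) (at x)" for i
    using gi[of i] by (simp add: gderiv_def)
  have 3: "grad (\<lambda>y. symbol_b \<phi> y \<xi>) x = 2 *\<^sub>R hess \<phi> x \<xi>"
  proof (rule grad_eqI)
    show "GDERIV (\<lambda>y. symbol_b \<phi> y \<xi>) x :> 2 *\<^sub>R hess \<phi> x \<xi>"
      unfolding gderiv_def symbol_b_def inner_vec_def inner_real_def
      by (rule has_derivative_eq_rhs, (rule derivative_eq_intros hd refl)+)
         (auto simp: hess_def inner_vec_def sum_distrib_left sum_distrib_right mult_ac intro!: ext sum.swap)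
  qed
  have 4: "grad (\<lambda>y. symbol_a \<phi> y \<xi>) x = - 2 *\<^sub>R hess \<phi> x (grad \<phi> x)"
  proof (rule grad_eqI)
    have "((\<lambda>y. \<xi> \<bullet> \<xi> - (\<Sum>i\<in>UNIV. grad \<phi> y $ i * grad \<phi> y $ i)) has_derivative
       (\<lambda>h. 0 - (\<Sum>i\<in>UNIV. grad \<phi> x $ i * (h \<bullet> grad (partial i \<phi>) x) + (h \<bullet> grad (partial i \<phi>) x) * grad \<phi> x $ i))) (at x)"
      by (intro derivative_intros hd)
    moreover have "h \<bullet> (- 2 *\<^sub>R hess \<phi> x (grad \<phi> x)) = 
       0 - (\<Sum>i\<in>UNIV. grad \<phi> x $ i * (h \<bullet> grad (partial i \<phi>) x) + (h \<bullet> grad (partial i \<phi>) x) * grad \<phi> x $ i)" for h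
      by (simp add: hess_def inner_sum_right sum_negf[symmetric] sum_distrib_left mult_ac)
    ultimately show "GDERIV (\<lambda>y. symbol_a \<phi> y \<xi>) x :> - 2 *\<^sub>R hess \<phi> x (grad \<phi> x)"
      by (simp add: gderiv_def symbol_a_def inner_vec_def[of "grad \<phi> _"])
  qed
  show ?thesis unfolding poisson_bracket_def 1 2 3 4 by (simp add: inner_commute)
qed

text \<open>The bracket vanishes on the characteristic set, so it lies in the ideal of \<open>a\<close> and \<open>b\<close>:
  \<open>\<phi>''(\<xi>,\<xi>) + \<phi>''(\<phi>',\<phi>')\<close> is \<open>m a + (l \<cdot> \<xi>) b\<close> with the explicit \<open>m\<close> and \<open>l\<close> below.\<close>

lemma quadratic_form_characteristic:
  fixes H :: "'a::real_inner \<Rightarrow> 'a"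
  assumes lin: "linear H" and sym: "\<And>\<xi> \<eta>. \<xi> \<bullet> H \<eta> = \<eta> \<bullet> H \<xi>" and p: "p \<noteq> 0"
    and char: "\<And>\<xi>. \<xi> \<bullet> \<xi> = p \<bullet> p \<Longrightarrow> p \<bullet> \<xi> = 0 \<Longrightarrow> \<xi> \<bullet> H \<xi> + p \<bullet> H p = 0"
  shows "\<xi> \<bullet> H \<xi> = - (p \<bullet> H p) / (p \<bullet> p) * (\<xi> \<bullet> \<xi>) + 2 * (p \<bullet> \<xi>) * (\<xi> \<bullet> H p) / (p \<bullet> p)"
proof -
  define N where "N = p \<bullet> p"
  define k where "k = p \<bullet> H p"
  have N: "N > 0" using p by (simp add: N_def)
  \<comment> \<open>The characteristic set consists of the vectors orthogonal to \<open>p\<close> of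
    the same length as \<open>p\<close>. Scaling a nonzero orthogonal vector to that length and
    using homogeneity removes the length condition.\<close>
  have perp: "\<eta> \<bullet> H \<eta> = - k / N * (\<eta> \<bullet> \<eta>)" if "p \<bullet> \<eta> = 0" for \<eta>
  proof (cases "\<eta> = 0")
    case True
    then show ?thesis by (simp add: linear_0[OF lin])
  next
    case False
    define c where "c = sqrt (N / (\<eta> \<bullet> \<eta>))"
    have c2: "c * c = N / (\<eta> \<bullet> \<eta>)" using N by (simp add: c_def)
    have "(c *\<^sub>R \<eta>) \<bullet> (c *\<^sub>R \<eta>) = (c * c) * (\<eta> \<bullet> \<eta>)" by simp
    also have "\<dots> = p \<bullet> p" using False by (simp add: c2 N_def)
    finally have "(c *\<^sub>R \<eta>) \<bullet> H (c *\<^sub>R \<eta>) + k = 0" using char[of "c *\<^sub>R \<eta>"] that by (simp add: k_def)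
    then have "(c * c) * (\<eta> \<bullet> H \<eta>) + k = 0" by (simp add: linear_cmul[OF lin] mult.assoc)
    then have "N * (\<eta> \<bullet> H \<eta>) = - k * (\<eta> \<bullet> \<eta>)" using False by (simp add: c2 field_simps)
    then show ?thesis using N by (simp add: field_simps)
  qed
  define t where "t = (p \<bullet> \<xi>) / N"
  \<comment> \<open>The component orthogonal to \<open>p\<close>. The mixed and parallel parts of
    the quadratic form all carry a factor p . \<xi>, which is the symbol b up to a constant.\<close>
  define \<eta> where "\<eta> = \<xi> - t *\<^sub>R p"
  have tN: "t * N = p \<bullet> \<xi>" using N by (simp add: t_def)
  have p\<eta>: "p \<bullet> \<eta> = 0" using tN by (simp add: \<eta>_def inner_diff_right N_def)
  have \<xi>: "\<xi> = \<eta> + t *\<^sub>R p" by (simp add: \<eta>_def)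
  have e1: "\<xi> \<bullet> H \<xi> = \<eta> \<bullet> H \<eta> + 2 * t * (\<eta> \<bullet> H p) + t * t * k"
    unfolding \<xi> using sym[of p \<eta>]
    by (simp add: linear_add[OF lin] linear_cmul[OF lin] inner_add_left inner_add_right k_def algebra_simps)
  have e2: "\<xi> \<bullet> \<xi> = \<eta> \<bullet> \<eta> + t * t * N"
    unfolding \<xi> using p\<eta> by (simp add: inner_add_left inner_add_right N_def inner_commute[of \<eta> p])
  have e3: "\<xi> \<bullet> H p = \<eta> \<bullet> H p + t * k" unfolding \<xi> by (simp add: inner_add_left k_def)
  have "\<eta> \<bullet> \<eta> = \<xi> \<bullet> \<xi> - t * t * N" using e2 by simp
  then have "\<xi> \<bullet> H \<xi> = - k / N * (\<xi> \<bullet> \<xi> - t * t * N) + 2 * t * (\<xi> \<bullet> H p - t * k) + t * t * k"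
    using e1 e3 perp[OF p\<eta>] by simp
  also have "\<dots> = - k / N * (\<xi> \<bullet> \<xi>) + 2 * t * (\<xi> \<bullet> H p)" using N by (simp add: field_simps)
  finally show ?thesis by (simp add: t_def k_def N_def)
qed

section \<open>The pointwise Carleman inequality\<close>

lemma absorb_square: "x * y \<ge> - (c * x\<^sup>2 + y\<^sup>2 / (4 * c))" if "c > 0" for x y c :: real
proof -
  have "0 \<le> (2 * c * x + y)\<^sup>2 / (4 * c)" using that by simp
  also have "\<dots> = c * x\<^sup>2 + y\<^sup>2 / (4 * c) + x * y" using that by (simp add: power2_eq_square field_simps)
  finally show ?thesis by simp
qed

text \<open>Here \<open>p = \<nabla>\<phi>\<close>, \<open>f = 1 + t \<phi>\<close>, so that \<open>f *\<^sub>R p\<close> is the gradient of the convexified weight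
  \<open>\<psi> = \<phi> + t \<phi>\<^sup>2 / 2\<close> with \<open>t = h / \<epsilon>\<close>; \<open>v = e\<^bsup>\<psi>/h\<^esup> u\<close> has gradient \<open>g\<close> and Laplacian \<open>lap\<close>, and
  \<open>S\<close>, \<open>T\<close> are the symmetric and antisymmetric parts of the conjugated operator applied to \<open>v\<close>.
  The long expression on the left is the divergence computed in \<open>green_conjugated\<close> below.\<close>

lemma pointwise_carleman:
  fixes p g L' M' W :: "real^'n::finite" and H :: "real^'n \<Rightarrow> real^'n"
  assumes lin: "linear H"
    and Q: "\<And>\<xi>. \<xi> \<bullet> H \<xi> = m * (\<xi> \<bullet> \<xi>) + 2 * (p \<bullet> \<xi>) * (\<xi> \<bullet> W)"
    and Hp: "p \<bullet> H p = - m * (p \<bullet> p)"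
    and S: "S = - (h\<^sup>2 * lap) - (f\<^sup>2 * (p \<bullet> p)) * v"
    and T: "T = 2 * h * (f * (p \<bullet> g)) + h * L * v"
    and h: "h > 0" and t: "t = h / \<epsilon>" "0 \<le> t" "t \<le> 1" and eps: "\<epsilon> > 0"
    and f: "1 / 2 \<le> f" "f \<le> 2"
    and N: "n0 > 0" "n0 \<le> p \<bullet> p" "p \<bullet> p \<le> P"
    and K: "K \<ge> 0" "\<bar>f * m\<bar> \<le> K" "norm W \<le> K" "norm (- 4 *\<^sub>R M' + 2 *\<^sub>R L' - (4 * L) *\<^sub>R W) \<le> K"
    and \<kappa>: "\<kappa> = n0\<^sup>2 / (8 * P)"
    and small: "\<epsilon> * (\<kappa>\<^sup>2 + 8 * K\<^sup>2 + K + 1) \<le> min (n0\<^sup>2 / 2) \<kappa>"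
  shows "- 4 * h^3 * (lap * (f * (p \<bullet> g)) + g \<bullet> (f *\<^sub>R H g + (t * (p \<bullet> g)) *\<^sub>R p))
    - 2 * h^3 * (L * v * lap + v * (L' \<bullet> g)) - 2 * h * (f\<^sup>2 * (p \<bullet> p)) * L * v\<^sup>2
    - 4 * h * v\<^sup>2 * ((f *\<^sub>R p) \<bullet> (f *\<^sub>R H (f *\<^sub>R p) + (t * (p \<bullet> (f *\<^sub>R p))) *\<^sub>R p))
    - 4 * h * (f\<^sup>2 * (p \<bullet> p)) * v * (f * (p \<bullet> g))
    + 4 * h^3 * (f * m * (g \<bullet> g) + f * m * v * lap + v * (M' \<bullet> g)) - \<kappa> * t * h^3 * (g \<bullet> g + v * lap)
    + h\<^sup>2 * (v\<^sup>2 + h\<^sup>2 * (g \<bullet> g)) \<le> (S + T)\<^sup>2"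
proof -
  define a where "a = p \<bullet> g"
  define b where "b = g \<bullet> W"
  define B where "B = g \<bullet> g"
  define N where "N = p \<bullet> p"
  define l where "l = L' \<bullet> g"
  define \<mu> where "\<mu> = M' \<bullet> g"
  define \<xi> where "\<xi> = h *\<^sub>R g"
  define G where "G = - 4 *\<^sub>R M' + 2 *\<^sub>R L' - (4 * L) *\<^sub>R W"
  have gHg: "g \<bullet> (f *\<^sub>R H g + (t * (p \<bullet> g)) *\<^sub>R p) = f * (m * B + 2 * a * b) + t * a\<^sup>2"
    by (simp add: inner_add_right Q a_def b_def B_def power2_eq_square inner_commute)
  have pHp: "(f *\<^sub>R p) \<bullet> (f *\<^sub>R H (f *\<^sub>R p) + (t * (p \<bullet> (f *\<^sub>R p))) *\<^sub>R p) = f^3 * (- m * N) + t * f\<^sup>2 * N\<^sup>2"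
    by (simp add: inner_add_right linear_cmul[OF lin] Hp N_def power2_eq_square power3_eq_cube algebra_simps)
  define E where "E = - 4 * h^3 * (lap * (f * a) + (f * (m * B + 2 * a * b) + t * a\<^sup>2))
    - 2 * h^3 * (L * v * lap + v * l) - 2 * h * (f\<^sup>2 * N) * L * v\<^sup>2
    - 4 * h * v\<^sup>2 * (f^3 * (- m * N) + t * f\<^sup>2 * N\<^sup>2)
    - 4 * h * (f\<^sup>2 * N) * v * (f * a)
    + 4 * h^3 * (f * m * B + f * m * v * lap + v * \<mu>) - \<kappa> * t * h^3 * (B + v * lap)"
  have G\<xi>: "G \<bullet> \<xi> = h * (- 4 * \<mu> + 2 * l - 4 * L * b)"
    by (simp add: G_def \<xi>_def inner_diff_left inner_add_left \<mu>_def l_def b_def inner_commute[of W])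
  have W\<xi>: "W \<bullet> \<xi> = h * b" by (simp add: \<xi>_def b_def inner_commute)
  have p\<xi>: "p \<bullet> \<xi> = h * a" by (simp add: \<xi>_def a_def)
  have \<xi>\<xi>: "(norm \<xi>)\<^sup>2 = h\<^sup>2 * B" unfolding power2_norm_eq_inner by (simp add: \<xi>_def B_def power2_eq_square)
  \<comment> \<open>An exact identity. Inside \<open>E\<close> the divergence of f m v g has
    replaced the \<open>m\<close> part of the bracket by a multiple of v S, and the divergence of v
    g does the same for the \<kappa> term. The \<open>W\<close> part of the bracket is a multiple of
    \<open>T\<close>, up to the zeroth order part of \<open>T\<close>, which joins the derivatives
    of the coefficients in \<open>G\<close>. The last two terms are the gain from
    convexification.\<close>
  have id: "2 * S * T = E + \<kappa> * t * h * ((norm \<xi>)\<^sup>2 - v * S - f\<^sup>2 * N * v\<^sup>2) + 4 * h * (f * m) * (v * S)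
     + h\<^sup>2 * v * (G \<bullet> \<xi>) + 4 * h * T * (W \<bullet> \<xi>) + 4 * h * t * (p \<bullet> \<xi>)\<^sup>2 + 4 * h * t * f\<^sup>2 * N\<^sup>2 * v\<^sup>2"
    unfolding E_def G\<xi> W\<xi> p\<xi> \<xi>\<xi> S T a_def[symmetric] N_def[symmetric]
    by (simp add: power2_eq_square power3_eq_cube algebra_simps)
  define r where "r = norm \<xi>"
  have r: "r \<ge> 0" by (simp add: r_def)
  have P: "P > 0" and N0: "n0 \<le> N" "N \<le> P" using N by (auto simp: N_def)
  have \<kappa>0: "\<kappa> \<ge> 0" using P by (simp add: \<kappa>)
  have th: "t * h = h\<^sup>2 / \<epsilon>" using t by (simp add: power2_eq_square)
  \<comment> \<open>The gain in \<open>v\<close>: since \<open>f\<close> is at least 1/2, the factor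
    4 f^2 is at least 1.\<close>
  have b1: "4 * h * t * f\<^sup>2 * N\<^sup>2 * v\<^sup>2 \<ge> t * h * n0\<^sup>2 * v\<^sup>2"
  proof -
    have "(1/2)\<^sup>2 \<le> f\<^sup>2" using f by (intro power_mono) auto
    moreover have "n0\<^sup>2 \<le> N\<^sup>2" using N N0 by (intro power_mono) auto
    ultimately have "(1/2)\<^sup>2 * n0\<^sup>2 \<le> f\<^sup>2 * N\<^sup>2" by (intro mult_mono) auto
    then have "(4 * h * t * v\<^sup>2) * ((1/2)\<^sup>2 * n0\<^sup>2) \<le> (4 * h * t * v\<^sup>2) * (f\<^sup>2 * N\<^sup>2)"
      using h t(2,3) by (intro mult_left_mono) auto
    then show ?thesis by (simp add: power2_eq_square mult_ac)
  qed
  \<comment> \<open>The price for regaining the whole gradient. With f^2 at most 4, the choice of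
    \<open>\<kappa>\<close> makes it at most half of the gain in \<open>b1\<close>.\<close>
  have b2: "\<kappa> * t * h * (f\<^sup>2 * N * v\<^sup>2) \<le> t * h * (n0\<^sup>2 / 2) * v\<^sup>2"
  proof -
    have "f\<^sup>2 \<le> 2\<^sup>2" using f by (intro power_mono) auto
    then have "f\<^sup>2 * N \<le> 4 * P" using N0 N by (intro mult_mono) auto
    then have "\<kappa> * (f\<^sup>2 * N) \<le> \<kappa> * (4 * P)" using \<kappa>0 by (intro mult_left_mono) auto
    also have "\<dots> = n0\<^sup>2 / 2" using P by (simp add: \<kappa>)
    finally have "(t * h * v\<^sup>2) * (\<kappa> * (f\<^sup>2 * N)) \<le> (t * h * v\<^sup>2) * (n0\<^sup>2 / 2)"
      using h t(2,3) by (intro mult_left_mono) auto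
    then show ?thesis by (simp add: mult_ac)
  qed
  \<comment> \<open>The budget for absorption: S^2 / 4 is spent here and S^2 / 2 in
    \<open>b4\<close>, which S^2 can afford, while \<open>b6\<close> spends all of T^2.\<close>
  have b3: "- (\<kappa> * t * h * (v * S)) \<ge> - (S\<^sup>2 / 4 + \<kappa>\<^sup>2 * h\<^sup>2 * v\<^sup>2)"
  proof -
    have "S * (- (\<kappa> * t * h * v)) \<ge> - (1 / 4 * S\<^sup>2 + (- (\<kappa> * t * h * v))\<^sup>2 / (4 * (1 / 4)))"
      by (rule absorb_square) simp
    moreover have "(- (\<kappa> * t * h * v))\<^sup>2 \<le> \<kappa>\<^sup>2 * h\<^sup>2 * v\<^sup>2"
    proof -
      have "t\<^sup>2 \<le> 1" using t(2,3) by (simp add: power_le_one)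
      then have "(\<kappa>\<^sup>2 * h\<^sup>2 * v\<^sup>2) * t\<^sup>2 \<le> (\<kappa>\<^sup>2 * h\<^sup>2 * v\<^sup>2) * 1" by (intro mult_left_mono) auto
      then show ?thesis by (simp add: power_mult_distrib mult_ac)
    qed
    ultimately show ?thesis by (simp add: mult_ac)
  qed
  have b4: "4 * h * (f * m) * (v * S) \<ge> - (S\<^sup>2 / 2 + 8 * K\<^sup>2 * h\<^sup>2 * v\<^sup>2)"
  proof -
    have "S * (4 * h * (f * m) * v) \<ge> - (1 / 2 * S\<^sup>2 + (4 * h * (f * m) * v)\<^sup>2 / (4 * (1 / 2)))"
      by (rule absorb_square) simp
    moreover have "(4 * h * (f * m) * v)\<^sup>2 \<le> 16 * K\<^sup>2 * h\<^sup>2 * v\<^sup>2"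
    proof -
      have "\<bar>f * m\<bar>\<^sup>2 \<le> K\<^sup>2" using K by (intro power_mono) auto
      then have "(16 * h\<^sup>2 * v\<^sup>2) * (f * m)\<^sup>2 \<le> (16 * h\<^sup>2 * v\<^sup>2) * K\<^sup>2" by (intro mult_left_mono) auto
      then show ?thesis by (simp add: power_mult_distrib mult_ac)
    qed
    ultimately show ?thesis by (simp add: mult_ac)
  qed
  have b5: "h\<^sup>2 * v * (G \<bullet> \<xi>) \<ge> - (K * h\<^sup>2 * (v\<^sup>2 + r\<^sup>2))"
  proof -
    have "\<bar>G \<bullet> \<xi>\<bar> \<le> K * r"
      unfolding r_def by (rule order_trans[OF Cauchy_Schwarz_ineq2 mult_right_mono]) (use K(4) in \<open>simp_all add: G_def\<close>)
    then have "\<bar>v * (G \<bullet> \<xi>)\<bar> \<le> \<bar>v\<bar> * (K * r)" by (simp add: abs_mult mult_left_mono)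
    also have "\<dots> = K * (\<bar>v\<bar> * r)" by simp
    also have "\<dots> \<le> K * (v\<^sup>2 + r\<^sup>2)"
    proof (rule mult_left_mono[OF _ K(1)])
      have "0 \<le> (\<bar>v\<bar> - r)\<^sup>2 + v\<^sup>2 + r\<^sup>2" by simp
      then show "\<bar>v\<bar> * r \<le> v\<^sup>2 + r\<^sup>2" by (simp add: power2_diff)
    qed
    finally have "- (K * (v\<^sup>2 + r\<^sup>2)) \<le> v * (G \<bullet> \<xi>)" by simp
    then have "h\<^sup>2 * - (K * (v\<^sup>2 + r\<^sup>2)) \<le> h\<^sup>2 * (v * (G \<bullet> \<xi>))" by (intro mult_left_mono) auto
    then show ?thesis by (simp add: mult_ac)
  qed
  have b6: "4 * h * T * (W \<bullet> \<xi>) \<ge> - (T\<^sup>2 + 4 * K\<^sup>2 * h\<^sup>2 * r\<^sup>2)"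
  proof -
    have "T * (4 * h * (W \<bullet> \<xi>)) \<ge> - (1 * T\<^sup>2 + (4 * h * (W \<bullet> \<xi>))\<^sup>2 / (4 * 1))"
      by (rule absorb_square) simp
    moreover have "\<bar>W \<bullet> \<xi>\<bar> \<le> K * r"
      unfolding r_def by (rule order_trans[OF Cauchy_Schwarz_ineq2 mult_right_mono]) (use K(3) in simp_all)
    then have "\<bar>W \<bullet> \<xi>\<bar>\<^sup>2 \<le> (K * r)\<^sup>2" by (intro power_mono) auto
    then have "(16 * h\<^sup>2) * (W \<bullet> \<xi>)\<^sup>2 \<le> (16 * h\<^sup>2) * (K * r)\<^sup>2" by (intro mult_left_mono) auto
    then have "(4 * h * (W \<bullet> \<xi>))\<^sup>2 \<le> 16 * (K\<^sup>2 * h\<^sup>2 * r\<^sup>2)" by (simp add: power_mult_distrib mult_ac)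
    ultimately show ?thesis by (simp add: mult_ac)
  qed
  have b7: "4 * h * t * (p \<bullet> \<xi>)\<^sup>2 \<ge> 0" using h t(2,3) by simp
  define c where "c = min (n0\<^sup>2 / 2) \<kappa>"
  define C where "C = \<kappa>\<^sup>2 + 8 * K\<^sup>2 + K"
  \<comment> \<open>What remains of the gain after \<open>b2\<close> has weight h^2 / \<epsilon>.
    Smallness of \<epsilon> makes it exceed all errors, collected in \<open>C\<close>, and leaves
    one further h^2 (v^2 + r^2) for the conclusion.\<close>
  have gain: "t * h * (n0\<^sup>2 / 2) * v\<^sup>2 + \<kappa> * t * h * r\<^sup>2 \<ge> h\<^sup>2 * (C + 1) * (v\<^sup>2 + r\<^sup>2)"
  proof -
    have "h\<^sup>2 * (C + 1) \<le> t * h * c"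
    proof -
      have "h\<^sup>2 * (C + 1) = (h\<^sup>2 / \<epsilon>) * (\<epsilon> * (C + 1))" using eps by simp
      also have "\<dots> \<le> (h\<^sup>2 / \<epsilon>) * c"
        using small eps by (intro mult_left_mono) (auto simp: c_def C_def)
      finally show ?thesis by (simp only: th)
    qed
    then have "h\<^sup>2 * (C + 1) * (v\<^sup>2 + r\<^sup>2) \<le> t * h * c * (v\<^sup>2 + r\<^sup>2)" by (intro mult_right_mono) auto
    also have "\<dots> = t * h * c * v\<^sup>2 + t * h * c * r\<^sup>2" by (simp add: algebra_simps)
    also have "\<dots> \<le> t * h * (n0\<^sup>2 / 2) * v\<^sup>2 + t * h * \<kappa> * r\<^sup>2"
      using h t(2,3) by (intro add_mono mult_right_mono mult_left_mono) (auto simp: c_def)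
    finally show ?thesis by (simp add: mult_ac)
  qed
  have C: "(\<kappa>\<^sup>2 * h\<^sup>2 * v\<^sup>2 + 8 * K\<^sup>2 * h\<^sup>2 * v\<^sup>2 + K * h\<^sup>2 * (v\<^sup>2 + r\<^sup>2) + 4 * K\<^sup>2 * h\<^sup>2 * r\<^sup>2) \<le> h\<^sup>2 * C * (v\<^sup>2 + r\<^sup>2)"
  proof -
    have "0 \<le> \<kappa>\<^sup>2 * h\<^sup>2 * r\<^sup>2" "0 \<le> K\<^sup>2 * h\<^sup>2 * r\<^sup>2" by simp_all
    then show ?thesis by (simp add: C_def algebra_simps)
  qed
  have "(S + T)\<^sup>2 = S\<^sup>2 + T\<^sup>2 + 2 * S * T" by (simp add: power2_sum)
  also have "\<dots> \<ge> E + h\<^sup>2 * (v\<^sup>2 + r\<^sup>2)"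
  proof -
    have "\<kappa> * t * h * ((norm \<xi>)\<^sup>2 - v * S - f\<^sup>2 * N * v\<^sup>2) =
      \<kappa> * t * h * r\<^sup>2 - \<kappa> * t * h * (v * S) - \<kappa> * t * h * (f\<^sup>2 * N * v\<^sup>2)"
      by (simp add: r_def algebra_simps)
    moreover have "h\<^sup>2 * (C + 1) * (v\<^sup>2 + r\<^sup>2) = h\<^sup>2 * C * (v\<^sup>2 + r\<^sup>2) + h\<^sup>2 * (v\<^sup>2 + r\<^sup>2)" by (simp add: algebra_simps)
    moreover have "t * h * n0\<^sup>2 * v\<^sup>2 = 2 * (t * h * (n0\<^sup>2 / 2) * v\<^sup>2)" by simp
    moreover have "S\<^sup>2 \<ge> 0" by simp
    ultimately show ?thesis using id b1 b2 b3 b4 b5 b6 b7 gain C by linarith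
  qed
  finally have "E + h\<^sup>2 * (v\<^sup>2 + h\<^sup>2 * B) \<le> (S + T)\<^sup>2" by (simp add: r_def \<xi>\<xi>)
  then show ?thesis
    unfolding gHg pHp by (simp add: E_def a_def b_def B_def N_def l_def \<mu>_def)
qed

section \<open>Green's formulas\<close>

context smooth_domain begin

text \<open>A density \<open>E\<close> whose integral is the boundary flux \<open>b\<close>.
  Integrability is included because the relation is closed under sums only with it.\<close>

definition green :: "(real^'n \<Rightarrow> real) \<Rightarrow> (real^'n \<Rightarrow> real) \<Rightarrow> bool" where
  "green E b \<longleftrightarrow> integrable lborel (\<lambda>x. indicator \<Omega> x * E x) \<and> integrable \<sigma> (\<lambda>x. indicator (frontier \<Omega>) x * b x) \<and>
    (\<integral>x. indicator \<Omega> x * E x \<partial>lborel) = (\<integral>x. indicator (frontier \<Omega>) x * b x \<partial>\<sigma>)"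

lemma green_cong:
  assumes "green E b" "\<And>x. x \<in> \<Omega> \<Longrightarrow> E x = E' x" "\<And>x. x \<in> frontier \<Omega> \<Longrightarrow> b x = b' x"
  shows "green E' b'"
proof -
  have "(\<lambda>x. indicator \<Omega> x * E x) = (\<lambda>x. indicator \<Omega> x * E' x)"
    "(\<lambda>x. indicator (frontier \<Omega>) x * b x) = (\<lambda>x. indicator (frontier \<Omega>) x * b' x)"
    using assms(2,3) by (auto simp: indicator_def)
  then show ?thesis using assms(1) by (simp only: green_def)
qed

lemma green_add:
  assumes "green E b" "green E' b'"
  shows "green (\<lambda>x. E x + E' x) (\<lambda>x. b x + b' x)"
  using assms unfolding green_def distrib_left by simp

lemma green_cmult:
  assumes "green E b"
  shows "green (\<lambda>x. c * E x) (\<lambda>x. c * b x)"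
proof -
  have "(\<lambda>x. indicator A x * (c * F x)) = (\<lambda>x. c * (indicator A x * F x))" for A and F :: "real^'n \<Rightarrow> real"
    by (simp add: fun_eq_iff)
  then show ?thesis using assms unfolding green_def by simp
qed

lemma green_sum:
  assumes "finite I" "\<And>i. i \<in> I \<Longrightarrow> green (E i) (b i)"
  shows "green (\<lambda>x. \<Sum>i\<in>I. E i x) (\<lambda>x. \<Sum>i\<in>I. b i x)"
  using assms by (induction I rule: finite_induct) (auto simp: green_def[of "\<lambda>x. 0"] intro: green_add)

lemma green_scalar_field:
  fixes w :: "real^'n \<Rightarrow> real^'n"
  assumes V: "open V" "closure \<Omega> \<subseteq> V" and f: "C1_grad V f f'" and w: "\<And>j. C1_grad V (\<lambda>x. w x $ j) (w' j)"
  shows "green (\<lambda>x. f x * (\<Sum>j\<in>UNIV. w' j x $ j) + f' x \<bullet> w x) (\<lambda>x. f x * (w x \<bullet> outer_normal \<Omega> x))"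
proof -
  have cw: "continuous_on V (\<lambda>x. w x $ j)" for j by (rule C1_grad_continuous[OF w])
  have fr: "frontier \<Omega> \<subseteq> V" using V(2) frontier_subset_closure by blast
  have "green (\<lambda>x. f x * w' j x $ j + f' x $ j * w x $ j) (\<lambda>x. f x * (w x $ j * outer_normal \<Omega> x $ j))" for j
    unfolding green_def
  proof (intro conjI)
    show "integrable lborel (\<lambda>x. indicator \<Omega> x * (f x * w' j x $ j + f' x $ j * w x $ j))"
      by (rule integrable_domain[OF continuous_on_subset[OF _ V(2)]])
         (intro continuous_intros C1_grad_continuous[OF f] C1_grad_continuous_grad[OF w] C1_grad_continuous_grad[OF f] cw)
    show "integrable \<sigma> (\<lambda>x. indicator (frontier \<Omega>) x * (f x * (w x $ j * outer_normal \<Omega> x $ j)))"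
      by (intro integrable_frontier continuous_intros continuous_outer_normal continuous_on_subset[OF C1_grad_continuous[OF f] fr]
          continuous_on_subset[OF cw fr])
    show "(\<integral>x. indicator \<Omega> x * (f x * w' j x $ j + f' x $ j * w x $ j) \<partial>lborel) =
        (\<integral>x. indicator (frontier \<Omega>) x * (f x * (w x $ j * outer_normal \<Omega> x $ j)) \<partial>\<sigma>)"
      using divergence_theorem[OF V C1_grad_mult[OF f w], of j j] by (simp add: mult_ac)
  qed
  then have "green (\<lambda>x. \<Sum>j\<in>UNIV. f x * w' j x $ j + f' x $ j * w x $ j)
     (\<lambda>x. \<Sum>j\<in>UNIV. f x * (w x $ j * outer_normal \<Omega> x $ j))"
    by (intro green_sum) auto
  then show ?thesis
    by (rule green_cong) (simp_all add: sum.distrib sum_distrib_left inner_vec_def)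
qed

text \<open>\<open>u\<close> vanishes along curves in the boundary, so all tangential derivatives
  are zero. Hence the whole gradient at the boundary is determined by the normal derivative.\<close>

lemma gradient_normal_on_frontier:
  assumes V: "open V" "closure \<Omega> \<subseteq> V" and u: "C1_grad V u u'" and zero: "\<And>x. x \<in> frontier \<Omega> \<Longrightarrow> u x = 0"
    and x: "x \<in> frontier \<Omega>"
  shows "u' x = (u' x \<bullet> outer_normal \<Omega> x) *\<^sub>R outer_normal \<Omega> x"
proof -
  obtain U k s g where U: "x \<in> U" and c: "graph_chart \<Omega> U k s g" using x by (rule chart_at)
  note nu = outer_normal_eq[OF c open_domain x U]
  have xV: "x \<in> V" using x V frontier_subset_closure by blast
  have xk: "x $ k = g x" using graph_chart_frontier[OF c open_domain U] x by blast
  have tang: "u' x $ j + grad g x $ j * u' x $ k = 0" if "j \<noteq> k" for j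
  proof -
    \<comment> \<open>A curve in the graph through \<open>x\<close>: a step in direction
      \<open>j\<close>, corrected in the coordinate \<open>k\<close>.\<close>
    define y where "y t = x + (t *\<^sub>R axis j 1 + (g (x + t *\<^sub>R axis j 1) - g x) *\<^sub>R axis k 1)" for t
    have gl: "((\<lambda>t. g (x + t *\<^sub>R axis j 1)) has_derivative (\<lambda>h. h * grad g x $ j)) (at 0)"
      using C1_grad_line[OF graph_chart_C1[OF c], of x j 0]
      by (simp add: has_field_derivative_def mult_commute_abs)
    have y': "(y has_derivative (\<lambda>h. h *\<^sub>R axis j 1 + (h * grad g x $ j) *\<^sub>R axis k 1)) (at 0)"
      unfolding y_def by (auto intro!: derivative_eq_intros gl)
    have y0: "y 0 = x" by (simp add: y_def)
    have "((\<lambda>t. u (y t)) has_derivative (\<lambda>h. u' (y 0) \<bullet> (h *\<^sub>R axis j 1 + (h * grad g x $ j) *\<^sub>R axis k 1))) (at 0)"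
      by (rule has_derivative_compose[OF y' C1_grad_has_derivative[OF u]]) (simp add: y0 xV)
    moreover have "((\<lambda>t. u (y t)) has_derivative (\<lambda>h. 0)) (at 0)"
    proof (rule has_derivative_transform_eventually[where f="\<lambda>_. 0"])
      have "(y \<longlongrightarrow> y 0) (at 0)" using has_derivative_continuous[OF y'] by (simp add: continuous_within)
      then have "\<forall>\<^sub>F t in at 0. y t \<in> U"
        using graph_chart_open[OF c] U by (intro topological_tendstoD) (auto simp: y0)
      then show "\<forall>\<^sub>F t in at 0. 0 = u (y t)"
      proof eventually_elim
        case (elim t)
        have "g (y t) = g (x + t *\<^sub>R axis j 1)"
          using graph_chart_invariant[OF c, of "x + t *\<^sub>R axis j 1" "g (x + t *\<^sub>R axis j 1) - g x"]
          by (simp add: y_def add.assoc)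
        moreover have "y t $ k = g (x + t *\<^sub>R axis j 1)"
          using that by (simp add: y_def axis_cart_nth xk)
        ultimately show ?case
          using graph_chart_frontier[OF c open_domain elim] zero by simp
      qed
      show "0 = u (y 0)" using zero[OF x] by (simp add: y0)
    qed auto
    ultimately have "(\<lambda>h. u' (y 0) \<bullet> (h *\<^sub>R axis j 1 + (h * grad g x $ j) *\<^sub>R axis k 1)) = (\<lambda>h. 0)"
      by (rule has_derivative_unique)
    then have "u' (y 0) \<bullet> (1 *\<^sub>R axis j 1 + (1 * grad g x $ j) *\<^sub>R axis k 1) = 0" by (rule fun_cong)
    then show ?thesis by (simp add: y0 inner_add_right inner_axis)
  qed
  define r where "r = sqrt (1 + (norm (grad g x))\<^sup>2)"
  have r: "r > 0" unfolding r_def by (intro real_sqrt_gt_zero add_pos_nonneg) auto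
  have "u' x $ j = (- u' x $ k) * (grad g x - axis k 1) $ j" for j
    using tang[of j] graph_chart_grad(2)[OF c, of x] by (cases "j = k") (auto simp: axis_cart_nth eq_neg_iff_add_eq_0 mult.commute)
  then have "u' x = (- u' x $ k) *\<^sub>R (grad g x - axis k 1)"
    by (subst vec_eq_iff, subst vector_scaleR_component, subst real_scaleR_def) (rule allI)
  also have "\<dots> = (- u' x $ k * s * r) *\<^sub>R graph_normal k s g x"
    using r graph_chart_sign[OF c] by (auto simp: graph_normal_def r_def[symmetric])
  finally obtain a where a: "u' x = a *\<^sub>R outer_normal \<Omega> x" unfolding nu by blast
  moreover have "outer_normal \<Omega> x \<bullet> outer_normal \<Omega> x = 1"
    using norm_outer_normal[OF x] by (simp add: dot_square_norm)
  ultimately show ?thesis by simp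
qed

text \<open>The divergences of (q . g) g, |g|^2 q, L v g and |q|^2 v^2 q carry 2 S T over into the
  bracket of the weight; the fields M v g and v g are the multipliers that turn |g|^2 into - v lap.
  At the boundary \<open>v\<close> is zero and \<open>g\<close> is normal, so only the first two
  fields contribute, with coefficients -4 and +2 whose sum is the -2 of the conclusion.\<close>

lemma green_conjugated:
  fixes g q :: "real^'n \<Rightarrow> real^'n"
  assumes V: "open V" "closure \<Omega> \<subseteq> V"
    and v: "C1_grad V v g" and g: "\<And>i. C1_grad V (\<lambda>x. g x $ i) (g' i)"
    and q: "\<And>i. C1_grad V (\<lambda>x. q x $ i) (q' i)"
    and L: "\<And>x. L x = (\<Sum>i\<in>UNIV. q' i x $ i)" and L': "C1_grad V L L'"
    and M: "C1_grad V M M'"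
    and zero: "\<And>x. x \<in> frontier \<Omega> \<Longrightarrow> v x = 0"
    and lap: "\<And>x. lap x = (\<Sum>i\<in>UNIV. g' i x $ i)"
  shows "green
    (\<lambda>x. - 4 * h^3 * (lap x * (q x \<bullet> g x) + g x \<bullet> (\<Sum>i\<in>UNIV. g x $ i *\<^sub>R q' i x))
      - 2 * h^3 * (L x * v x * lap x + v x * (L' x \<bullet> g x)) - 2 * h * (q x \<bullet> q x) * L x * (v x)\<^sup>2
      - 4 * h * (v x)\<^sup>2 * (q x \<bullet> (\<Sum>i\<in>UNIV. q x $ i *\<^sub>R q' i x))
      - 4 * h * (q x \<bullet> q x) * v x * (q x \<bullet> g x)
      + 4 * h^3 * (M x * (g x \<bullet> g x) + M x * v x * lap x + v x * (M' x \<bullet> g x)) - \<kappa> * (g x \<bullet> g x + v x * lap x))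
    (\<lambda>x. - 2 * h^3 * ((q x \<bullet> outer_normal \<Omega> x) * (g x \<bullet> outer_normal \<Omega> x)\<^sup>2))"
proof -
  let ?\<nu> = "outer_normal \<Omega>"
  have ip: "C1_grad V (\<lambda>x. a x \<bullet> b x) (\<lambda>x. \<Sum>i\<in>UNIV. a x $ i *\<^sub>R b' i x + b x $ i *\<^sub>R a' i x)"
    if "\<And>i. C1_grad V (\<lambda>x. a x $ i) (a' i)" "\<And>i. C1_grad V (\<lambda>x. b x $ i) (b' i)"
    for a b :: "real^'n \<Rightarrow> real^'n" and a' b'
    unfolding inner_vec_def inner_real_def by (intro C1_grad_sum C1_grad_mult that)
  note A = ip[OF q g] and B = ip[OF g g] and P = ip[OF q q]
  note G1 = green_scalar_field[OF V A g]
  note G2 = green_scalar_field[OF V B q]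
  note G3 = green_scalar_field[OF V C1_grad_mult[OF L' v] g]
  note G4 = green_scalar_field[OF V C1_grad_mult[OF P C1_grad_mult[OF v v]] q]
  note G5 = green_scalar_field[OF V C1_grad_mult[OF M v] g]
  note G6 = green_scalar_field[OF V v g]
  note G = green_add[OF green_cmult[OF G1, of "- 4 * h^3"] green_add[OF green_cmult[OF G2, of "2 * h^3"]
     green_add[OF green_cmult[OF G3, of "- 2 * h^3"] green_add[OF green_cmult[OF G4, of "- 2 * h"]
     green_add[OF green_cmult[OF G5, of "4 * h^3"] green_cmult[OF G6, of "- \<kappa>"]]]]]]
  show ?thesis
  proof (rule green_cong[OF G])
    fix x assume "x \<in> \<Omega>"
    then have xV: "x \<in> V" using V closure_subset by blast
    have sym: "g' i x $ j = g' j x $ i" for i j by (rule C1_grad_symmetric[OF V(1) v g xV])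
    \<comment> \<open>The Hessian of \<open>v\<close> paired with \<open>q\<close> and
      \<open>g\<close>. By symmetry it occurs identically in \<open>G1\<close> and
      \<open>G2\<close>, where the coefficients -4 h^3 and 2 * 2 h^3 cancel; likewise
      \<open>G3\<close> cancels the term L |g|^2 of \<open>G2\<close>.\<close>
    define a where "a = (\<Sum>i\<in>UNIV. q x $ i * (g' i x \<bullet> g x))"
    have a2: "a = (\<Sum>i\<in>UNIV. g x $ i * (g' i x \<bullet> q x))"
    proof -
      have "a = (\<Sum>i\<in>UNIV. \<Sum>j\<in>UNIV. q x $ i * (g' i x $ j * g x $ j))" by (simp add: a_def inner_vec_def sum_distrib_left)
      also have "\<dots> = (\<Sum>j\<in>UNIV. \<Sum>i\<in>UNIV. q x $ i * (g' i x $ j * g x $ j))" by (rule sum.swap)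
      also have "\<dots> = (\<Sum>j\<in>UNIV. \<Sum>i\<in>UNIV. g x $ j * (g' j x $ i * q x $ i))" by (simp add: sym[of _ j for j] mult_ac)
      also have "\<dots> = (\<Sum>i\<in>UNIV. g x $ i * (g' i x \<bullet> q x))" by (simp add: inner_vec_def sum_distrib_left)
      finally show ?thesis .
    qed
    define b where "b = (\<Sum>i\<in>UNIV. g x $ i * (q' i x \<bullet> g x))"
    define c where "c = (\<Sum>i\<in>UNIV. q x $ i * (q' i x \<bullet> q x))"
    have 1: "(\<Sum>i\<in>UNIV. q x $ i *\<^sub>R g' i x + g x $ i *\<^sub>R q' i x) \<bullet> g x = a + b"
      by (simp add: inner_sum_left inner_add_left sum.distrib a_def b_def)
    have 2: "(\<Sum>i\<in>UNIV. g x $ i *\<^sub>R g' i x + g x $ i *\<^sub>R g' i x) \<bullet> q x = 2 * a"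
      unfolding a2 by (simp only: inner_sum_left inner_add_left inner_scaleR_left sum.distrib, simp?)
    have 3: "(\<Sum>i\<in>UNIV. q x $ i *\<^sub>R q' i x + q x $ i *\<^sub>R q' i x) \<bullet> q x = 2 * c"
      unfolding c_def by (simp only: inner_sum_left inner_add_left inner_scaleR_left sum.distrib, simp?)
    have 4: "g x \<bullet> (\<Sum>i\<in>UNIV. g x $ i *\<^sub>R q' i x) = b" by (simp add: inner_sum_right b_def inner_commute)
    have 5: "q x \<bullet> (\<Sum>i\<in>UNIV. q x $ i *\<^sub>R q' i x) = c" by (simp add: inner_sum_right c_def inner_commute)
    have 6: "(v x *\<^sub>R g x + v x *\<^sub>R g x) \<bullet> q x = 2 * (v x * (q x \<bullet> g x))"
      by (simp only: inner_add_left inner_scaleR_left inner_commute[of "g x" "q x"])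
    show "- 4 * h ^ 3 * (q x \<bullet> g x * (\<Sum>j\<in>UNIV. g' j x $ j) + (\<Sum>i\<in>UNIV. q x $ i *\<^sub>R g' i x + g x $ i *\<^sub>R q' i x) \<bullet> g x) +
      (2 * h ^ 3 * (g x \<bullet> g x * (\<Sum>j\<in>UNIV. q' j x $ j) + (\<Sum>i\<in>UNIV. g x $ i *\<^sub>R g' i x + g x $ i *\<^sub>R g' i x) \<bullet> q x) +
      (- 2 * h ^ 3 * (L x * v x * (\<Sum>j\<in>UNIV. g' j x $ j) + (L x *\<^sub>R g x + v x *\<^sub>R L' x) \<bullet> g x) +
      (- 2 * h * (q x \<bullet> q x * (v x * v x) * (\<Sum>j\<in>UNIV. q' j x $ j) +
        ((q x \<bullet> q x) *\<^sub>R (v x *\<^sub>R g x + v x *\<^sub>R g x) + (v x * v x) *\<^sub>R (\<Sum>i\<in>UNIV. q x $ i *\<^sub>R q' i x + q x $ i *\<^sub>R q' i x)) \<bullet> q x) +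
      (4 * h ^ 3 * (M x * v x * (\<Sum>j\<in>UNIV. g' j x $ j) + (M x *\<^sub>R g x + v x *\<^sub>R M' x) \<bullet> g x) +
       - \<kappa> * (v x * (\<Sum>j\<in>UNIV. g' j x $ j) + g x \<bullet> g x))))) =
      - 4 * h^3 * (lap x * (q x \<bullet> g x) + g x \<bullet> (\<Sum>i\<in>UNIV. g x $ i *\<^sub>R q' i x))
      - 2 * h^3 * (L x * v x * lap x + v x * (L' x \<bullet> g x)) - 2 * h * (q x \<bullet> q x) * L x * (v x)\<^sup>2
      - 4 * h * (v x)\<^sup>2 * (q x \<bullet> (\<Sum>i\<in>UNIV. q x $ i *\<^sub>R q' i x))
      - 4 * h * (q x \<bullet> q x) * v x * (q x \<bullet> g x)
      + 4 * h^3 * (M x * (g x \<bullet> g x) + M x * v x * lap x + v x * (M' x \<bullet> g x)) - \<kappa> * (g x \<bullet> g x + v x * lap x)"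
      unfolding inner_add_left[of "(q x \<bullet> q x) *\<^sub>R (v x *\<^sub>R g x + v x *\<^sub>R g x)"] inner_scaleR_left[of "v x * v x"]
        inner_scaleR_left[of "q x \<bullet> q x"] 1 2 3 4 5 6
      by (simp add: lap[symmetric] L[symmetric] inner_add_left inner_commute[of "g x" "q x"] power2_eq_square algebra_simps)
  next
    fix x assume x: "x \<in> frontier \<Omega>"
    define lm where "lm = g x \<bullet> ?\<nu> x"
    have gx: "g x = lm *\<^sub>R ?\<nu> x" unfolding lm_def by (rule gradient_normal_on_frontier[OF V v zero x])
    have n1: "?\<nu> x \<bullet> ?\<nu> x = 1" using norm_outer_normal[OF x] by (simp add: dot_square_norm)
    have gg: "g x \<bullet> g x = lm\<^sup>2" "q x \<bullet> g x = lm * (q x \<bullet> ?\<nu> x)" by (simp_all add: gx n1 power2_eq_square)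
    show "- 4 * h ^ 3 * (q x \<bullet> g x * (g x \<bullet> ?\<nu> x)) +
         (2 * h ^ 3 * (g x \<bullet> g x * (q x \<bullet> ?\<nu> x)) +
          (- 2 * h ^ 3 * (L x * v x * (g x \<bullet> ?\<nu> x)) +
           (- 2 * h * (q x \<bullet> q x * (v x * v x) * (q x \<bullet> ?\<nu> x)) +
            (4 * h ^ 3 * (M x * v x * (g x \<bullet> ?\<nu> x)) + - \<kappa> * (v x * (g x \<bullet> ?\<nu> x)))))) =
         - 2 * h ^ 3 * (q x \<bullet> ?\<nu> x * (g x \<bullet> ?\<nu> x)\<^sup>2)"
      by (simp add: gg zero[OF x] lm_def[symmetric] power2_eq_square algebra_simps)
  qed
qed

end

section \<open>The Carleman estimate for real functions\<close>

context smooth_domain begin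

text \<open>Integrates a pointwise inequality that holds modulo a divergence, trading the divergence
  for its flux.\<close>

lemma green_integral_le:
  assumes E: "green E b" and F: "continuous_on (closure \<Omega>) F" and R: "continuous_on (closure \<Omega>) R"
    and le: "\<And>x. x \<in> \<Omega> \<Longrightarrow> E x + F x \<le> R x"
  shows "(\<integral>x. indicator \<Omega> x * F x \<partial>lborel) + (\<integral>x. indicator (frontier \<Omega>) x * b x \<partial>\<sigma>) \<le> (\<integral>x. indicator \<Omega> x * R x \<partial>lborel)"
proof -
  have iE: "integrable lborel (\<lambda>x. indicator \<Omega> x * E x)"
    and eq: "(\<integral>x. indicator \<Omega> x * E x \<partial>lborel) = (\<integral>x. indicator (frontier \<Omega>) x * b x \<partial>\<sigma>)"
    using E by (simp_all add: green_def)
  note iF = integrable_domain[OF F] and iR = integrable_domain[OF R]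
  have "(\<integral>x. indicator \<Omega> x * F x + indicator \<Omega> x * E x \<partial>lborel) \<le> (\<integral>x. indicator \<Omega> x * R x \<partial>lborel)"
  proof (rule integral_mono)
    show "integrable lborel (\<lambda>x. indicator \<Omega> x * F x + indicator \<Omega> x * E x)"
      using iF iE by (rule Bochner_Integration.integrable_add)
    show "indicator \<Omega> x * F x + indicator \<Omega> x * E x \<le> indicator \<Omega> x * R x" for x
      using le[of x] by (cases "x \<in> \<Omega>") auto
  qed (rule iR)
  then show ?thesis using iE iF eq by simp
qed

text \<open>All bounds on the coefficients are hypotheses that do not involve \<open>h\<close> or
  \<open>u\<close>; so the constants can be fixed from the weight and the domain beforehand. The
  conclusion is for the convexified exponential \<open>w\<close>.\<close>

lemma conjugated_estimate:
  fixes \<phi> u :: "real^'n \<Rightarrow> real" and W :: "real^'n \<Rightarrow> real^'n"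
  assumes O: "open \<Omega>'" "closure \<Omega> \<subseteq> \<Omega>'" "smooth_on \<Omega>' \<phi>"
    and char: "\<And>x \<xi>. x \<in> \<Omega> \<Longrightarrow> \<xi> \<bullet> hess \<phi> x \<xi> = m x * (\<xi> \<bullet> \<xi>) + 2 * (grad \<phi> x \<bullet> \<xi>) * (\<xi> \<bullet> W x)"
      "\<And>x. x \<in> \<Omega> \<Longrightarrow> grad \<phi> x \<bullet> hess \<phi> x (grad \<phi> x) = - m x * (grad \<phi> x \<bullet> grad \<phi> x)"
    and m: "C1_grad \<Omega>' m m'" and D: "\<And>x. D x = (\<Sum>i\<in>UNIV. grad (partial i \<phi>) x $ i)" and D': "C1_grad \<Omega>' D D'"
    and n: "n0 > 0" "\<And>x. x \<in> \<Omega> \<Longrightarrow> n0 \<le> grad \<phi> x \<bullet> grad \<phi> x" "\<And>x. x \<in> \<Omega> \<Longrightarrow> grad \<phi> x \<bullet> grad \<phi> x \<le> P"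
    and t: "t = h / \<epsilon>" "0 \<le> t" "t \<le> 1" and h: "h > 0" and eps: "\<epsilon> > 0"
    and \<phi>: "\<And>x. x \<in> \<Omega> \<Longrightarrow> \<bar>t * \<phi> x\<bar> \<le> 1 / 2"
    and K: "K \<ge> 0" "\<And>x. x \<in> \<Omega> \<Longrightarrow> 2 * \<bar>m x\<bar> \<le> K" "\<And>x. x \<in> \<Omega> \<Longrightarrow> norm (W x) \<le> K"
      "\<And>x. x \<in> \<Omega> \<Longrightarrow> 4 * (2 * norm (m' x) + \<bar>m x\<bar> * norm (grad \<phi> x)) +
         2 * (2 * norm (D' x) + \<bar>D x\<bar> * norm (grad \<phi> x) + 2 * norm (hess \<phi> x (grad \<phi> x))) +
         4 * (2 * \<bar>D x\<bar> + grad \<phi> x \<bullet> grad \<phi> x) * norm (W x) \<le> K"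
    and small: "\<epsilon> * ((n0\<^sup>2 / (8 * P))\<^sup>2 + 8 * K\<^sup>2 + K + 1) \<le> min (n0\<^sup>2 / 2) (n0\<^sup>2 / (8 * P))"
    and V: "open V" "closure \<Omega> \<subseteq> V" and u: "C1_grad V u u'" "\<And>i. C1_grad V (\<lambda>x. u' x $ i) (u'' i)"
    and zero: "\<And>x. x \<in> frontier \<Omega> \<Longrightarrow> u x = 0"
    and f: "\<And>x. f x = 1 + t * \<phi> x" and w: "\<And>x. w x = exp ((\<phi> x + t / 2 * (\<phi> x * \<phi> x)) / h)"
  shows "(\<integral>x. indicator \<Omega> x * (h\<^sup>2 * ((w x * u x)\<^sup>2 + h\<^sup>2 * (norm (w x *\<^sub>R (u' x + (u x / h) *\<^sub>R (f x *\<^sub>R grad \<phi> x))))\<^sup>2)) \<partial>lborel)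
    + (\<integral>x. indicator (frontier \<Omega>) x * (- 2 * h^3 * (f x * (grad \<phi> x \<bullet> outer_normal \<Omega> x) * (w x * (u' x \<bullet> outer_normal \<Omega> x))\<^sup>2)) \<partial>\<sigma>)
    \<le> (\<integral>x. indicator \<Omega> x * (w x * (h\<^sup>2 * (\<Sum>i\<in>UNIV. u'' i x $ i)))\<^sup>2 \<partial>lborel)"
proof -
  define V' where "V' = V \<inter> \<Omega>'"
  have V': "open V'" "closure \<Omega> \<subseteq> V'" using V O by (auto simp: V'_def)
  define p where "p = grad \<phi>"
  define N where "N x = p x \<bullet> p x" for x
  have sub: "V' \<subseteq> V" "V' \<subseteq> \<Omega>'" by (auto simp: V'_def)
  have \<phi>1: "C1_grad V' \<phi> p" unfolding p_def by (rule C1_grad_subset[OF smooth_on_C1_grad[OF O(3)] sub(2)])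
  have p1: "C1_grad V' (\<lambda>x. p x $ i) (grad (partial i \<phi>))" for i
    unfolding p_def by (rule C1_grad_subset[OF smooth_on_C1_grad_component[OF O(3)] sub(2)])
  note u1 = C1_grad_subset[OF u(1) sub(1)] and u2 = C1_grad_subset[OF u(2) sub(1)]
  note m1 = C1_grad_subset[OF m sub(2)] and D1 = C1_grad_subset[OF D' sub(2)]
  have N1: "C1_grad V' N (\<lambda>x. 2 *\<^sub>R hess \<phi> x (p x))"
  proof (rule C1_grad_cong)
    show "C1_grad V' N (\<lambda>x. \<Sum>i\<in>UNIV. p x $ i *\<^sub>R grad (partial i \<phi>) x + p x $ i *\<^sub>R grad (partial i \<phi>) x)"
      unfolding N_def inner_vec_def inner_real_def by (intro C1_grad_sum C1_grad_mult p1)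
    show "(\<Sum>i\<in>UNIV. p x $ i *\<^sub>R grad (partial i \<phi>) x + p x $ i *\<^sub>R grad (partial i \<phi>) x) = 2 *\<^sub>R hess \<phi> x (p x)" for x
      by (simp only: hess_def scaleR_sum_right scaleR_2)
  qed
  have f1: "C1_grad V' f (\<lambda>x. t *\<^sub>R p x)"
  proof (rule C1_grad_cong)
    show "C1_grad V' f (\<lambda>x. 0 + (t *\<^sub>R p x + \<phi> x *\<^sub>R 0))"
      unfolding f[abs_def] by (intro C1_grad_add C1_grad_const C1_grad_mult \<phi>1)
  qed simp
  \<comment> \<open>The gradient of the convexified weight; \<open>q'\<close> and \<open>L\<close>
    are the gradients of its components and its Laplacian.\<close>
  define q where "q x = f x *\<^sub>R p x" for x
  define q' where "q' i x = f x *\<^sub>R grad (partial i \<phi>) x + p x $ i *\<^sub>R (t *\<^sub>R p x)" for i x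
  have q1: "C1_grad V' (\<lambda>x. q x $ i) (q' i)" for i
    unfolding q_def q'_def vector_scaleR_component real_scaleR_def by (intro C1_grad_mult f1 p1)
  define L where "L x = f x * D x + t * N x" for x
  define L' where "L' x = f x *\<^sub>R D' x + D x *\<^sub>R (t *\<^sub>R p x) + t *\<^sub>R (2 *\<^sub>R hess \<phi> x (p x))" for x
  have L1: "C1_grad V' L L'"
  proof (rule C1_grad_cong)
    show "C1_grad V' L (\<lambda>x. (f x *\<^sub>R D' x + D x *\<^sub>R (t *\<^sub>R p x)) + (t *\<^sub>R (2 *\<^sub>R hess \<phi> x (p x)) + N x *\<^sub>R 0))"
      unfolding L_def by (intro C1_grad_add C1_grad_mult f1 D1 N1 C1_grad_const)
  qed (simp add: L'_def)
  have Lq: "L x = (\<Sum>i\<in>UNIV. q' i x $ i)" for x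
    by (simp add: L_def q'_def D N_def sum.distrib sum_distrib_left inner_vec_def mult_ac)
  define M where "M x = f x * m x" for x
  define M' where "M' x = f x *\<^sub>R m' x + m x *\<^sub>R (t *\<^sub>R p x)" for x
  have M1: "C1_grad V' M M'" unfolding M_def M'_def by (intro C1_grad_mult f1 m1)
  \<comment> \<open>The exponent of \<open>w\<close>, so that its gradient is \<open>q\<close>
    divided by \<open>h\<close>.\<close>
  define \<theta> where "\<theta> x = (1 / h) * (\<phi> x + t / 2 * (\<phi> x * \<phi> x))" for x
  have w\<theta>: "w x = exp (\<theta> x)" for x by (simp add: w \<theta>_def)
  have \<theta>1: "C1_grad V' \<theta> (\<lambda>x. (1 / h) *\<^sub>R q x)"
  proof (rule C1_grad_cong)
    show "C1_grad V' \<theta> (\<lambda>x. (1 / h) *\<^sub>R (p x + ((t / 2) *\<^sub>R (\<phi> x *\<^sub>R p x + \<phi> x *\<^sub>R p x) + (\<phi> x * \<phi> x) *\<^sub>R 0)) + (\<phi> x + t / 2 * (\<phi> x * \<phi> x)) *\<^sub>R 0)"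
      unfolding \<theta>_def by (intro C1_grad_add C1_grad_const C1_grad_mult \<phi>1)
    have half: "(t / 2) *\<^sub>R (\<phi> x *\<^sub>R p x + \<phi> x *\<^sub>R p x) = (t * \<phi> x) *\<^sub>R p x" for x
      by (simp only: scaleR_add_left[symmetric] scaleR_scaleR) simp
    show "(1 / h) *\<^sub>R (p x + ((t / 2) *\<^sub>R (\<phi> x *\<^sub>R p x + \<phi> x *\<^sub>R p x) + (\<phi> x * \<phi> x) *\<^sub>R 0)) + (\<phi> x + t / 2 * (\<phi> x * \<phi> x)) *\<^sub>R 0
        = (1 / h) *\<^sub>R q x" for x
      unfolding half by (simp add: q_def f scaleR_add_left)
  qed
  have w1: "C1_grad V' w (\<lambda>x. w x *\<^sub>R ((1 / h) *\<^sub>R q x))"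
    unfolding w\<theta>[abs_def] by (rule C1_grad_exp[OF \<theta>1])
  define v where "v x = w x * u x" for x
  define g where "g x = w x *\<^sub>R (u' x + (u x / h) *\<^sub>R q x)" for x
  have v1: "C1_grad V' v g"
  proof (rule C1_grad_cong)
    show "C1_grad V' v (\<lambda>x. w x *\<^sub>R u' x + u x *\<^sub>R (w x *\<^sub>R ((1 / h) *\<^sub>R q x)))"
      unfolding v_def by (intro C1_grad_mult w1 u1)
  qed (simp add: g_def scaleR_add_right mult.commute)
  define g' where "g' i x = w x *\<^sub>R (u'' i x + (1 / h) *\<^sub>R (u x *\<^sub>R q' i x + q x $ i *\<^sub>R u' x)) +
     (u' x $ i + (1 / h) * (u x * q x $ i)) *\<^sub>R (w x *\<^sub>R ((1 / h) *\<^sub>R q x))" for i x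
  have g1: "C1_grad V' (\<lambda>x. g x $ i) (g' i)" for i
  proof (rule C1_grad_cong)
    have eq: "(\<lambda>x. g x $ i) = (\<lambda>x. w x * (u' x $ i + (1 / h) * (u x * q x $ i)))" by (simp add: g_def fun_eq_iff)
    show "C1_grad V' (\<lambda>x. g x $ i) (\<lambda>x. w x *\<^sub>R (u'' i x + ((1 / h) *\<^sub>R (u x *\<^sub>R q' i x + q x $ i *\<^sub>R u' x) + (u x * q x $ i) *\<^sub>R 0)) +
     (u' x $ i + (1 / h) * (u x * q x $ i)) *\<^sub>R (w x *\<^sub>R ((1 / h) *\<^sub>R q x)))"
      unfolding eq by (intro C1_grad_mult C1_grad_add C1_grad_const w1 u2 u1 q1)
  qed (simp add: g'_def)
  define lap where "lap x = (\<Sum>i\<in>UNIV. g' i x $ i)" for x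
  define lapu where "lapu x = (\<Sum>i\<in>UNIV. u'' i x $ i)" for x
  have lap: "lap x = w x * (lapu x + (1 / h) * (u x * L x + q x \<bullet> u' x)) + (w x / h) * (q x \<bullet> u' x + (1 / h) * u x * (q x \<bullet> q x))" for x
  proof -
    have "lap x = (\<Sum>i\<in>UNIV. w x * u'' i x $ i + (w x / h) * u x * q' i x $ i + (w x / h) * (q x $ i * u' x $ i)
       + (w x / h) * (q x $ i * u' x $ i) + (w x / h) * ((1 / h) * u x) * (q x $ i * q x $ i))"
      unfolding lap_def by (intro sum.cong) (simp_all add: g'_def algebra_simps add_divide_distrib)
    also have "\<dots> = w x * lapu x + (w x / h) * u x * L x + (w x / h) * (q x \<bullet> u' x) + (w x / h) * (q x \<bullet> u' x)
      + (w x / h) * ((1 / h) * u x) * (q x \<bullet> q x)"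
      unfolding sum.distrib lapu_def Lq inner_vec_def inner_real_def by (simp only: sum_distrib_left)
    finally show ?thesis by (simp add: algebra_simps)
  qed
  have hq: "(\<Sum>i\<in>UNIV. \<xi> $ i *\<^sub>R q' i x) = f x *\<^sub>R hess \<phi> x \<xi> + (t * (p x \<bullet> \<xi>)) *\<^sub>R p x" for \<xi> x
  proof -
    have "(\<Sum>i\<in>UNIV. \<xi> $ i *\<^sub>R q' i x) = (\<Sum>i\<in>UNIV. f x *\<^sub>R (\<xi> $ i *\<^sub>R grad (partial i \<phi>) x) + (t * (p x $ i * \<xi> $ i)) *\<^sub>R p x)"
      by (intro sum.cong) (simp_all add: q'_def scaleR_add_right mult_ac)
    also have "\<dots> = f x *\<^sub>R hess \<phi> x \<xi> + (t * (p x \<bullet> \<xi>)) *\<^sub>R p x"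
      unfolding sum.distrib hess_def inner_vec_def inner_real_def
      by (simp only: scaleR_sum_right[symmetric] scaleR_sum_left[symmetric] sum_distrib_left)
    finally show ?thesis .
  qed
  define \<kappa> where "\<kappa> = n0\<^sup>2 / (8 * P)"
  have vzero: "v x = 0" if "x \<in> frontier \<Omega>" for x using zero[OF that] by (simp add: v_def)
  \<comment> \<open>The free coefficient of |g|^2 + v lap is set to the value that the pointwise
    inequality requires.\<close>
  note gr = green_conjugated[OF V' v1 g1 q1 Lq L1 M1 vzero lap_def, of h "\<kappa> * t * h^3"]
  have cont: "continuous_on (closure \<Omega>) F" if "continuous_on V' F" for F :: "real^'n \<Rightarrow> real"
    using that V'(2) by (rule continuous_on_subset)
  note cs = C1_grad_continuous[OF u1] C1_grad_continuous[OF w1] C1_grad_continuous[OF v1]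
    C1_grad_continuous[OF g1] C1_grad_continuous_grad[OF v1] C1_grad_continuous_grad[OF u2]
  have le: "(\<integral>x. indicator \<Omega> x * (h\<^sup>2 * ((v x)\<^sup>2 + h\<^sup>2 * (g x \<bullet> g x))) \<partial>lborel)
    + (\<integral>x. indicator (frontier \<Omega>) x * (- 2 * h^3 * ((q x \<bullet> outer_normal \<Omega> x) * (g x \<bullet> outer_normal \<Omega> x)\<^sup>2)) \<partial>\<sigma>)
    \<le> (\<integral>x. indicator \<Omega> x * (w x * (h\<^sup>2 * lapu x))\<^sup>2 \<partial>lborel)"
  proof (rule green_integral_le[OF gr])
    show "continuous_on (closure \<Omega>) (\<lambda>x. h\<^sup>2 * ((v x)\<^sup>2 + h\<^sup>2 * (g x \<bullet> g x)))"
      by (intro cont continuous_intros cs)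
    show "continuous_on (closure \<Omega>) (\<lambda>x. (w x * (h\<^sup>2 * lapu x))\<^sup>2)"
      unfolding lapu_def by (intro cont continuous_intros cs)
    fix x assume x: "x \<in> \<Omega>"
    have fx: "1 / 2 \<le> f x" "f x \<le> 2" using \<phi>[OF x] by (auto simp: f)
    have qg: "q x \<bullet> g x = f x * (p x \<bullet> g x)" and qq: "q x \<bullet> q x = (f x)\<^sup>2 * (p x \<bullet> p x)"
      by (simp_all add: q_def power2_eq_square)
    define S where "S = - (h\<^sup>2 * lap x) - ((f x)\<^sup>2 * (p x \<bullet> p x)) * v x"
    define T where "T = 2 * h * (f x * (p x \<bullet> g x)) + h * L x * v x"
    \<comment> \<open>The conjugation identity: the first and zeroth order terms produced by
      differentiating \<open>w\<close> are exactly those in \<open>S\<close> and \<open>T\<close>,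
      and only the Laplacian of \<open>u\<close> is left.\<close>
    have ST: "S + T = - (w x * (h\<^sup>2 * lapu x))"
    proof -
      have "q x \<bullet> g x = w x * (q x \<bullet> u' x + (u x / h) * (q x \<bullet> q x))"
        by (simp add: g_def inner_add_right)
      then show ?thesis
        unfolding S_def T_def qg[symmetric] qq[symmetric] lap v_def using h
        by (simp add: field_simps power2_eq_square)
    qed
    have fn: "f x \<ge> 0" using fx by simp
    \<comment> \<open>Both \<open>f\<close> and \<open>t\<close> depend on \<open>h\<close>; the
      bounds f \<le> 2 and t \<le> 1 replace them by constants, which explains the numerical factors
      in the hypothesis on \<open>K\<close>.\<close>
    have G: "norm (- 4 *\<^sub>R M' x + 2 *\<^sub>R L' x - (4 * L x) *\<^sub>R W x) \<le> K"
    proof -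
      have nM: "norm (M' x) \<le> 2 * norm (m' x) + \<bar>m x\<bar> * norm (p x)"
      proof -
        have "norm (M' x) \<le> norm (f x *\<^sub>R m' x) + norm (m x *\<^sub>R (t *\<^sub>R p x))" unfolding M'_def by (rule norm_triangle_ineq)
        also have "\<dots> = f x * norm (m' x) + t * (\<bar>m x\<bar> * norm (p x))" using fn t(2) by (simp add: abs_mult mult_ac)
        also have "\<dots> \<le> 2 * norm (m' x) + 1 * (\<bar>m x\<bar> * norm (p x))"
          using fx t(2,3) by (intro add_mono mult_right_mono) auto
        finally show ?thesis by simp
      qed
      have nL: "norm (L' x) \<le> 2 * norm (D' x) + \<bar>D x\<bar> * norm (p x) + 2 * norm (hess \<phi> x (p x))"
      proof -
        have "norm (L' x) \<le> norm (f x *\<^sub>R D' x) + norm (D x *\<^sub>R (t *\<^sub>R p x)) + norm (t *\<^sub>R (2 *\<^sub>R hess \<phi> x (p x)))"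
          unfolding L'_def
          using norm_triangle_ineq[of "f x *\<^sub>R D' x + D x *\<^sub>R (t *\<^sub>R p x)" "t *\<^sub>R (2 *\<^sub>R hess \<phi> x (p x))"]
            norm_triangle_ineq[of "f x *\<^sub>R D' x" "D x *\<^sub>R (t *\<^sub>R p x)"] by linarith
        also have "\<dots> = f x * norm (D' x) + t * (\<bar>D x\<bar> * norm (p x)) + t * (2 * norm (hess \<phi> x (p x)))" using fn t(2) by (simp add: abs_mult mult_ac)
        also have "\<dots> \<le> 2 * norm (D' x) + 1 * (\<bar>D x\<bar> * norm (p x)) + 1 * (2 * norm (hess \<phi> x (p x)))"
          using fx t(2,3) by (intro add_mono mult_right_mono) auto
        finally show ?thesis by simp
      qed
      have nl: "\<bar>L x\<bar> \<le> 2 * \<bar>D x\<bar> + p x \<bullet> p x"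
      proof -
        have "\<bar>L x\<bar> \<le> \<bar>f x * D x\<bar> + \<bar>t * N x\<bar>" unfolding L_def by (rule abs_triangle_ineq)
        also have "\<dots> = f x * \<bar>D x\<bar> + t * (p x \<bullet> p x)" using fn t(2) by (simp add: abs_mult N_def)
        also have "\<dots> \<le> 2 * \<bar>D x\<bar> + 1 * (p x \<bullet> p x)" using fx t(2,3) by (intro add_mono mult_right_mono) auto
        finally show ?thesis by simp
      qed
      have "norm (- 4 *\<^sub>R M' x + 2 *\<^sub>R L' x - (4 * L x) *\<^sub>R W x) \<le> norm (- 4 *\<^sub>R M' x) + norm (2 *\<^sub>R L' x) + norm ((4 * L x) *\<^sub>R W x)"
        using norm_triangle_ineq4[of "- 4 *\<^sub>R M' x + 2 *\<^sub>R L' x" "(4 * L x) *\<^sub>R W x"]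
          norm_triangle_ineq[of "- 4 *\<^sub>R M' x" "2 *\<^sub>R L' x"] by linarith
      also have "\<dots> = 4 * norm (M' x) + 2 * norm (L' x) + 4 * \<bar>L x\<bar> * norm (W x)" by (simp add: abs_mult)
      also have "\<dots> \<le> 4 * (2 * norm (m' x) + \<bar>m x\<bar> * norm (p x)) +
         2 * (2 * norm (D' x) + \<bar>D x\<bar> * norm (p x) + 2 * norm (hess \<phi> x (p x))) +
         4 * (2 * \<bar>D x\<bar> + p x \<bullet> p x) * norm (W x)"
        using nM nL nl by (intro add_mono mult_right_mono mult_left_mono) auto
      also have "\<dots> \<le> K" unfolding p_def by (rule K(4)[OF x])
      finally show ?thesis .
    qed
    have Km: "\<bar>f x * m x\<bar> \<le> K"
    proof -
      have "\<bar>f x * m x\<bar> = f x * \<bar>m x\<bar>" using fn by (simp add: abs_mult)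
      also have "\<dots> \<le> 2 * \<bar>m x\<bar>" using fx by (intro mult_right_mono) auto
      finally show ?thesis using K(2)[OF x] by simp
    qed
    have pc: "- 4 * h^3 * (lap x * (f x * (p x \<bullet> g x)) + g x \<bullet> (f x *\<^sub>R hess \<phi> x (g x) + (t * (p x \<bullet> g x)) *\<^sub>R p x))
    - 2 * h^3 * (L x * v x * lap x + v x * (L' x \<bullet> g x)) - 2 * h * ((f x)\<^sup>2 * (p x \<bullet> p x)) * L x * (v x)\<^sup>2
    - 4 * h * (v x)\<^sup>2 * ((f x *\<^sub>R p x) \<bullet> (f x *\<^sub>R hess \<phi> x (f x *\<^sub>R p x) + (t * (p x \<bullet> (f x *\<^sub>R p x))) *\<^sub>R p x))
    - 4 * h * ((f x)\<^sup>2 * (p x \<bullet> p x)) * v x * (f x * (p x \<bullet> g x))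
    + 4 * h^3 * (f x * m x * (g x \<bullet> g x) + f x * m x * v x * lap x + v x * (M' x \<bullet> g x)) - \<kappa> * t * h^3 * (g x \<bullet> g x + v x * lap x)
    + h\<^sup>2 * ((v x)\<^sup>2 + h\<^sup>2 * (g x \<bullet> g x)) \<le> (S + T)\<^sup>2"
      by (rule pointwise_carleman[OF linear_hess, where m="m x" and W="W x" and \<epsilon>=\<epsilon> and K=K and ?n0.0=n0 and P=P])
         (use char x n t h eps fx G Km K small in \<open>simp_all add: p_def S_def T_def \<kappa>_def\<close>)
    show "- 4 * h^3 * (lap x * (q x \<bullet> g x) + g x \<bullet> (\<Sum>i\<in>UNIV. g x $ i *\<^sub>R q' i x))
      - 2 * h^3 * (L x * v x * lap x + v x * (L' x \<bullet> g x)) - 2 * h * (q x \<bullet> q x) * L x * (v x)\<^sup>2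
      - 4 * h * (v x)\<^sup>2 * (q x \<bullet> (\<Sum>i\<in>UNIV. q x $ i *\<^sub>R q' i x))
      - 4 * h * (q x \<bullet> q x) * v x * (q x \<bullet> g x)
      + 4 * h^3 * (M x * (g x \<bullet> g x) + M x * v x * lap x + v x * (M' x \<bullet> g x)) - \<kappa> * t * h^3 * (g x \<bullet> g x + v x * lap x)
      + h\<^sup>2 * ((v x)\<^sup>2 + h\<^sup>2 * (g x \<bullet> g x)) \<le> (w x * (h\<^sup>2 * lapu x))\<^sup>2"
      using pc unfolding ST power2_minus hq qg qq M_def by (simp only: q_def)
  qed
  \<comment> \<open>On the boundary \<open>u\<close> vanishes, so the gradient of \<open>v\<close>
    reduces to \<open>w\<close> times that of \<open>u\<close>.\<close>
  have "(\<integral>x. indicator (frontier \<Omega>) x * (- 2 * h^3 * ((q x \<bullet> outer_normal \<Omega> x) * (g x \<bullet> outer_normal \<Omega> x)\<^sup>2)) \<partial>\<sigma>) =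
     (\<integral>x. indicator (frontier \<Omega>) x * (- 2 * h^3 * (f x * (p x \<bullet> outer_normal \<Omega> x) * (w x * (u' x \<bullet> outer_normal \<Omega> x))\<^sup>2)) \<partial>\<sigma>)"
    by (intro Bochner_Integration.integral_cong refl) (simp add: indicator_def zero g_def q_def)
  then show ?thesis
    using le by (simp only: v_def g_def q_def p_def lapu_def power2_norm_eq_inner)
qed

end

section \<open>Choice of the constants, and the return from the convexified weight to the original
  one\<close>

lemma compact_continuous_upper_bound:
  fixes F :: "'a::topological_space \<Rightarrow> real"
  assumes "compact S" "continuous_on S F"
  shows "\<exists>K\<ge>0. \<forall>x\<in>S. F x \<le> K"
proof -
  have "bounded (F ` S)" using assms by (intro compact_imp_bounded compact_continuous_image)
  then obtain B where "\<And>x. x \<in> S \<Longrightarrow> \<bar>F x\<bar> \<le> B" by (auto simp: bounded_real)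
  then show ?thesis by (intro exI[of _ "max B 0"]) (force simp: abs_le_iff)
qed

lemma limiting_carleman_weight_hess:
  assumes O: "open \<Omega>'" and \<phi>: "limiting_carleman_weight \<Omega>' \<phi>" and x: "x \<in> \<Omega>'"
  shows "\<xi> \<bullet> hess \<phi> x \<xi> = - (grad \<phi> x \<bullet> hess \<phi> x (grad \<phi> x)) / (grad \<phi> x \<bullet> grad \<phi> x) * (\<xi> \<bullet> \<xi>) +
    2 * (grad \<phi> x \<bullet> \<xi>) * (\<xi> \<bullet> hess \<phi> x (grad \<phi> x)) / (grad \<phi> x \<bullet> grad \<phi> x)"
proof (rule quadratic_form_characteristic[OF linear_hess])
  have sm: "smooth_on \<Omega>' \<phi>" using \<phi> by (simp add: limiting_carleman_weight_def)
  show "\<xi> \<bullet> hess \<phi> x \<eta> = \<eta> \<bullet> hess \<phi> x \<xi>" for \<xi> \<eta> by (rule hess_symmetric[OF O sm x])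
  show "grad \<phi> x \<noteq> 0" using \<phi> x by (simp add: limiting_carleman_weight_def)
  fix \<xi> assume "\<xi> \<bullet> \<xi> = grad \<phi> x \<bullet> grad \<phi> x" "grad \<phi> x \<bullet> \<xi> = 0"
  then have "symbol_a \<phi> x \<xi> = 0 \<and> symbol_b \<phi> x \<xi> = 0" by (simp add: symbol_a_def symbol_b_def)
  then have "poisson_bracket (symbol_a \<phi>) (symbol_b \<phi>) x \<xi> = 0"
    using \<phi> x unfolding limiting_carleman_weight_def by blast
  then show "\<xi> \<bullet> hess \<phi> x \<xi> + grad \<phi> x \<bullet> hess \<phi> x (grad \<phi> x) = 0"
    unfolding poisson_bracket_symbols[OF sm x] by simp
qed

text \<open>The gradient of w u is \<open>w\<close> times the vector on the right. Solving for
  \<open>a\<close> costs a term u f b, which is bounded by the square of \<open>u\<close> without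
  any power of 1/h because of the factor \<open>h\<close> in front of the gradient.\<close>

lemma weighted_gradient_bound:
  fixes a b :: "'a::real_inner"
  assumes h: "h > 0" and f: "0 \<le> f" "f \<le> 2" and N: "b \<bullet> b \<le> P"
  shows "u\<^sup>2 + h\<^sup>2 * (norm a)\<^sup>2 \<le> (2 + 8 * P) * (u\<^sup>2 + h\<^sup>2 * (norm (a + (u / h) *\<^sub>R (f *\<^sub>R b)))\<^sup>2)"
proof -
  define c where "c = a + (u / h) *\<^sub>R (f *\<^sub>R b)"
  have P: "P \<ge> 0" using N inner_ge_zero order_trans by blast
  have "h *\<^sub>R a = h *\<^sub>R c - (u * f) *\<^sub>R b" using h by (simp add: c_def scaleR_add_right)
  then have "norm (h *\<^sub>R a) \<le> norm (h *\<^sub>R c) + norm ((u * f) *\<^sub>R b)" by (metis norm_triangle_ineq4)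
  then have "(norm (h *\<^sub>R a))\<^sup>2 \<le> (norm (h *\<^sub>R c) + norm ((u * f) *\<^sub>R b))\<^sup>2" by (intro power_mono) auto
  also have "\<dots> \<le> 2 * (norm (h *\<^sub>R c))\<^sup>2 + 2 * (norm ((u * f) *\<^sub>R b))\<^sup>2"
    using sum_squares_bound[of "norm (h *\<^sub>R c)" "norm ((u * f) *\<^sub>R b)"] by (simp add: power2_sum)
  also have "(norm ((u * f) *\<^sub>R b))\<^sup>2 = u\<^sup>2 * (f\<^sup>2 * (b \<bullet> b))"
    by (simp add: power_mult_distrib power2_norm_eq_inner mult.assoc)
  also have "\<dots> \<le> u\<^sup>2 * (4 * P)"
  proof -
    have "f\<^sup>2 \<le> 2\<^sup>2" using f by (intro power_mono) auto
    then show ?thesis using N by (intro mult_left_mono mult_mono) auto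
  qed
  finally have "h\<^sup>2 * (norm a)\<^sup>2 \<le> 2 * (h\<^sup>2 * (norm c)\<^sup>2) + 8 * P * u\<^sup>2"
    by (simp add: power_mult_distrib mult_ac)
  moreover have "0 \<le> u\<^sup>2" "0 \<le> P * (h\<^sup>2 * (norm c)\<^sup>2)" using P by simp_all
  moreover have "(2 + 8 * P) * (u\<^sup>2 + h\<^sup>2 * (norm c)\<^sup>2) =
      2 * u\<^sup>2 + 2 * (h\<^sup>2 * (norm c)\<^sup>2) + 8 * P * u\<^sup>2 + 8 * (P * (h\<^sup>2 * (norm c)\<^sup>2))"
    by (simp add: algebra_simps)
  ultimately show ?thesis unfolding c_def[symmetric] by linarith
qed

context smooth_domain begin

text \<open>Closedness provides the measurability that integrals over the two parts require.\<close>

lemma closed_boundary_parts: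
  assumes "continuous_on (closure \<Omega>) (grad \<phi>)"
  shows "closed (boundary_plus \<Omega> \<phi>)" "closed (boundary_minus \<Omega> \<phi>)"
proof -
  have c: "continuous_on (frontier \<Omega>) (\<lambda>x. grad \<phi> x \<bullet> outer_normal \<Omega> x)"
    by (intro continuous_intros continuous_outer_normal continuous_on_subset[OF assms frontier_subset_closure])
  have "closed (frontier \<Omega> \<inter> (\<lambda>x. grad \<phi> x \<bullet> outer_normal \<Omega> x) -` {0..})"
    "closed (frontier \<Omega> \<inter> (\<lambda>x. grad \<phi> x \<bullet> outer_normal \<Omega> x) -` {..0})"
    by (auto intro!: continuous_closed_preimage c)
  moreover have "boundary_plus \<Omega> \<phi> = frontier \<Omega> \<inter> (\<lambda>x. grad \<phi> x \<bullet> outer_normal \<Omega> x) -` {0..}"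
    "boundary_minus \<Omega> \<phi> = frontier \<Omega> \<inter> (\<lambda>x. grad \<phi> x \<bullet> outer_normal \<Omega> x) -` {..0}"
    by (auto simp: boundary_plus_def boundary_minus_def)
  ultimately show "closed (boundary_plus \<Omega> \<phi>)" "closed (boundary_minus \<Omega> \<phi>)" by simp_all
qed

lemma integrable_frontier_part:
  fixes f :: "real^'n \<Rightarrow> real"
  assumes "closed \<Gamma>" "\<Gamma> \<subseteq> frontier \<Omega>" "continuous_on (frontier \<Omega>) f"
  shows "integrable \<sigma> (\<lambda>x. indicator \<Gamma> x * f x)"
proof -
  have "integrable \<sigma> (\<lambda>x. indicator (frontier \<Omega>) x * f x * indicator \<Gamma> x)"
    using integrable_frontier[OF assms(3)] assms(1) by (intro integrable_real_mult_indicator) auto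
  moreover have "(\<lambda>x. indicator (frontier \<Omega>) x * f x * indicator \<Gamma> x) = (\<lambda>x. indicator \<Gamma> x * f x)"
    using assms(2) by (auto simp: indicator_def fun_eq_iff)
  ultimately show ?thesis by simp
qed

text \<open>Compactness of the closure bounds every coefficient formed from the weight. Then
  \<epsilon> is fixed, after it the range of \<open>h\<close>, and last the constant that compares
  the two exponentials.\<close>

lemma real_carleman_estimate:
  assumes O: "open \<Omega>'" "closure \<Omega> \<subseteq> \<Omega>'" and \<phi>: "limiting_carleman_weight \<Omega>' \<phi>"
  shows "\<exists>C\<ge>1. \<exists>h0>0. \<forall>V u u' u'' h. open V \<and> closure \<Omega> \<subseteq> V \<and> C1_grad V u u' \<and>
      (\<forall>i. C1_grad V (\<lambda>x. u' x $ i) (u'' i)) \<and> (\<forall>x\<in>frontier \<Omega>. u x = 0) \<and> 0 < h \<and> h \<le> h0 \<longrightarrow>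
    (h\<^sup>2 / C) * (\<integral>x. indicator \<Omega> x * ((exp (\<phi> x / h))\<^sup>2 * ((u x)\<^sup>2 + h\<^sup>2 * (norm (u' x))\<^sup>2)) \<partial>lborel)
      - h^3 * (\<integral>x. indicator (boundary_minus \<Omega> \<phi>) x * ((grad \<phi> x \<bullet> outer_normal \<Omega> x) * (exp (\<phi> x / h) * (u' x \<bullet> outer_normal \<Omega> x))\<^sup>2) \<partial>\<sigma>)
    \<le> C * (\<integral>x. indicator \<Omega> x * (exp (\<phi> x / h) * (h\<^sup>2 * (\<Sum>i\<in>UNIV. u'' i x $ i)))\<^sup>2 \<partial>lborel)
      + C * h^3 * (\<integral>x. indicator (boundary_plus \<Omega> \<phi>) x * ((grad \<phi> x \<bullet> outer_normal \<Omega> x) * (exp (\<phi> x / h) * (u' x \<bullet> outer_normal \<Omega> x))\<^sup>2) \<partial>\<sigma>)"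
proof -
  have sm: "smooth_on \<Omega>' \<phi>" using \<phi> by (simp add: limiting_carleman_weight_def)
  define p where "p = grad \<phi>"
  define N where "N x = p x \<bullet> p x" for x
  define Hp where "Hp x = hess \<phi> x (p x)" for x
  define m where "m x = - (p x \<bullet> Hp x) / N x" for x
  define W where "W x = (1 / N x) *\<^sub>R Hp x" for x
  define D where "D x = (\<Sum>i\<in>UNIV. grad (partial i \<phi>) x $ i)" for x
  have pnz: "p x \<noteq> 0" if "x \<in> \<Omega>'" for x using \<phi> that by (simp add: p_def limiting_carleman_weight_def)
  have Nnz: "N x \<noteq> 0" if "x \<in> \<Omega>'" for x using pnz[OF that] by (simp add: N_def)
  have p1: "C1_grad \<Omega>' (\<lambda>x. p x $ i) (grad (partial i \<phi>))" for i
    unfolding p_def by (rule smooth_on_C1_grad_component[OF sm])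
  have pp1: "C1_grad \<Omega>' (\<lambda>x. grad (partial i \<phi>) x $ j) (grad (partial j (partial i \<phi>)))" for i j
    by (rule smooth_on_C1_grad_component[OF smooth_on_partial[OF sm]])
  have D1: "C1_grad \<Omega>' D (\<lambda>x. \<Sum>i\<in>UNIV. grad (partial i (partial i \<phi>)) x)"
    unfolding D_def by (intro C1_grad_sum pp1)
  define D' where "D' x = (\<Sum>i\<in>UNIV. grad (partial i (partial i \<phi>)) x)" for x
  obtain m' where m1: "C1_grad \<Omega>' m m'"
  proof -
    have k: "p x \<bullet> Hp x = (\<Sum>j\<in>UNIV. p x $ j * (\<Sum>i\<in>UNIV. p x $ i * grad (partial i \<phi>) x $ j))" for x
      by (simp add: Hp_def hess_def inner_vec_def)
    have N: "N x = (\<Sum>j\<in>UNIV. p x $ j * p x $ j)" for x by (simp add: N_def inner_vec_def)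
    obtain k' where k1: "C1_grad \<Omega>' (\<lambda>x. p x \<bullet> Hp x) k'"
      unfolding k by atomize_elim (rule exI, rule C1_grad_sum, rule C1_grad_mult, rule p1, rule C1_grad_sum, rule C1_grad_mult, rule p1, rule pp1)
    obtain N' where N1: "C1_grad \<Omega>' N N'"
      unfolding N[abs_def] by atomize_elim (rule exI, rule C1_grad_sum, rule C1_grad_mult, rule p1, rule p1)
    note C1_grad_mult[OF C1_grad_minus[OF k1] C1_grad_inverse[OF N1 Nnz]]
    then show ?thesis using that unfolding m_def[abs_def] divide_inverse by blast
  qed
  have cp: "continuous_on \<Omega>' p" unfolding p_def by (rule C1_grad_continuous_grad[OF smooth_on_C1_grad[OF sm]])
  have cN: "continuous_on \<Omega>' N" unfolding N_def by (intro continuous_intros cp)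
  have cH: "continuous_on \<Omega>' Hp" unfolding Hp_def hess_def
    by (intro continuous_intros cp C1_grad_continuous_grad[OF p1])
  have cW: "continuous_on \<Omega>' W" unfolding W_def using Nnz by (intro continuous_intros cN cH) auto
  have cD': "continuous_on \<Omega>' D'" unfolding D'_def by (rule C1_grad_continuous_grad[OF D1])
  note cs = cp cN cH cW cD' C1_grad_continuous[OF m1] C1_grad_continuous_grad[OF m1] C1_grad_continuous[OF D1]
    C1_grad_continuous[OF smooth_on_C1_grad[OF sm]]
  have bound: "\<exists>K\<ge>0. \<forall>x\<in>closure \<Omega>. F x \<le> K" if "continuous_on \<Omega>' F" for F :: "_ \<Rightarrow> real"
    using compact_closure continuous_on_subset[OF that O(2)] by (rule compact_continuous_upper_bound)
  obtain P0 where P0: "P0 \<ge> 0" "\<And>x. x \<in> closure \<Omega> \<Longrightarrow> N x \<le> P0" using bound[OF cN] by blast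
  \<comment> \<open>The added 1 makes \<open>P\<close> positive even when the closure is empty; the
    one in \<open>n0\<close> likewise guards against inverting 0.\<close>
  define P where "P = P0 + 1"
  have P: "P > 0" "\<And>x. x \<in> closure \<Omega> \<Longrightarrow> N x \<le> P"
    using P0(1) by (simp add: P_def) (use P0(2) in \<open>force simp: P_def\<close>)
  have "continuous_on \<Omega>' (\<lambda>x. inverse (N x))" using Nnz by (intro continuous_intros cN) auto
  then obtain K0 where K0: "K0 \<ge> 0" "\<And>x. x \<in> closure \<Omega> \<Longrightarrow> inverse (N x) \<le> K0" using bound by blast
  define n0 where "n0 = inverse (K0 + 1)"
  have n0: "n0 > 0" using K0 by (simp add: n0_def)
  have n0N: "n0 \<le> N x" if "x \<in> closure \<Omega>" for x
  proof -
    have "N x > 0" using pnz[of x] that O(2) by (auto simp: N_def)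
    moreover have "inverse (N x) \<le> K0 + 1" using K0(2)[OF that] by simp
    ultimately have "inverse (K0 + 1) \<le> inverse (inverse (N x))" by (intro le_imp_inverse_le) auto
    then show ?thesis by (simp add: n0_def)
  qed
  have "continuous_on \<Omega>' (\<lambda>x. \<bar>\<phi> x\<bar>)" by (intro continuous_intros cs)
  then obtain \<Phi> where \<Phi>: "\<Phi> \<ge> 0" "\<And>x. x \<in> closure \<Omega> \<Longrightarrow> \<bar>\<phi> x\<bar> \<le> \<Phi>" using bound by blast
  define Kf where "Kf x = 4 * (2 * norm (m' x) + \<bar>m x\<bar> * norm (p x)) +
         2 * (2 * norm (D' x) + \<bar>D x\<bar> * norm (p x) + 2 * norm (Hp x)) +
         4 * (2 * \<bar>D x\<bar> + N x) * norm (W x)" for x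
  have Kf0: "Kf x \<ge> 0" for x
    unfolding Kf_def N_def by (intro add_nonneg_nonneg mult_nonneg_nonneg) auto
  have "continuous_on \<Omega>' (\<lambda>x. 2 * \<bar>m x\<bar> + norm (W x) + Kf x)"
    unfolding Kf_def by (intro continuous_intros cs)
  then obtain K where K: "K \<ge> 0" "\<And>x. x \<in> closure \<Omega> \<Longrightarrow> 2 * \<bar>m x\<bar> + norm (W x) + Kf x \<le> K" using bound by blast
  define \<kappa> where "\<kappa> = n0\<^sup>2 / (8 * P)"
  define Cc where "Cc = \<kappa>\<^sup>2 + 8 * K\<^sup>2 + K + 1"
  have Cc: "Cc > 0" unfolding Cc_def using K(1) by (intro add_nonneg_pos add_nonneg_nonneg) auto
  define \<epsilon> where "\<epsilon> = min (n0\<^sup>2 / 2) \<kappa> / Cc"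
  have \<kappa>0: "\<kappa> > 0" using n0 P by (simp add: \<kappa>_def)
  have \<epsilon>: "\<epsilon> > 0" using Cc n0 \<kappa>0 by (simp add: \<epsilon>_def)
  have small: "\<epsilon> * ((n0\<^sup>2 / (8 * P))\<^sup>2 + 8 * K\<^sup>2 + K + 1) \<le> min (n0\<^sup>2 / 2) (n0\<^sup>2 / (8 * P))"
    using Cc by (simp add: \<epsilon>_def Cc_def[symmetric] \<kappa>_def[symmetric])
  \<comment> \<open>Ensures t (\<Phi> + 1) \<le> 1/2, from which both t \<le> 1 and the bound 1/2
    for t \<phi> follow, also when \<Phi> is zero.\<close>
  define h0 where "h0 = \<epsilon> / (2 * (\<Phi> + 1))"
  have h0: "h0 > 0" using \<epsilon> \<Phi> by (simp add: h0_def)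
  \<comment> \<open>An upper bound for the square of \<open>r x\<close>, the quotient of the
    convexified and the original exponential.\<close>
  define E where "E = exp (\<Phi>\<^sup>2 / \<epsilon>)"
  have E1: "E \<ge> 1" using \<epsilon> by (simp add: E_def)
  \<comment> \<open>The first summand dominates the factor 2 f r^2 at the boundary as well as r^2 in
    the source term; the second is the constant of \<open>weighted_gradient_bound\<close>.\<close>
  define C where "C = 4 * E + (2 + 8 * P)"
  have C: "C \<ge> 1" "4 * E \<le> C" "2 + 8 * P \<le> C" "E \<le> C" using E1 P(1) by (auto simp: C_def)
  have subcl: "x \<in> \<Omega> \<Longrightarrow> x \<in> closure \<Omega>" for x using closure_subset by blast
  have main: "(h\<^sup>2 / C) * (\<integral>x. indicator \<Omega> x * ((exp (\<phi> x / h))\<^sup>2 * ((u x)\<^sup>2 + h\<^sup>2 * (norm (u' x))\<^sup>2)) \<partial>lborel)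
      - h^3 * (\<integral>x. indicator (boundary_minus \<Omega> \<phi>) x * ((grad \<phi> x \<bullet> outer_normal \<Omega> x) * (exp (\<phi> x / h) * (u' x \<bullet> outer_normal \<Omega> x))\<^sup>2) \<partial>\<sigma>)
    \<le> C * (\<integral>x. indicator \<Omega> x * (exp (\<phi> x / h) * (h\<^sup>2 * (\<Sum>i\<in>UNIV. u'' i x $ i)))\<^sup>2 \<partial>lborel)
      + C * h^3 * (\<integral>x. indicator (boundary_plus \<Omega> \<phi>) x * ((grad \<phi> x \<bullet> outer_normal \<Omega> x) * (exp (\<phi> x / h) * (u' x \<bullet> outer_normal \<Omega> x))\<^sup>2) \<partial>\<sigma>)"
    if V: "open V" "closure \<Omega> \<subseteq> V" and u: "C1_grad V u u'" "\<And>i. C1_grad V (\<lambda>x. u' x $ i) (u'' i)"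
      and zero: "\<And>x. x \<in> frontier \<Omega> \<Longrightarrow> u x = 0" and h: "0 < h" "h \<le> h0" for V u u' u'' h
  proof -
    define t where "t = h / \<epsilon>"
    have t0: "t \<ge> 0" using h \<epsilon> by (simp add: t_def)
    have tb: "t \<le> 1 / (2 * (\<Phi> + 1))"
      using h(2) \<epsilon> \<Phi>(1) by (simp add: t_def h0_def field_simps)
    have t\<Phi>: "t * (\<Phi> + 1) \<le> 1 / 2"
    proof -
      have "t * (\<Phi> + 1) \<le> 1 / (2 * (\<Phi> + 1)) * (\<Phi> + 1)" using tb \<Phi>(1) by (intro mult_right_mono) auto
      also have "\<dots> = 1 / 2" using \<Phi>(1) by simp
      finally show ?thesis .
    qed
    have t1: "t \<le> 1" using t\<Phi> t0 \<Phi>(1) mult_left_mono[of 1 "\<Phi> + 1" t] by simp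
    have t\<phi>: "\<bar>t * \<phi> x\<bar> \<le> 1 / 2" if "x \<in> closure \<Omega>" for x
    proof -
      have "\<bar>t * \<phi> x\<bar> = t * \<bar>\<phi> x\<bar>" using t0 by (simp add: abs_mult)
      also have "\<dots> \<le> t * (\<Phi> + 1)" using \<Phi>(2)[OF that] t0 by (intro mult_left_mono) auto
      finally show ?thesis using t\<Phi> by simp
    qed
    define f where "f x = 1 + t * \<phi> x" for x
    define w where "w x = exp ((\<phi> x + t / 2 * (\<phi> x * \<phi> x)) / h)" for x
    define e where "e x = exp (\<phi> x / h)" for x
    define r where "r x = exp (\<phi> x * \<phi> x / (2 * \<epsilon>))" for x
    have wer: "w x = e x * r x" for x
    proof -
      have "(\<phi> x + t / 2 * (\<phi> x * \<phi> x)) / h = \<phi> x / h + \<phi> x * \<phi> x / (2 * \<epsilon>)"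
        using h \<epsilon> by (simp add: t_def field_simps)
      then show ?thesis by (simp add: w_def e_def r_def exp_add)
    qed
    have f: "1 / 2 \<le> f x" "f x \<le> 2" if "x \<in> closure \<Omega>" for x using t\<phi>[OF that] by (auto simp: f_def abs_le_iff)
    have r1: "1 \<le> (r x)\<^sup>2" for x using \<epsilon> by (simp add: r_def)
    have r2: "(r x)\<^sup>2 \<le> E" if "x \<in> closure \<Omega>" for x
    proof -
      have "\<phi> x * \<phi> x \<le> \<Phi>\<^sup>2" using \<Phi>(2)[OF that] by (metis abs_le_square_iff abs_of_nonneg \<Phi>(1) power2_eq_square)
      then show ?thesis using \<epsilon> by (simp add: r_def E_def exp_double[symmetric] divide_right_mono)
    qed
    define lapu where "lapu x = (\<Sum>i\<in>UNIV. u'' i x $ i)" for x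
    define g where "g x = u' x + (u x / h) *\<^sub>R (f x *\<^sub>R p x)" for x
    define b where "b x = (p x \<bullet> outer_normal \<Omega> x) * (e x * (u' x \<bullet> outer_normal \<Omega> x))\<^sup>2" for x
    let ?I = "\<lambda>F. \<integral>x. indicator \<Omega> x * F x \<partial>lborel"
    let ?B = "\<lambda>\<Gamma> F. \<integral>x. indicator \<Gamma> x * F x \<partial>\<sigma>"
    have est: "?I (\<lambda>x. h\<^sup>2 * ((w x * u x)\<^sup>2 + h\<^sup>2 * (norm (w x *\<^sub>R g x))\<^sup>2))
      + ?B (frontier \<Omega>) (\<lambda>x. - 2 * h^3 * (f x * (p x \<bullet> outer_normal \<Omega> x) * (w x * (u' x \<bullet> outer_normal \<Omega> x))\<^sup>2))
      \<le> ?I (\<lambda>x. (w x * (h\<^sup>2 * lapu x))\<^sup>2)"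
      unfolding g_def lapu_def p_def
    proof (rule conjugated_estimate[OF O sm _ _ m1 _ D1 n0 _ _ t_def t0 t1 h(1) \<epsilon> _ K(1) _ _ _ small V u zero f_def w_def])
      fix x assume x: "x \<in> \<Omega>"
      then have xO: "x \<in> \<Omega>'" and xc: "x \<in> closure \<Omega>" using subcl O(2) by auto
      show "\<xi> \<bullet> hess \<phi> x \<xi> = m x * (\<xi> \<bullet> \<xi>) + 2 * (grad \<phi> x \<bullet> \<xi>) * (\<xi> \<bullet> W x)" for \<xi>
        using limiting_carleman_weight_hess[OF O(1) \<phi> xO, of \<xi>] by (simp add: m_def W_def N_def Hp_def p_def)
      show "grad \<phi> x \<bullet> hess \<phi> x (grad \<phi> x) = - m x * (grad \<phi> x \<bullet> grad \<phi> x)"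
        using Nnz[OF xO] by (simp add: m_def Hp_def p_def N_def)
      show "n0 \<le> grad \<phi> x \<bullet> grad \<phi> x" "grad \<phi> x \<bullet> grad \<phi> x \<le> P"
        using n0N[OF xc] P(2)[OF xc] by (simp_all add: N_def p_def)
      show "\<bar>t * \<phi> x\<bar> \<le> 1 / 2" by (rule t\<phi>[OF xc])
      show "2 * \<bar>m x\<bar> \<le> K" "norm (W x) \<le> K"
        using K(2)[OF xc] Kf0[of x] norm_ge_zero[of "W x"] abs_ge_zero[of "m x"] by linarith+
      have "Kf x \<le> K" using K(2)[OF xc] norm_ge_zero[of "W x"] abs_ge_zero[of "m x"] by linarith
      then show "4 * (2 * norm (m' x) + \<bar>m x\<bar> * norm (grad \<phi> x)) +
         2 * (2 * norm (\<Sum>i\<in>UNIV. grad (partial i (partial i \<phi>)) x) + \<bar>D x\<bar> * norm (grad \<phi> x) + 2 * norm (hess \<phi> x (grad \<phi> x))) +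
         4 * (2 * \<bar>D x\<bar> + grad \<phi> x \<bullet> grad \<phi> x) * norm (W x) \<le> K"
        by (simp only: Kf_def D'_def Hp_def N_def p_def)
    qed (simp_all add: D_def)
    have c1: "continuous_on (closure \<Omega>) u" "continuous_on (closure \<Omega>) u'"
      "continuous_on (closure \<Omega>) \<phi>" "continuous_on (closure \<Omega>) p" "continuous_on (closure \<Omega>) (u'' i)" for i
      using continuous_on_subset[OF C1_grad_continuous[OF u(1)] V(2)] continuous_on_subset[OF C1_grad_continuous_grad[OF u(1)] V(2)]
        continuous_on_subset[OF C1_grad_continuous[OF smooth_on_C1_grad[OF sm]] O(2)] continuous_on_subset[OF cp O(2)]
        continuous_on_subset[OF C1_grad_continuous_grad[OF u(2)] V(2)] by simp_all
    have c2: "continuous_on (closure \<Omega>) f" "continuous_on (closure \<Omega>) w" "continuous_on (closure \<Omega>) e"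
      "continuous_on (closure \<Omega>) lapu" "continuous_on (closure \<Omega>) g"
      unfolding f_def w_def e_def lapu_def g_def using h(1) by (intro continuous_intros c1 less_imp_neq[symmetric]; simp)+
    note cf = c1[THEN continuous_on_subset[OF _ frontier_subset_closure]] c2[THEN continuous_on_subset[OF _ frontier_subset_closure]]
    have cb: "continuous_on (frontier \<Omega>) b"
      unfolding b_def by (intro continuous_intros cf continuous_outer_normal)
    note cl = closed_boundary_parts[OF c1(4)[unfolded p_def]]
    have ib: "integrable \<sigma> (\<lambda>x. indicator (boundary_plus \<Omega> \<phi>) x * b x)" "integrable \<sigma> (\<lambda>x. indicator (boundary_minus \<Omega> \<phi>) x * b x)"
      by (rule integrable_frontier_part[OF cl(1) _ cb] integrable_frontier_part[OF cl(2) _ cb]; auto simp: boundary_plus_def boundary_minus_def)+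
    have low: "(h\<^sup>2 / C) * ?I (\<lambda>x. (e x)\<^sup>2 * ((u x)\<^sup>2 + h\<^sup>2 * (norm (u' x))\<^sup>2))
       \<le> ?I (\<lambda>x. h\<^sup>2 * ((w x * u x)\<^sup>2 + h\<^sup>2 * (norm (w x *\<^sub>R g x))\<^sup>2))"
    proof -
      have i1: "integrable lborel (\<lambda>x. indicator \<Omega> x * ((e x)\<^sup>2 * ((u x)\<^sup>2 + h\<^sup>2 * (norm (u' x))\<^sup>2)))"
        by (intro integrable_domain continuous_intros c1 c2)
      have i2: "integrable lborel (\<lambda>x. indicator \<Omega> x * (h\<^sup>2 * ((w x * u x)\<^sup>2 + h\<^sup>2 * (norm (w x *\<^sub>R g x))\<^sup>2)))"
        by (intro integrable_domain continuous_intros c1 c2)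
      have "(\<integral>x. (h\<^sup>2 / C) * (indicator \<Omega> x * ((e x)\<^sup>2 * ((u x)\<^sup>2 + h\<^sup>2 * (norm (u' x))\<^sup>2))) \<partial>lborel)
        \<le> ?I (\<lambda>x. h\<^sup>2 * ((w x * u x)\<^sup>2 + h\<^sup>2 * (norm (w x *\<^sub>R g x))\<^sup>2))"
      proof (rule integral_mono[OF integrable_mult_right[OF i1] i2])
        fix x
        show "(h\<^sup>2 / C) * (indicator \<Omega> x * ((e x)\<^sup>2 * ((u x)\<^sup>2 + h\<^sup>2 * (norm (u' x))\<^sup>2)))
          \<le> indicator \<Omega> x * (h\<^sup>2 * ((w x * u x)\<^sup>2 + h\<^sup>2 * (norm (w x *\<^sub>R g x))\<^sup>2))"
        proof (cases "x \<in> \<Omega>")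
          case True
          then have xc: "x \<in> closure \<Omega>" by (rule subcl)
          define J where "J = (u x)\<^sup>2 + h\<^sup>2 * (norm (g x))\<^sup>2"
          have J: "J \<ge> 0" by (simp add: J_def)
          have "(u x)\<^sup>2 + h\<^sup>2 * (norm (u' x))\<^sup>2 \<le> (2 + 8 * P) * J"
            unfolding J_def g_def using f[OF xc] P(2)[OF xc] by (intro weighted_gradient_bound h(1)) (auto simp: N_def)
          also have "\<dots> \<le> C * J" using C(3) J by (rule mult_right_mono)
          finally have "(e x)\<^sup>2 * ((u x)\<^sup>2 + h\<^sup>2 * (norm (u' x))\<^sup>2) \<le> (e x)\<^sup>2 * (C * J)" by (intro mult_left_mono) auto
          also have "\<dots> \<le> ((e x)\<^sup>2 * (r x)\<^sup>2) * (C * J)"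
            using r1[of x] J C(1) mult_left_mono[OF r1[of x], of "(e x)\<^sup>2"] by (intro mult_right_mono) auto
          also have "\<dots> = C * ((w x)\<^sup>2 * J)" by (simp add: wer power_mult_distrib)
          also have "(w x)\<^sup>2 * J = (w x * u x)\<^sup>2 + h\<^sup>2 * (norm (w x *\<^sub>R g x))\<^sup>2"
            by (simp add: J_def power_mult_distrib distrib_left mult_ac)
          finally have "(h\<^sup>2 / C) * ((e x)\<^sup>2 * ((u x)\<^sup>2 + h\<^sup>2 * (norm (u' x))\<^sup>2)) \<le> (h\<^sup>2 / C) * (C * ((w x * u x)\<^sup>2 + h\<^sup>2 * (norm (w x *\<^sub>R g x))\<^sup>2))"
            using C(1) by (intro mult_left_mono) auto
          then show ?thesis using True C(1) by simp
        qed simp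
      qed
      then show ?thesis by simp
    qed
    have up: "?I (\<lambda>x. (w x * (h\<^sup>2 * lapu x))\<^sup>2) \<le> C * ?I (\<lambda>x. (e x * (h\<^sup>2 * lapu x))\<^sup>2)"
    proof -
      have i1: "integrable lborel (\<lambda>x. indicator \<Omega> x * (w x * (h\<^sup>2 * lapu x))\<^sup>2)"
        by (intro integrable_domain continuous_intros c1 c2)
      have i2: "integrable lborel (\<lambda>x. indicator \<Omega> x * (e x * (h\<^sup>2 * lapu x))\<^sup>2)"
        by (intro integrable_domain continuous_intros c1 c2)
      have "?I (\<lambda>x. (w x * (h\<^sup>2 * lapu x))\<^sup>2) \<le> (\<integral>x. C * (indicator \<Omega> x * (e x * (h\<^sup>2 * lapu x))\<^sup>2) \<partial>lborel)"
      proof (rule integral_mono[OF i1 integrable_mult_right[OF i2]])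
        fix x
        show "indicator \<Omega> x * (w x * (h\<^sup>2 * lapu x))\<^sup>2 \<le> C * (indicator \<Omega> x * (e x * (h\<^sup>2 * lapu x))\<^sup>2)"
        proof (cases "x \<in> \<Omega>")
          case True
          have "(r x)\<^sup>2 \<le> C" using r2[OF subcl[OF True]] C(4) by simp
          then have "(r x)\<^sup>2 * (e x * (h\<^sup>2 * lapu x))\<^sup>2 \<le> C * (e x * (h\<^sup>2 * lapu x))\<^sup>2" by (intro mult_right_mono) auto
          then show ?thesis using True by (simp add: wer power_mult_distrib mult_ac)
        qed simp
      qed
      then show ?thesis by simp
    qed
    \<comment> \<open>The boundary integrand is - h^3 k b with k = 2 f r^2 between 1 and
      \<open>C\<close>. Where \<open>b\<close> is negative the lower bound for \<open>k\<close> is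
      used, where it is positive the upper one. The two boundary parts overlap only where the normal
      derivative of the weight, and so \<open>b\<close>, is zero.\<close>
    have bdry: "- (h^3) * ?B (boundary_minus \<Omega> \<phi>) b - C * h^3 * ?B (boundary_plus \<Omega> \<phi>) b
      \<le> ?B (frontier \<Omega>) (\<lambda>x. - 2 * h^3 * (f x * (p x \<bullet> outer_normal \<Omega> x) * (w x * (u' x \<bullet> outer_normal \<Omega> x))\<^sup>2))"
    proof -
      have i0: "integrable \<sigma> (\<lambda>x. indicator (frontier \<Omega>) x * (- 2 * h^3 * (f x * (p x \<bullet> outer_normal \<Omega> x) * (w x * (u' x \<bullet> outer_normal \<Omega> x))\<^sup>2)))"
        by (intro integrable_frontier continuous_intros cf continuous_outer_normal)
      have "(\<integral>x. (- (h^3)) * (indicator (boundary_minus \<Omega> \<phi>) x * b x) - (C * h^3) * (indicator (boundary_plus \<Omega> \<phi>) x * b x) \<partial>\<sigma>)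
        \<le> ?B (frontier \<Omega>) (\<lambda>x. - 2 * h^3 * (f x * (p x \<bullet> outer_normal \<Omega> x) * (w x * (u' x \<bullet> outer_normal \<Omega> x))\<^sup>2))"
      proof (rule integral_mono[OF Bochner_Integration.integrable_diff[OF integrable_mult_right[OF ib(2)] integrable_mult_right[OF ib(1)]] i0])
        fix x
        show "(- (h^3)) * (indicator (boundary_minus \<Omega> \<phi>) x * b x) - (C * h^3) * (indicator (boundary_plus \<Omega> \<phi>) x * b x)
          \<le> indicator (frontier \<Omega>) x * (- 2 * h^3 * (f x * (p x \<bullet> outer_normal \<Omega> x) * (w x * (u' x \<bullet> outer_normal \<Omega> x))\<^sup>2))"
        proof (cases "x \<in> frontier \<Omega>")
          case False
          then show ?thesis by (simp add: boundary_plus_def boundary_minus_def)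
        next
          case True
          then have xc: "x \<in> closure \<Omega>" using frontier_subset_closure by blast
          define k where "k = 2 * (f x * (r x)\<^sup>2)"
          have eq: "- 2 * h^3 * (f x * (p x \<bullet> outer_normal \<Omega> x) * (w x * (u' x \<bullet> outer_normal \<Omega> x))\<^sup>2) = - (h^3 * (k * b x))"
            by (simp add: b_def k_def wer power_mult_distrib mult_ac)
          have k1: "1 \<le> k"
          proof -
            have "1 / 2 * 1 \<le> f x * (r x)\<^sup>2" using f[OF xc] r1[of x] by (intro mult_mono) auto
            then show ?thesis by (simp add: k_def)
          qed
          have k2: "k \<le> C"
          proof -
            have "f x * (r x)\<^sup>2 \<le> 2 * E" using f[OF xc] r2[OF xc] by (intro mult_mono) auto
            then show ?thesis using C(2) by (simp add: k_def)
          qed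
          have h3: "h^3 \<ge> 0" using h by simp
          consider "p x \<bullet> outer_normal \<Omega> x > 0" | "p x \<bullet> outer_normal \<Omega> x < 0" | "p x \<bullet> outer_normal \<Omega> x = 0" by linarith
          then show ?thesis
          proof cases
            case 1
            then have "b x \<ge> 0" by (simp add: b_def)
            then have "h^3 * (k * b x) \<le> h^3 * (C * b x)" using k2 h3 by (intro mult_left_mono mult_right_mono)
            then show ?thesis unfolding eq using 1 True by (simp add: boundary_plus_def boundary_minus_def p_def mult_ac)
          next
            case 2
            then have b0: "b x \<le> 0" by (simp add: b_def mult_nonpos_nonneg)
            have "k * b x \<le> 1 * b x" using k1 b0 by (rule mult_right_mono_neg)
            then have "h^3 * (k * b x) \<le> h^3 * b x" using h3 by (intro mult_left_mono) auto
            then show ?thesis unfolding eq using 2 True by (simp add: boundary_plus_def boundary_minus_def p_def)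
          next
            case 3
            then show ?thesis by (simp add: b_def)
          qed
        qed
      qed
      then show ?thesis using ib by simp
    qed
    have "(h\<^sup>2 / C) * ?I (\<lambda>x. (e x)\<^sup>2 * ((u x)\<^sup>2 + h\<^sup>2 * (norm (u' x))\<^sup>2)) - h^3 * ?B (boundary_minus \<Omega> \<phi>) b
      \<le> C * ?I (\<lambda>x. (e x * (h\<^sup>2 * lapu x))\<^sup>2) + C * h^3 * ?B (boundary_plus \<Omega> \<phi>) b"
      using est low up bdry by linarith
    then show ?thesis by (simp only: e_def b_def p_def lapu_def)
  qed
  show ?thesis
    by (rule exI[of _ C], rule conjI[OF C(1)], rule exI[of _ h0], rule conjI[OF h0]) (use main in blast)
qed

end

section \<open>Complex functions\<close>

text \<open>With \<open>Re\<close> and \<open>Im\<close>, applied to a complex function and to its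
  partial derivatives, this supplies the first and second derivatives required by the real
  estimate.\<close>

lemma C1_grad_bounded_linear:
  fixes u :: "real^'n::finite \<Rightarrow> 'b::real_normed_vector"
  assumes u: "smooth_on V u" and l: "bounded_linear (l :: 'b \<Rightarrow> real)"
  shows "C1_grad V (\<lambda>x. l (u x)) (\<lambda>x. \<chi> i. l (partial i u x))"
  unfolding C1_grad_def
proof (intro conjI ballI)
  interpret l: bounded_linear l by (rule l)
  fix x assume "x \<in> V"
  then have d: "u differentiable at x" by (rule smooth_on_differentiable[OF u])
  have "((\<lambda>x. l (u x)) has_derivative (\<lambda>h. l (frechet_derivative u (at x) h))) (at x)"
    using d frechet_derivative_works l.has_derivative by blast
  moreover have "l (frechet_derivative u (at x) h) = h \<bullet> (\<chi> i. l (partial i u x))" for h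
    by (simp add: frechet_derivative_expansion[OF d] l.sum l.scaleR inner_vec_def)
  ultimately show "GDERIV (\<lambda>x. l (u x)) x :> (\<chi> i. l (partial i u x))" by (simp add: gderiv_def)
next
  show "continuous_on V (\<lambda>x. \<chi> i. l (partial i u x))"
    by (intro continuous_on_vec_lambda bounded_linear.continuous_on[OF l] smooth_on_continuous smooth_on_partial u)
qed

lemma norm_grad_complex:
  fixes u :: "real^'n::finite \<Rightarrow> complex"
  shows "(norm (grad u x))\<^sup>2 = (norm (\<chi> i. Re (partial i u x)))\<^sup>2 + (norm (\<chi> i. Im (partial i u x)))\<^sup>2"
  by (simp add: norm_vec_def L2_set_def sum_nonneg grad_def cmod_power2 sum.distrib)

lemma L2norm_on_square: "(L2norm_on \<Omega> f)\<^sup>2 = (\<integral>x. (norm (f x))\<^sup>2 \<partial>lebesgue_on \<Omega>)"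
  by (simp add: L2norm_on_def)

context smooth_domain begin

text \<open>The norms refer to completed Lebesgue measure on the domain, the divergence theorem to
  the Borel measure on the whole space; for functions continuous up to the boundary the integrals
  agree.\<close>

lemma integral_lebesgue_on:
  fixes F :: "real^'n \<Rightarrow> real"
  assumes "continuous_on (closure \<Omega>) F"
  shows "integrable (lebesgue_on \<Omega>) F" "(\<integral>x. F x \<partial>lebesgue_on \<Omega>) = (\<integral>x. indicator \<Omega> x * F x \<partial>lborel)"
proof -
  have int: "integrable lborel (\<lambda>x. indicator \<Omega> x *\<^sub>R F x)" using integrable_domain[OF assms] by simp
  have \<Omega>: "\<Omega> \<inter> space lebesgue \<in> sets lebesgue" using domain_borel by simp
  have m: "(\<lambda>x. indicator \<Omega> x *\<^sub>R F x) \<in> borel_measurable lborel" using int by (rule borel_measurable_integrable)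
  show "integrable (lebesgue_on \<Omega>) F"
    using int by (subst integrable_restrict_space[OF \<Omega>]) (simp only: integrable_completion[OF m])
  have "(\<integral>x. F x \<partial>lebesgue_on \<Omega>) = (\<integral>x. indicator \<Omega> x *\<^sub>R F x \<partial>lebesgue)"
    by (rule integral_restrict_space[OF \<Omega>])
  also have "\<dots> = (\<integral>x. indicator \<Omega> x *\<^sub>R F x \<partial>lborel)" by (rule integral_completion[OF m])
  finally show "(\<integral>x. F x \<partial>lebesgue_on \<Omega>) = (\<integral>x. indicator \<Omega> x * F x \<partial>lborel)" by simp
qed

text \<open>The integrand is a real factor times the squared modulus of the normal derivative, so it
  splits into the contributions of the real and the imaginary part.\<close>

lemma boundary_term_eq:
  assumes u: "smooth_on V u" "closure \<Omega> \<subseteq> V" and \<Gamma>: "\<Gamma> \<subseteq> frontier \<Omega>"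
  shows "boundary_term \<Omega> \<Gamma> \<phi> h u = (\<integral>x. indicator \<Gamma> x * ((grad \<phi> x \<bullet> outer_normal \<Omega> x) *
    ((exp (\<phi> x / h) * ((\<chi> i. Re (partial i u x)) \<bullet> outer_normal \<Omega> x))\<^sup>2 +
     (exp (\<phi> x / h) * ((\<chi> i. Im (partial i u x)) \<bullet> outer_normal \<Omega> x))\<^sup>2)) \<partial>\<sigma>)"
proof -
  let ?\<nu> = "outer_normal \<Omega>" and ?e = "\<lambda>x. exp (\<phi> x / h)"
  define F where "F x = indicator \<Gamma> x * ((grad \<phi> x \<bullet> ?\<nu> x) *
    ((?e x * ((\<chi> i. Re (partial i u x)) \<bullet> ?\<nu> x))\<^sup>2 + (?e x * ((\<chi> i. Im (partial i u x)) \<bullet> ?\<nu> x))\<^sup>2))" for x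
  have "indicator \<Gamma> x *\<^sub>R (((grad \<phi> x \<bullet> ?\<nu> x) *\<^sub>R ?e x *\<^sub>R normal_deriv \<Omega> u x) * cnj (?e x *\<^sub>R normal_deriv \<Omega> u x))
     = complex_of_real (F x)" for x
  proof (cases "x \<in> \<Gamma>")
    case True
    then have "x \<in> V" using \<Gamma> u(2) frontier_subset_closure by blast
    then have d: "u differentiable at x" by (rule smooth_on_differentiable[OF u(1)])
    define d where "d = normal_deriv \<Omega> u x"
    have d: "d = (\<Sum>i\<in>UNIV. ?\<nu> x $ i *\<^sub>R partial i u x)"
      unfolding d_def normal_deriv_def by (rule frechet_derivative_expansion[OF \<open>u differentiable at x\<close>])
    have re: "Re d = (\<chi> i. Re (partial i u x)) \<bullet> ?\<nu> x" "Im d = (\<chi> i. Im (partial i u x)) \<bullet> ?\<nu> x"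
      by (simp_all add: d inner_vec_def mult.commute)
    have "((grad \<phi> x \<bullet> ?\<nu> x) *\<^sub>R ?e x *\<^sub>R d) * cnj (?e x *\<^sub>R d) = complex_of_real ((grad \<phi> x \<bullet> ?\<nu> x) * (?e x)\<^sup>2) * (d * cnj d)"
      by (simp add: scaleR_conv_of_real power2_eq_square mult_ac)
    also have "d * cnj d = complex_of_real ((Re d)\<^sup>2 + (Im d)\<^sup>2)" by (rule complex_mult_cnj)
    finally show ?thesis using True
      by (simp add: F_def d_def[symmetric] re[symmetric] power_mult_distrib distrib_left mult_ac)
  qed (simp add: F_def)
  then have "boundary_pairing \<Omega> \<Gamma> (\<lambda>x. (grad \<phi> x \<bullet> ?\<nu> x) *\<^sub>R ?e x *\<^sub>R normal_deriv \<Omega> u x) (\<lambda>x. ?e x *\<^sub>R normal_deriv \<Omega> u x)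
     = (\<integral>x. complex_of_real (F x) \<partial>\<sigma>)"
    by (simp only: boundary_pairing_def set_lebesgue_integral_def)
  then show ?thesis by (simp only: boundary_term_def integral_complex_of_real Re_complex_of_real F_def)
qed

text \<open>The Laplacian term is the difference between the potential term and the full operator,
  and the square of a difference is at most twice the sum of the squares.\<close>

lemma potential_absorption:
  fixes u Lu q :: "real^'n \<Rightarrow> complex" and e :: "real^'n \<Rightarrow> real"
  assumes u: "continuous_on (closure \<Omega>) u" and Lu: "continuous_on (closure \<Omega>) Lu" and e: "continuous_on (closure \<Omega>) e"
    and q: "q \<in> borel_measurable (lebesgue_on \<Omega>)" "AE x in lebesgue_on \<Omega>. norm (q x) \<le> K" and K: "K \<ge> 0"
  shows "(\<integral>x. indicator \<Omega> x * (e x * (h\<^sup>2 * norm (Lu x)))\<^sup>2 \<partial>lborel) \<le>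
    2 * (L2norm_on \<Omega> (\<lambda>x. e x *\<^sub>R (- (h\<^sup>2 *\<^sub>R Lu x) + h\<^sup>2 *\<^sub>R (q x * u x))))\<^sup>2 +
    2 * (h\<^sup>2 * K)\<^sup>2 * (\<integral>x. indicator \<Omega> x * (e x * norm (u x))\<^sup>2 \<partial>lborel)"
proof -
  let ?M = "lebesgue_on \<Omega>"
  define X where "X x = e x *\<^sub>R (- (h\<^sup>2 *\<^sub>R Lu x) + h\<^sup>2 *\<^sub>R (q x * u x))" for x
  have meas: "F \<in> borel_measurable ?M" if "continuous_on (closure \<Omega>) F" for F :: "real^'n \<Rightarrow> 'z::euclidean_space"
    using continuous_on_subset[OF that closure_subset] domain_borel by (intro continuous_imp_measurable_on_sets_lebesgue) auto
  note [measurable] = meas[OF u] meas[OF Lu] meas[OF e] q(1)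
  have c1: "continuous_on (closure \<Omega>) (\<lambda>x. (e x * (h\<^sup>2 * norm (Lu x)))\<^sup>2)"
    and c2: "continuous_on (closure \<Omega>) (\<lambda>x. (e x * norm (u x))\<^sup>2)"
    by (intro continuous_intros u Lu e)+
  have c3: "continuous_on (closure \<Omega>) (\<lambda>x. (\<bar>e x\<bar> * (h\<^sup>2 * norm (Lu x) + h\<^sup>2 * (K * norm (u x))))\<^sup>2)"
    by (intro continuous_intros u Lu e)
  \<comment> \<open>Without integrability the integral in the norm would be 0 by convention and
    could bound nothing. Since \<open>q\<close> is only essentially bounded, the domination holds
    almost everywhere.\<close>
  have iX: "integrable ?M (\<lambda>x. (norm (X x))\<^sup>2)"
  proof (rule Bochner_Integration.integrable_bound[OF integral_lebesgue_on(1)[OF c3]])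
    show "(\<lambda>x. (norm (X x))\<^sup>2) \<in> borel_measurable ?M" unfolding X_def by measurable
    show "AE x in ?M. norm ((norm (X x))\<^sup>2) \<le> norm ((\<bar>e x\<bar> * (h\<^sup>2 * norm (Lu x) + h\<^sup>2 * (K * norm (u x))))\<^sup>2)"
      using q(2)
    proof eventually_elim
      case (elim x)
      have "norm (X x) \<le> \<bar>e x\<bar> * (norm (- (h\<^sup>2 *\<^sub>R Lu x)) + norm (h\<^sup>2 *\<^sub>R (q x * u x)))"
        unfolding X_def norm_scaleR[of "e x"] by (rule mult_left_mono[OF norm_triangle_ineq abs_ge_zero])
      also have "\<dots> \<le> \<bar>e x\<bar> * (h\<^sup>2 * norm (Lu x) + h\<^sup>2 * (K * norm (u x)))"
        using elim by (intro mult_left_mono add_mono) (auto simp: norm_mult intro!: mult_left_mono mult_right_mono)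
      finally have "(norm (X x))\<^sup>2 \<le> (\<bar>e x\<bar> * (h\<^sup>2 * norm (Lu x) + h\<^sup>2 * (K * norm (u x))))\<^sup>2"
        by (intro power_mono) auto
      then show ?case by simp
    qed
  qed
  have "(\<integral>x. (e x * (h\<^sup>2 * norm (Lu x)))\<^sup>2 \<partial>?M) \<le> (\<integral>x. 2 * (norm (X x))\<^sup>2 + 2 * (h\<^sup>2 * K)\<^sup>2 * (e x * norm (u x))\<^sup>2 \<partial>?M)"
  proof (rule integral_mono_AE)
    show "integrable ?M (\<lambda>x. 2 * (norm (X x))\<^sup>2 + 2 * (h\<^sup>2 * K)\<^sup>2 * (e x * norm (u x))\<^sup>2)"
      by (intro Bochner_Integration.integrable_add integrable_mult_right iX integral_lebesgue_on(1)[OF c2])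
    show "AE x in ?M. (e x * (h\<^sup>2 * norm (Lu x)))\<^sup>2 \<le> 2 * (norm (X x))\<^sup>2 + 2 * (h\<^sup>2 * K)\<^sup>2 * (e x * norm (u x))\<^sup>2"
      using q(2)
    proof eventually_elim
      case (elim x)
      define Y where "Y = e x *\<^sub>R (h\<^sup>2 *\<^sub>R (q x * u x))"
      have "norm (Y - X x) = \<bar>e x\<bar> * (h\<^sup>2 * norm (Lu x))"
        by (simp add: Y_def X_def scaleR_add_right scaleR_diff_right norm_mult abs_mult)
      then have "(e x * (h\<^sup>2 * norm (Lu x)))\<^sup>2 = (norm (Y - X x))\<^sup>2" by (simp add: power_mult_distrib)
      also have "\<dots> \<le> (norm Y + norm (X x))\<^sup>2" by (intro power_mono norm_triangle_ineq4) auto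
      also have "\<dots> \<le> 2 * (norm (X x))\<^sup>2 + 2 * (norm Y)\<^sup>2"
        using sum_squares_bound[of "norm Y" "norm (X x)"] by (simp add: power2_sum)
      also have "(norm Y)\<^sup>2 \<le> (h\<^sup>2 * K)\<^sup>2 * (e x * norm (u x))\<^sup>2"
      proof -
        have "norm Y \<le> \<bar>e x\<bar> * (h\<^sup>2 * (K * norm (u x)))"
          unfolding Y_def norm_scaleR norm_mult using elim K by (intro mult_left_mono mult_mono) auto
        then have "(norm Y)\<^sup>2 \<le> (\<bar>e x\<bar> * (h\<^sup>2 * (K * norm (u x))))\<^sup>2" by (intro power_mono) auto
        then show ?thesis by (simp add: power_mult_distrib mult_ac)
      qed
      finally show ?case by simp
    qed
  qed (rule integral_lebesgue_on(1)[OF c1])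
  also have "\<dots> = 2 * (\<integral>x. (norm (X x))\<^sup>2 \<partial>?M) + 2 * (h\<^sup>2 * K)\<^sup>2 * (\<integral>x. (e x * norm (u x))\<^sup>2 \<partial>?M)"
    by (subst Bochner_Integration.integral_add) (auto intro!: integrable_mult_right iX integral_lebesgue_on(1)[OF c2])
  finally show ?thesis
    unfolding integral_lebesgue_on(2)[OF c1] integral_lebesgue_on(2)[OF c2] L2norm_on_square X_def .
qed

end

text \<open>The free operator has real coefficients and acts on real and imaginary parts separately,
  but a complex \<open>q\<close> couples them. It is therefore brought in only after the two real
  estimates have been added.\<close>

theorem proposition3p2:
  fixes \<Omega>' \<Omega> :: "(real^'n::finite) set"
    and \<phi> :: "real^'n \<Rightarrow> real"
    and q :: "real^'n \<Rightarrow> complex"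
  assumes "CARD('n) \<ge> 2"
    and "open \<Omega>'"
    and "limiting_carleman_weight \<Omega>' \<phi>"
    and "open \<Omega>" and "compact (closure \<Omega>)" and "closure \<Omega> \<subseteq> \<Omega>'"
    and "smooth_boundary \<Omega>"
    and "q \<in> L_infty \<Omega>"
  shows "\<exists>C0>0. \<exists>h0>0. \<forall>u :: real^'n \<Rightarrow> complex. \<forall>h::real.
    smooth_on_closure \<Omega> u \<and> (\<forall>x\<in>frontier \<Omega>. u x = 0) \<and> 0 < h \<and> h \<le> h0 \<longrightarrow>
      - (h^3 / C0) * boundary_term \<Omega> (boundary_minus \<Omega> \<phi>) \<phi> h u
      + (h^2 / C0) * ((L2norm_on \<Omega> (\<lambda>x. exp (\<phi> x / h) *\<^sub>R u x))\<^sup>2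
                     + (L2norm_on \<Omega> (\<lambda>x. exp (\<phi> x / h) *\<^sub>R h *\<^sub>R grad u x))\<^sup>2)
      \<le> (L2norm_on \<Omega> (\<lambda>x. exp (\<phi> x / h) *\<^sub>R
            (- (h^2 *\<^sub>R laplacian u x) + h^2 *\<^sub>R (q x * u x))))\<^sup>2
        + C0 * h^3 * boundary_term \<Omega> (boundary_plus \<Omega> \<phi>) \<phi> h u"
proof -
  interpret smooth_domain \<Omega> by standard fact+
  have sm: "smooth_on \<Omega>' \<phi>" using assms(3) by (simp add: limiting_carleman_weight_def)
  obtain C h1 where C: "C \<ge> 1" and h1: "h1 > 0" and real: "\<And>V u u' u'' h. open V \<Longrightarrow> closure \<Omega> \<subseteq> V \<Longrightarrow> C1_grad V u u' \<Longrightarrow>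
      (\<And>i. C1_grad V (\<lambda>x. u' x $ i) (u'' i)) \<Longrightarrow> (\<And>x. x \<in> frontier \<Omega> \<Longrightarrow> u x = 0) \<Longrightarrow> 0 < h \<Longrightarrow> h \<le> h1 \<Longrightarrow>
    (h\<^sup>2 / C) * (\<integral>x. indicator \<Omega> x * ((exp (\<phi> x / h))\<^sup>2 * ((u x)\<^sup>2 + h\<^sup>2 * (norm (u' x))\<^sup>2)) \<partial>lborel)
      - h^3 * (\<integral>x. indicator (boundary_minus \<Omega> \<phi>) x * ((grad \<phi> x \<bullet> outer_normal \<Omega> x) * (exp (\<phi> x / h) * (u' x \<bullet> outer_normal \<Omega> x))\<^sup>2) \<partial>\<sigma>)
    \<le> C * (\<integral>x. indicator \<Omega> x * (exp (\<phi> x / h) * (h\<^sup>2 * (\<Sum>i\<in>UNIV. u'' i x $ i)))\<^sup>2 \<partial>lborel)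
      + C * h^3 * (\<integral>x. indicator (boundary_plus \<Omega> \<phi>) x * ((grad \<phi> x \<bullet> outer_normal \<Omega> x) * (exp (\<phi> x / h) * (u' x \<bullet> outer_normal \<Omega> x))\<^sup>2) \<partial>\<sigma>)"
    using real_carleman_estimate[OF assms(2,6,3)] by (elim exE conjE) (rule that, assumption, assumption, blast)
  obtain K0 where q: "q \<in> borel_measurable (lebesgue_on \<Omega>)" and K0: "AE x in lebesgue_on \<Omega>. norm (q x) \<le> K0"
    using assms(8) by (auto simp: L_infty_def)
  define K where "K = max K0 0"
  have K: "K \<ge> 0" "AE x in lebesgue_on \<Omega>. norm (q x) \<le> K" using K0 by (auto simp: K_def)
  \<comment> \<open>The second bound gives 2 C K h \<le> 1, so that the potential costs at most half
    of the gain.\<close>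
  define h0 where "h0 = min h1 (1 / (2 * C * (K + 1)))"
  have h0: "h0 > 0" using h1 C K by (simp add: h0_def)
  \<comment> \<open>The square of 2 C: halving the gain leaves h^2 / (2 C), and a further division
    by 2 C gives the operator norm the coefficient 1.\<close>
  define C0 where "C0 = 4 * C\<^sup>2"
  have C0: "C0 > 0" using C by (simp add: C0_def)
  have main: "- (h^3 / C0) * boundary_term \<Omega> (boundary_minus \<Omega> \<phi>) \<phi> h u
      + (h^2 / C0) * ((L2norm_on \<Omega> (\<lambda>x. exp (\<phi> x / h) *\<^sub>R u x))\<^sup>2
                     + (L2norm_on \<Omega> (\<lambda>x. exp (\<phi> x / h) *\<^sub>R h *\<^sub>R grad u x))\<^sup>2)
      \<le> (L2norm_on \<Omega> (\<lambda>x. exp (\<phi> x / h) *\<^sub>R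
            (- (h^2 *\<^sub>R laplacian u x) + h^2 *\<^sub>R (q x * u x))))\<^sup>2
        + C0 * h^3 * boundary_term \<Omega> (boundary_plus \<Omega> \<phi>) \<phi> h u"
    if V: "open V" "closure \<Omega> \<subseteq> V" and u: "smooth_on V u" and zero: "\<And>x. x \<in> frontier \<Omega> \<Longrightarrow> u x = 0"
      and h: "0 < h" "h \<le> h0" for V h and u :: "real^'n \<Rightarrow> complex"
  proof -
    have hh: "h \<le> h1" "h \<le> 1 / (2 * C * (K + 1))" using h by (auto simp: h0_def)
    define e where "e x = exp (\<phi> x / h)" for x
    define ur where "ur x = (\<chi> i. Re (partial i u x))" for x
    define ui where "ui x = (\<chi> i. Im (partial i u x))" for x
    let ?I = "\<lambda>F. \<integral>x. indicator \<Omega> x * F x \<partial>lborel"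
    let ?B = "\<lambda>\<Gamma> F. \<integral>x. indicator \<Gamma> x * F x \<partial>\<sigma>"
    define b where "b d x = (grad \<phi> x \<bullet> outer_normal \<Omega> x) * (e x * (d x \<bullet> outer_normal \<Omega> x))\<^sup>2" for d :: "real^'n \<Rightarrow> real^'n" and x
    have lapr: "(\<Sum>i\<in>UNIV. (\<chi> j. Re (partial j (partial i u) x)) $ i) = Re (laplacian u x)"
      and lapi: "(\<Sum>i\<in>UNIV. (\<chi> j. Im (partial j (partial i u) x)) $ i) = Im (laplacian u x)" for x
      by (simp_all add: laplacian_def)
    have est_r: "(h\<^sup>2 / C) * ?I (\<lambda>x. (e x)\<^sup>2 * ((Re (u x))\<^sup>2 + h\<^sup>2 * (norm (ur x))\<^sup>2)) - h^3 * ?B (boundary_minus \<Omega> \<phi>) (b ur)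
      \<le> C * ?I (\<lambda>x. (e x * (h\<^sup>2 * Re (laplacian u x)))\<^sup>2) + C * h^3 * ?B (boundary_plus \<Omega> \<phi>) (b ur)"
      unfolding e_def b_def lapr[symmetric]
    proof (rule real[OF V _ _ _ h(1) hh(1)])
      show "C1_grad V (\<lambda>x. Re (u x)) ur"
        unfolding ur_def by (rule C1_grad_bounded_linear[OF u bounded_linear_Re])
      show "C1_grad V (\<lambda>x. ur x $ i) (\<lambda>x. \<chi> j. Re (partial j (partial i u) x))" for i
        unfolding ur_def vec_lambda_beta by (rule C1_grad_bounded_linear[OF smooth_on_partial[OF u] bounded_linear_Re])
    qed (simp add: zero)
    have est_i: "(h\<^sup>2 / C) * ?I (\<lambda>x. (e x)\<^sup>2 * ((Im (u x))\<^sup>2 + h\<^sup>2 * (norm (ui x))\<^sup>2)) - h^3 * ?B (boundary_minus \<Omega> \<phi>) (b ui)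
      \<le> C * ?I (\<lambda>x. (e x * (h\<^sup>2 * Im (laplacian u x)))\<^sup>2) + C * h^3 * ?B (boundary_plus \<Omega> \<phi>) (b ui)"
      unfolding e_def b_def lapi[symmetric]
    proof (rule real[OF V _ _ _ h(1) hh(1)])
      show "C1_grad V (\<lambda>x. Im (u x)) ui"
        unfolding ui_def by (rule C1_grad_bounded_linear[OF u bounded_linear_Im])
      show "C1_grad V (\<lambda>x. ui x $ i) (\<lambda>x. \<chi> j. Im (partial j (partial i u) x))" for i
        unfolding ui_def vec_lambda_beta by (rule C1_grad_bounded_linear[OF smooth_on_partial[OF u] bounded_linear_Im])
    qed (simp add: zero)
    have cu: "continuous_on (closure \<Omega>) u" "continuous_on (closure \<Omega>) (partial i u)" "continuous_on (closure \<Omega>) (partial i (partial i u))" for i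
      by (rule continuous_on_subset[OF smooth_on_continuous V(2)]; intro smooth_on_partial u)+
    have cl: "continuous_on (closure \<Omega>) (laplacian u)" unfolding laplacian_def[abs_def] by (intro continuous_intros cu)
    have cr: "continuous_on (closure \<Omega>) ur" "continuous_on (closure \<Omega>) ui"
      unfolding ur_def ui_def by (intro continuous_on_vec_lambda continuous_intros cu)+
    have cg: "continuous_on (closure \<Omega>) (grad u)" unfolding grad_def[abs_def] by (intro continuous_on_vec_lambda cu)
    have c\<phi>: "continuous_on (closure \<Omega>) \<phi>" "continuous_on (closure \<Omega>) (grad \<phi>)"
      using continuous_on_subset[OF smooth_on_continuous[OF sm] assms(6)]
        continuous_on_subset[OF C1_grad_continuous_grad[OF smooth_on_C1_grad[OF sm]] assms(6)] by simp_all
    have ce: "continuous_on (closure \<Omega>) e" unfolding e_def using h(1) by (intro continuous_intros c\<phi>) auto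
    note cf = c\<phi>[THEN continuous_on_subset[OF _ frontier_subset_closure]] cr[THEN continuous_on_subset[OF _ frontier_subset_closure]]
      ce[THEN continuous_on_subset[OF _ frontier_subset_closure]]
    have cb: "continuous_on (frontier \<Omega>) (b ur)" "continuous_on (frontier \<Omega>) (b ui)"
      unfolding b_def by (intro continuous_intros cf continuous_outer_normal)+
    define U where "U = ?I (\<lambda>x. (e x)\<^sup>2 * ((norm (u x))\<^sup>2 + h\<^sup>2 * (norm (grad u x))\<^sup>2))"
    define J where "J = ?I (\<lambda>x. (e x * (h\<^sup>2 * norm (laplacian u x)))\<^sup>2)"
    define Bm where "Bm = boundary_term \<Omega> (boundary_minus \<Omega> \<phi>) \<phi> h u"
    define Bp where "Bp = boundary_term \<Omega> (boundary_plus \<Omega> \<phi>) \<phi> h u"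
    define R where "R = (L2norm_on \<Omega> (\<lambda>x. exp (\<phi> x / h) *\<^sub>R (- (h^2 *\<^sub>R laplacian u x) + h^2 *\<^sub>R (q x * u x))))\<^sup>2"
    have Bsum: "boundary_term \<Omega> \<Gamma> \<phi> h u = ?B \<Gamma> (b ur) + ?B \<Gamma> (b ui)" if \<Gamma>: "closed \<Gamma>" "\<Gamma> \<subseteq> frontier \<Omega>" for \<Gamma>
    proof -
      have "boundary_term \<Omega> \<Gamma> \<phi> h u = (\<integral>x. indicator \<Gamma> x * b ur x + indicator \<Gamma> x * b ui x \<partial>\<sigma>)"
        unfolding boundary_term_eq[OF u V(2) \<Gamma>(2)] by (simp add: b_def e_def ur_def ui_def distrib_left)
      then show ?thesis using integrable_frontier_part[OF \<Gamma> cb(1)] integrable_frontier_part[OF \<Gamma> cb(2)] by simp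
    qed
    note clb = closed_boundary_parts[OF c\<phi>(2)]
    have Bm: "Bm = ?B (boundary_minus \<Omega> \<phi>) (b ur) + ?B (boundary_minus \<Omega> \<phi>) (b ui)"
      unfolding Bm_def by (rule Bsum[OF clb(2)]) (auto simp: boundary_minus_def)
    have Bp: "Bp = ?B (boundary_plus \<Omega> \<phi>) (b ur) + ?B (boundary_plus \<Omega> \<phi>) (b ui)"
      unfolding Bp_def by (rule Bsum[OF clb(1)]) (auto simp: boundary_plus_def)
    \<comment> \<open>The signs of the two boundary terms allow their coefficients to be weakened to
      those with the common constant \<open>C0\<close> at the end.\<close>
    have Bm0: "Bm \<le> 0"
    proof -
      have "?B (boundary_minus \<Omega> \<phi>) (b d) \<le> 0" for d
      proof -
        have "0 \<le> (\<integral>x. - (indicator (boundary_minus \<Omega> \<phi>) x * b d x) \<partial>\<sigma>)"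
          by (rule Bochner_Integration.integral_nonneg)
             (auto simp: indicator_def boundary_minus_def b_def mult_nonpos_nonneg)
        then show ?thesis by simp
      qed
      then show ?thesis unfolding Bm by (intro add_nonpos_nonpos)
    qed
    have Bp0: "Bp \<ge> 0"
    proof -
      have "?B (boundary_plus \<Omega> \<phi>) (b d) \<ge> 0" for d
        by (rule Bochner_Integration.integral_nonneg) (auto simp: indicator_def boundary_plus_def b_def)
      then show ?thesis unfolding Bp by (intro add_nonneg_nonneg)
    qed
    have U: "U = ?I (\<lambda>x. (e x)\<^sup>2 * ((Re (u x))\<^sup>2 + h\<^sup>2 * (norm (ur x))\<^sup>2)) + ?I (\<lambda>x. (e x)\<^sup>2 * ((Im (u x))\<^sup>2 + h\<^sup>2 * (norm (ui x))\<^sup>2))"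
    proof -
      have "U = (\<integral>x. indicator \<Omega> x * ((e x)\<^sup>2 * ((Re (u x))\<^sup>2 + h\<^sup>2 * (norm (ur x))\<^sup>2)) +
          indicator \<Omega> x * ((e x)\<^sup>2 * ((Im (u x))\<^sup>2 + h\<^sup>2 * (norm (ui x))\<^sup>2)) \<partial>lborel)"
        unfolding U_def by (simp add: cmod_power2 norm_grad_complex ur_def ui_def algebra_simps)
      also have "\<dots> = ?I (\<lambda>x. (e x)\<^sup>2 * ((Re (u x))\<^sup>2 + h\<^sup>2 * (norm (ur x))\<^sup>2)) + ?I (\<lambda>x. (e x)\<^sup>2 * ((Im (u x))\<^sup>2 + h\<^sup>2 * (norm (ui x))\<^sup>2))"
        by (intro Bochner_Integration.integral_add integrable_domain continuous_intros cu cr ce)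
      finally show ?thesis .
    qed
    have J: "J = ?I (\<lambda>x. (e x * (h\<^sup>2 * Re (laplacian u x)))\<^sup>2) + ?I (\<lambda>x. (e x * (h\<^sup>2 * Im (laplacian u x)))\<^sup>2)"
    proof -
      have "J = (\<integral>x. indicator \<Omega> x * (e x * (h\<^sup>2 * Re (laplacian u x)))\<^sup>2 + indicator \<Omega> x * (e x * (h\<^sup>2 * Im (laplacian u x)))\<^sup>2 \<partial>lborel)"
        unfolding J_def by (simp add: cmod_power2 power_mult_distrib distrib_left)
      also have "\<dots> = ?I (\<lambda>x. (e x * (h\<^sup>2 * Re (laplacian u x)))\<^sup>2) + ?I (\<lambda>x. (e x * (h\<^sup>2 * Im (laplacian u x)))\<^sup>2)"
        by (intro Bochner_Integration.integral_add integrable_domain continuous_intros cl ce)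
      finally show ?thesis .
    qed
    have est: "(h\<^sup>2 / C) * U - h^3 * Bm \<le> C * J + C * h^3 * Bp"
      unfolding U J Bm Bp distrib_left[of "h\<^sup>2 / C"] distrib_left[of "h^3"] distrib_left[of C] distrib_left[of "C * h^3"]
      using est_r est_i by linarith
    have cc: "continuous_on (closure \<Omega>) (\<lambda>x. (e x * norm (u x))\<^sup>2)" "continuous_on (closure \<Omega>) (\<lambda>x. (e x * (h * norm (grad u x)))\<^sup>2)"
      by (intro continuous_intros ce cu cg)+
    have n1: "(L2norm_on \<Omega> (\<lambda>x. exp (\<phi> x / h) *\<^sub>R u x))\<^sup>2 = ?I (\<lambda>x. (e x * norm (u x))\<^sup>2)"
      unfolding L2norm_on_square integral_lebesgue_on(2)[OF cc(1), symmetric] by (simp add: e_def)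
    have n2: "(L2norm_on \<Omega> (\<lambda>x. exp (\<phi> x / h) *\<^sub>R h *\<^sub>R grad u x))\<^sup>2 = ?I (\<lambda>x. (e x * (h * norm (grad u x)))\<^sup>2)"
      unfolding L2norm_on_square integral_lebesgue_on(2)[OF cc(2), symmetric] using h(1) by (simp add: e_def mult.assoc)
    have U2: "U = ?I (\<lambda>x. (e x * norm (u x))\<^sup>2) + ?I (\<lambda>x. (e x * (h * norm (grad u x)))\<^sup>2)"
    proof -
      have "U = (\<integral>x. indicator \<Omega> x * (e x * norm (u x))\<^sup>2 + indicator \<Omega> x * (e x * (h * norm (grad u x)))\<^sup>2 \<partial>lborel)"
        unfolding U_def by (simp add: power_mult_distrib distrib_left)
      also have "\<dots> = ?I (\<lambda>x. (e x * norm (u x))\<^sup>2) + ?I (\<lambda>x. (e x * (h * norm (grad u x)))\<^sup>2)"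
        by (intro Bochner_Integration.integral_add integrable_domain cc)
      finally show ?thesis .
    qed
    have U0: "?I (\<lambda>x. (e x * norm (u x))\<^sup>2) \<le> U" "U \<ge> 0"
    proof -
      have "?I (\<lambda>x. (e x * (h * norm (grad u x)))\<^sup>2) \<ge> 0" "?I (\<lambda>x. (e x * norm (u x))\<^sup>2) \<ge> 0"
        by (rule Bochner_Integration.integral_nonneg; simp)+
      then show "?I (\<lambda>x. (e x * norm (u x))\<^sup>2) \<le> U" "U \<ge> 0" unfolding U2 by simp_all
    qed
    have "J \<le> 2 * R + 2 * (h\<^sup>2 * K)\<^sup>2 * ?I (\<lambda>x. (e x * norm (u x))\<^sup>2)"
      unfolding J_def R_def e_def[symmetric] by (rule potential_absorption[OF cu(1) cl ce q K(2,1)])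
    also have "\<dots> \<le> 2 * R + 2 * (h\<^sup>2 * K)\<^sup>2 * U" using U0 by (intro add_left_mono mult_left_mono) auto
    finally have J_le: "C * J \<le> 2 * C * R + (2 * C * (h\<^sup>2 * K)\<^sup>2) * U"
      using C mult_left_mono[of J "2 * R + 2 * (h\<^sup>2 * K)\<^sup>2 * U" C] by (simp add: algebra_simps)
    have "2 * C * (h\<^sup>2 * K)\<^sup>2 \<le> h\<^sup>2 / (2 * C)"
    proof -
      have "h * (2 * C * (K + 1)) \<le> 1" using hh(2) C K by (simp add: pos_le_divide_eq)
      moreover have "h * (2 * C * K) \<le> h * (2 * C * (K + 1))" using h C by (intro mult_left_mono) auto
      ultimately have "h * (2 * C * K) \<le> 1" by linarith
      then have "(h * (2 * C * K))\<^sup>2 \<le> 1\<^sup>2" using h C K by (intro power_mono) auto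
      then have "(h\<^sup>2 / (2 * C)) * (h * (2 * C * K))\<^sup>2 \<le> (h\<^sup>2 / (2 * C)) * 1" using C by (intro mult_left_mono) auto
      moreover have "(h\<^sup>2 / (2 * C)) * (h * (2 * C * K))\<^sup>2 = 2 * C * (h\<^sup>2 * K)\<^sup>2"
        using C by (simp add: power2_eq_square)
      ultimately show ?thesis by simp
    qed
    then have small: "(2 * C * (h\<^sup>2 * K)\<^sup>2) * U \<le> (h\<^sup>2 / (2 * C)) * U" using U0(2) by (rule mult_right_mono)
    have half: "(h\<^sup>2 / C) * U = (h\<^sup>2 / (2 * C)) * U + (h\<^sup>2 / (2 * C)) * U" using C by (simp add: field_simps)
    \<comment> \<open>Stated for plain variables, so that linear arithmetic is not confronted with
      products.\<close>
    have absorb: "a \<le> d \<Longrightarrow> c = d + d \<Longrightarrow> c - m \<le> j + bp \<Longrightarrow> j \<le> r + a \<Longrightarrow> d - m \<le> r + bp"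
      for a c d m j bp r :: real by linarith
    have key: "(h\<^sup>2 / (2 * C)) * U - h^3 * Bm \<le> 2 * C * R + C * h^3 * Bp"
      by (rule absorb[OF small half est J_le])
    \<comment> \<open>Normalises the coefficient of \<open>R\<close> to 1.\<close>
    have "(1 / (2 * C)) * ((h\<^sup>2 / (2 * C)) * U - h^3 * Bm) \<le> (1 / (2 * C)) * (2 * C * R + C * h^3 * Bp)"
      using key C by (intro mult_left_mono) auto
    moreover have "(1 / (2 * C)) * ((h\<^sup>2 / (2 * C)) * U - h^3 * Bm) = (h\<^sup>2 / C0) * U - (1 / (2 * C)) * (h^3 * Bm)"
      by (simp add: right_diff_distrib C0_def power2_eq_square)
    moreover have "(1 / (2 * C)) * (2 * C * R + C * h^3 * Bp) = R + (1 / 2) * (h^3 * Bp)"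
      using C by (simp add: distrib_left)
    ultimately have final: "(h\<^sup>2 / C0) * U - (1 / (2 * C)) * (h^3 * Bm) \<le> R + (1 / 2) * (h^3 * Bp)" by simp
    have "1 / C0 \<le> 1 / (2 * C)"
      using C by (simp add: C0_def power2_eq_square field_simps)
    then have m: "(1 / (2 * C)) * (h^3 * Bm) \<le> (1 / C0) * (h^3 * Bm)"
      using Bm0 h by (intro mult_right_mono_neg) (auto simp: mult_nonneg_nonpos)
    have "1 / 2 \<le> C0" using C mult_mono[of 1 C 1 C] by (simp add: C0_def power2_eq_square)
    then have "(1 / 2) * (h^3 * Bp) \<le> C0 * (h^3 * Bp)" using Bp0 h by (intro mult_right_mono) auto
    with final m have "- (h^3 / C0) * Bm + (h\<^sup>2 / C0) * U \<le> R + C0 * h^3 * Bp" by (simp add: mult.assoc)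
    then show ?thesis unfolding n1 n2 U2[symmetric] Bm_def Bp_def R_def .
  qed
  show ?thesis
    by (rule exI[of _ C0], rule conjI[OF C0], rule exI[of _ h0], rule conjI[OF h0])
       (use main in \<open>auto simp: smooth_on_closure_def\<close>)
qed

end
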